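(* Let $s>\frac12$. Consider the initial value problem $$ i\partial_t w+\partial_x^2 w+2\operatorname{Re} w=G[w],\qquad w(0)=w_0,\qquad G[w]:=-\big(2|w|^2+w^2+|w|^2w\big), \tag{$*$}$$ for $w=w(t,x)\in\mathbb{C}$, $x\in\mathbb{R}$. Then: (1) For any $T>0$ there exists $\delta=\delta(T)>0$ such that for any $w_0\in H^s(\mathbb{R})$ with $\|w_0\|_{H^s}<\delta$ there exists a unique solution $w\in C([0,T];H^s(\mathbb{R}))$ of $( * )$. (2) A corresponding result holds with no size restriction provided the time is small: for any $w_0\in H^s(\mathbb{R})$ there exists a unique solution $w\in C([0,T];H^s(\mathbb{R}))$ of $( * )$, provided $T>0$ is chosen small enough. (3) (Blow-up alternative) If $I$ is the maximal interval of existence of $w$ and $\sup I<+\infty$, then $\lim_{t\uparrow\sup I}\|w(t)\|_{H^s}=+\infty$.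
   Context: The equation $( * )$ arises from the focusing cubic NLS $i\partial_tu+\partial_x^2u+|u|^2u=0$ by writing $u(t,x)=e^{it}(1+w(t,x))$. $H^s(\mathbb{R})$ is the usual Sobolev space of complex-valued functions; $\hat{\ }$ is the Fourier transform in $x$. For $t\in\mathbb{R}$, $\xi\in\mathbb{R}$ set $C_t(\xi)=\cosh(|\xi|\sqrt{2-\xi^2}\,t)$ and $S_t(\xi)=\frac{\sinh(|\xi|\sqrt{2-\xi^2}\,t)}{|\xi|\sqrt{2-\xi^2}}$ if $|\xi|\le\sqrt2$, and $C_t(\xi)=\cos(|\xi|\sqrt{\xi^2-2}\,t)$ and $S_t(\xi)=\frac{\sin(|\xi|\sqrt{\xi^2-2}\,t)}{|\xi|\sqrt{\xi^2-2}}$ if $|\xi|>\sqrt2$ (with $S_t=t$ at the removable singularities $\xi=0$, $|\xi|=\sqrt2$). Write $w=\phi+i\varphi$, $w_0=\phi_0+i\varphi_0$, $G[w]=f+ig$ with $\phi,\varphi,\phi_0,\varphi_0,f,g$ real-valued. A function $w\in C([0,T];H^s(\mathbb{R}))$ is a (strong) solution of $( * )$ if it satisfies the equation in the integral (Duhamel) sense: for $t\in[0,T]$, $$\hat\phi(t,\xi)=C_t(\xi)\hat\phi_0(\xi)+S_t(\xi)\xi^2\hat\varphi_0(\xi)+\int_0^tC_{t-\sigma}(\xi)\hat g(\sigma,\xi)\,d\sigma-\int_0^tS_{t-\sigma}(\xi)\xi^2\hat f(\sigma,\xi)\,d\sigma,$$ $$\hat\varphi(t,\xi)=C_t(\xi)\hat\varphi_0(\xi)+S_t(\xi)(2-\xi^2)\hat\phi_0(\xi)-\int_0^tC_{t-\sigma}(\xi)\hat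 f(\sigma,\xi)\,d\sigma+\int_0^tS_{t-\sigma}(\xi)(2-\xi^2)\hat g(\sigma,\xi)\,d\sigma .$$ The maximal interval of existence $I$ (forward in time) is the union of all intervals $[0,T]$ on which a solution in $C([0,T];H^s(\mathbb{R}))$ with datum $w_0$ exists. *)

theory Defs
  imports "HOL-Analysis.Analysis"
begin

text \<open>Elements of $L^2$ and $H^s$ are represented by Borel functions \<open>real \<Rightarrow> complex\<close>;
  equality of such elements is equality almost everywhere.\<close>

definition L2 :: "(real \<Rightarrow> complex) \<Rightarrow> bool" where
  "L2 f \<longleftrightarrow> f \<in> borel_measurable lborel \<and> integrable lborel (\<lambda>x. (cmod (f x))\<^sup>2)"

definition fourier_integral :: "(real \<Rightarrow> complex) \<Rightarrow> real \<Rightarrow> complex" where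
  "fourier_integral f \<xi> = (LINT x|lborel. cis (- (x * \<xi>)) * f x)"

text \<open>\<open>F\<close> is the Plancherel transform of \<open>f\<close>: the $L^2$-limit of the Fourier integrals of the
  truncations of \<open>f\<close> to $[-R,R]$. It is unique up to null sets. The nonnegative integral is used
  so that a non-integrable difference counts as infinite.\<close>

definition plancherel_transform :: "(real \<Rightarrow> complex) \<Rightarrow> (real \<Rightarrow> complex) \<Rightarrow> bool" where
  "plancherel_transform f F \<longleftrightarrow> L2 f \<and> L2 F \<and>
     ((\<lambda>R. \<integral>\<^sup>+ \<xi>. ennreal ((cmod (F \<xi> -
          fourier_integral (\<lambda>x. indicator {-R..R} x * f x) \<xi>))\<^sup>2) \<partial>lborel) \<longlongrightarrow> 0) at_top"

text \<open>The Fourier transform on $L^1$ and on $L^2$. On $L^1$ it is the integral itself,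
  hence defined at every frequency; on the rest of $L^2$ it is a representative of the Plancherel
  transform, which is meaningful almost everywhere only. On $L^1 \cap L^2$ the two agree almost
  everywhere.\<close>

definition fourier :: "(real \<Rightarrow> complex) \<Rightarrow> real \<Rightarrow> complex" where
  "fourier f = (if integrable lborel f then fourier_integral f
                else (SOME F. plancherel_transform f F))"

text \<open>Only meant for $s \ge 0$, where $H^s$ is contained in $L^2$. The norm is meaningful on members of \<open>Hs s\<close> only.\<close>

definition Hs :: "real \<Rightarrow> (real \<Rightarrow> complex) set" where
  "Hs s = {f. L2 f \<and> integrable lborel (\<lambda>\<xi>. (1 + \<xi>\<^sup>2) powr s * (cmod (fourier f \<xi>))\<^sup>2)}"

definition Hs_norm :: "real \<Rightarrow> (real \<Rightarrow> complex) \<Rightarrow> real" where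
  "Hs_norm s f = sqrt (LINT \<xi>|lborel. (1 + \<xi>\<^sup>2) powr s * (cmod (fourier f \<xi>))\<^sup>2)"

definition C_Hs :: "real \<Rightarrow> real \<Rightarrow> (real \<Rightarrow> real \<Rightarrow> complex) \<Rightarrow> bool" where
  "C_Hs s T w \<longleftrightarrow> (\<forall>t\<in>{0..T}. w t \<in> Hs s) \<and>
     (\<forall>t\<in>{0..T}. ((\<lambda>r. Hs_norm s (\<lambda>x. w r x - w t x)) \<longlongrightarrow> 0) (at t within {0..T}))"

definition C_mult :: "real \<Rightarrow> real \<Rightarrow> real" where
  "C_mult t \<xi> = (if \<bar>\<xi>\<bar> \<le> sqrt 2 then cosh (\<bar>\<xi>\<bar> * sqrt (2 - \<xi>\<^sup>2) * t)
                 else cos (\<bar>\<xi>\<bar> * sqrt (\<xi>\<^sup>2 - 2) * t))"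

definition S_mult :: "real \<Rightarrow> real \<Rightarrow> real" where
  "S_mult t \<xi> =
     (if \<xi> = 0 \<or> \<bar>\<xi>\<bar> = sqrt 2 then t
      else if \<bar>\<xi>\<bar> \<le> sqrt 2 then sinh (\<bar>\<xi>\<bar> * sqrt (2 - \<xi>\<^sup>2) * t) / (\<bar>\<xi>\<bar> * sqrt (2 - \<xi>\<^sup>2))
      else sin (\<bar>\<xi>\<bar> * sqrt (\<xi>\<^sup>2 - 2) * t) / (\<bar>\<xi>\<bar> * sqrt (\<xi>\<^sup>2 - 2)))"

definition G :: "complex \<Rightarrow> complex" where
  "G z = - (2 * of_real ((cmod z)\<^sup>2) + z\<^sup>2 + of_real ((cmod z)\<^sup>2) * z)"

definition Re_hat :: "(real \<Rightarrow> complex) \<Rightarrow> real \<Rightarrow> complex" where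
  "Re_hat u = fourier (\<lambda>x. of_real (Re (u x)))"

definition Im_hat :: "(real \<Rightarrow> complex) \<Rightarrow> real \<Rightarrow> complex" where
  "Im_hat u = fourier (\<lambda>x. of_real (Im (u x)))"

text \<open>The Duhamel formulas are identities in $L^2$, hence hold for almost every frequency. For
  $s > 1/2$ and \<open>w\<close> continuous in $H^s$, the nonlinearity is continuous in time with values in
  $L^1$; so its transforms are Fourier integrals, continuous in time at each frequency, and the
  time integrals below are pointwise ordinary ones that do not depend on a choice of
  representatives.\<close>

definition is_solution ::
  "real \<Rightarrow> real \<Rightarrow> (real \<Rightarrow> complex) \<Rightarrow> (real \<Rightarrow> real \<Rightarrow> complex) \<Rightarrow> bool" where
  "is_solution s T w0 w \<longleftrightarrow> C_Hs s T w \<and>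
     (\<forall>t\<in>{0..T}. AE \<xi> in lborel.
        Re_hat (w t) \<xi> =
            of_real (C_mult t \<xi>) * Re_hat w0 \<xi>
          + of_real (S_mult t \<xi> * \<xi>\<^sup>2) * Im_hat w0 \<xi>
          + (LINT \<sigma>:{0..t}|lborel. of_real (C_mult (t - \<sigma>) \<xi>) * Im_hat (\<lambda>x. G (w \<sigma> x)) \<xi>)
          - (LINT \<sigma>:{0..t}|lborel. of_real (S_mult (t - \<sigma>) \<xi> * \<xi>\<^sup>2) * Re_hat (\<lambda>x. G (w \<sigma> x)) \<xi>)
      \<and> Im_hat (w t) \<xi> =
            of_real (C_mult t \<xi>) * Im_hat w0 \<xi>
          + of_real (S_mult t \<xi> * (2 - \<xi>\<^sup>2)) * Re_hat w0 \<xi>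
          - (LINT \<sigma>:{0..t}|lborel. of_real (C_mult (t - \<sigma>) \<xi>) * Re_hat (\<lambda>x. G (w \<sigma> x)) \<xi>)
          + (LINT \<sigma>:{0..t}|lborel. of_real (S_mult (t - \<sigma>) \<xi> * (2 - \<xi>\<^sup>2)) * Im_hat (\<lambda>x. G (w \<sigma> x)) \<xi>))"

definition ex_unique_solution :: "real \<Rightarrow> real \<Rightarrow> (real \<Rightarrow> complex) \<Rightarrow> bool" where
  "ex_unique_solution s T w0 \<longleftrightarrow>
     (\<exists>w. is_solution s T w0 w \<and>
        (\<forall>v. is_solution s T w0 v \<longrightarrow> (\<forall>t\<in>{0..T}. AE x in lborel. v t x = w t x)))"

definition max_interval :: "real \<Rightarrow> (real \<Rightarrow> complex) \<Rightarrow> real set" where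
  "max_interval s w0 = \<Union> {{0..T} | T. 0 < T \<and> (\<exists>w. is_solution s T w0 w)}"

text \<open>The values of \<open>w\<close> outside the maximal interval are irrelevant.\<close>

definition is_maximal_solution ::
  "real \<Rightarrow> (real \<Rightarrow> complex) \<Rightarrow> (real \<Rightarrow> real \<Rightarrow> complex) \<Rightarrow> bool" where
  "is_maximal_solution s w0 w \<longleftrightarrow> (\<forall>T\<in>max_interval s w0. is_solution s T w0 w)"

end

theory Submission
  imports Defs "HOL-Probability.Levy"
begin

text \<open>
  Multiplying the Fourier transform by $(1+\<xi>^2)^{s/2}$ identifies $H^s$ modulo null sets with the
  Banach space \<open>l2\<close> of classes of square-integrable functions; \<open>E\<close> and \<open>D\<close> are the identification
  and its inverse. In these coordinates the linear part of the equation is a group \<open>V\<close> of Fourier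
  multiplier operators that couple the frequencies \<open>\<xi>\<close> and \<open>- \<xi>\<close> by $2 \times 2$ matrices of
  determinant one. These matrices are bounded uniformly in \<open>\<xi>\<close> for bounded times, so \<open>V\<close> is strongly
  continuous with locally bounded norms.

  For $s > 1/2$ the space $H^s$ is an algebra under pointwise multiplication (\<open>D_mult_Hs\<close>): by
  Cauchy and Schwarz this reduces to the integrability of $(1+\<xi>^2)^{-s}$. Hence the nonlinearity
  becomes a map \<open>K\<close> of the Banach space into itself that is a sum of quadratic and cubic terms in
  bounded bilinear maps. It is Lipschitz on balls, and its Lipschitz constant on the ball of radius
  \<open>r\<close> tends to zero with \<open>r\<close>.

  The problem is thereby the equation $u(t) = V(t) u_0 + \int_0^t V(t-\<sigma>) K(u(\<sigma>)) d\<sigma>$ in a Banach space,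
  and the three claims are general facts about it. The right-hand side is a contraction of a ball of
  curves as soon as the length of the time interval times the Lipschitz constant on the ball is small
  (\<open>mild_exists\<close>). Either the ball is small, which gives existence on a given interval for small
  data, or the interval is short, which gives local existence for all data. Uniqueness holds without a
  size restriction by Gronwall's inequality (\<open>mild_unique\<close>). Since the length of the interval depends on
  the size of the datum only, a solution whose norm is at most \<open>Z\<close> at times arbitrarily close to the end
  of its interval can be restarted and continued beyond the end (\<open>mild_glue\<close>, \<open>blow_up_alternative\<close>).

  Two bridges lead from the stated problem to this equation. The first is the $L^2$ theory of the
  Fourier transform. Damping by Gaussians gives Bessel's inequality (\<open>bessel_inequality\<close>), and with it
  the convergence of the transforms of truncations, which is the definition of the Plancherel
  transform. Inversion (\<open>fourier_inv_fourier\<close>, \<open>fourier_inversion\<close>) is tested against modulated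
  Gaussians: their transforms are explicit, and they separate functions because an integrable
  function is determined by its Fourier integral, by the uniqueness theorem of Levy for characteristic
  functions. The second bridge compares the integrals. The stated formulas integrate in time at each
  frequency, whereas the equation above has a vector-valued integral; pairing both with modulated
  Gaussians shows that they agree almost everywhere (\<open>l2_integral_pointwise\<close>).
\<close>

section \<open>Square-integrable functions modulo null sets\<close>

lemma L2_borel [measurable_dest]: "L2 f \<Longrightarrow> f \<in> borel_measurable borel"
  by (simp add: L2_def)

lemma L2_integrable: "L2 f \<Longrightarrow> integrable lborel (\<lambda>x. (cmod (f x))\<^sup>2)"
  by (simp add: L2_def)

lemma L2I:
  assumes "f \<in> borel_measurable borel" "integrable lborel (\<lambda>x. (cmod (f x))\<^sup>2)"
  shows "L2 f"
  using assms by (simp add: L2_def)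

lemma L2_bound:
  assumes "f \<in> borel_measurable borel" "integrable lborel g"
    and "\<And>x. (cmod (f x))\<^sup>2 \<le> g x"
  shows "L2 f"
proof (rule L2I[OF assms(1)], rule Bochner_Integration.integrable_bound[OF assms(2)])
  show "AE x in lborel. norm ((cmod (f x))\<^sup>2) \<le> norm (g x)"
    using assms(3) by (auto intro!: AE_I2 order_trans[OF _ abs_ge_self])
qed (use assms(1) in measurable)

lemma cmod_add_squared_le: "(cmod (a + b))\<^sup>2 \<le> 2 * (cmod a)\<^sup>2 + 2 * (cmod b)\<^sup>2"
proof -
  have "(cmod (a + b))\<^sup>2 \<le> (cmod a + cmod b)\<^sup>2"
    by (intro power_mono norm_triangle_ineq) auto
  also have "\<dots> \<le> 2 * (cmod a)\<^sup>2 + 2 * (cmod b)\<^sup>2"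
    using sum_squares_bound[of "cmod a" "cmod b"] by (simp add: power2_sum)
  finally show ?thesis .
qed

lemma L2_add:
  assumes "L2 f" "L2 g" shows "L2 (\<lambda>x. f x + g x)"
proof -
  note [measurable] = assms[THEN L2_borel]
  show ?thesis
    by (rule L2_bound[where g = "\<lambda>x. 2 * (cmod (f x))\<^sup>2 + 2 * (cmod (g x))\<^sup>2"])
       (auto intro!: L2_integrable assms cmod_add_squared_le)
qed

lemma L2_bounded_mult:
  assumes "L2 f" "g \<in> borel_measurable borel" "\<And>x. cmod (g x) \<le> c"
  shows "L2 (\<lambda>x. g x * f x)"
proof -
  have [measurable]: "f \<in> borel_measurable borel" "g \<in> borel_measurable borel"
    using assms by (auto dest: L2_borel)
  show ?thesis
  proof (rule L2_bound[where g = "\<lambda>x. c\<^sup>2 * (cmod (f x))\<^sup>2"])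
    show "(cmod (g x * f x))\<^sup>2 \<le> c\<^sup>2 * (cmod (f x))\<^sup>2" for x
      using power_mono[OF assms(3)[of x], of 2] by (simp add: norm_mult power_mult_distrib mult_right_mono)
  qed (use L2_integrable[OF assms(1)] in auto)
qed

lemma L2_cmult: "L2 f \<Longrightarrow> L2 (\<lambda>x. c * f x)"
  using L2_bounded_mult[of f "\<lambda>_. c" "cmod c"] by simp

lemma L2_diff: "L2 f \<Longrightarrow> L2 g \<Longrightarrow> L2 (\<lambda>x. f x - g x)"
  using L2_add[of f "\<lambda>x. (-1) * g x"] L2_cmult[of g "-1"] by simp

lemma L2_zero: "L2 (\<lambda>x. 0)"
  by (simp add: L2_def)

lemma borel_measurable_cnj [measurable (raw)]:
  "f \<in> borel_measurable M \<Longrightarrow> (\<lambda>x. cnj (f x)) \<in> borel_measurable M"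
  by (rule borel_measurable_continuous_on[where f = cnj]) (auto intro: continuous_intros)

lemma L2_cnj: "L2 f \<Longrightarrow> L2 (\<lambda>x. cnj (f x))"
  by (auto simp: L2_def)

lemma lborel_integrable_reflect:
  fixes f :: "real \<Rightarrow> 'a :: {banach, second_countable_topology}"
  shows "integrable lborel (\<lambda>x. f (- x)) \<longleftrightarrow> integrable lborel f"
  using lborel_integrable_real_affine_iff[of "-1" f 0] by simp

lemma lborel_integral_reflect:
  fixes f :: "real \<Rightarrow> 'a :: {banach, second_countable_topology}"
  shows "(LINT x|lborel. f (- x)) = (LINT x|lborel. f x)"
  using lborel_integral_real_affine[of "-1" f 0] by simp

lemma lborel_AE_reflect:
  assumes "AE x in lborel. P x" shows "AE x :: real in lborel. P (- x)"
proof -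
  have "AE x in distr lborel borel uminus. P x"
    using assms by (simp only: lborel_distr_uminus)
  then obtain N where N: "N \<in> null_sets (distr lborel borel (uminus :: real \<Rightarrow> real))"
      "{x \<in> space (distr lborel borel (uminus :: real \<Rightarrow> real)). \<not> P x} \<subseteq> N"
    by (auto simp: eventually_ae_filter)
  have "uminus -` N \<in> null_sets lborel"
    using N(1) measurable_sets[of "uminus :: real \<Rightarrow> real" borel borel N]
    by (auto simp: null_sets_def emeasure_distr)
  moreover have "{x \<in> space lborel. \<not> P (- x)} \<subseteq> uminus -` N"
    using N(2) by auto
  ultimately show ?thesis
    by (auto simp: eventually_ae_filter)
qed

lemma L2_reflect: "L2 f \<Longrightarrow> L2 (\<lambda>x. f (- x))"
  using lborel_integrable_reflect[of "\<lambda>x. (cmod (f x))\<^sup>2"]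
    measurable_compose[of uminus lborel borel f borel] by (simp add: L2_def)

lemma L2_AE_cong:
  assumes "L2 f" "g \<in> borel_measurable borel" "AE x in lborel. f x = g x"
  shows "L2 g"
proof (rule L2I[OF assms(2)])
  have [measurable]: "f \<in> borel_measurable borel" "g \<in> borel_measurable borel"
    using assms by (auto dest: L2_borel)
  have "integrable lborel (\<lambda>x. (cmod (f x))\<^sup>2) \<longleftrightarrow> integrable lborel (\<lambda>x. (cmod (g x))\<^sup>2)"
    by (rule integrable_cong_AE) (use assms(3) in auto)
  then show "integrable lborel (\<lambda>x. (cmod (g x))\<^sup>2)"
    using L2_integrable[OF assms(1)] by simp
qed

lemma L2_mult_integrable:
  assumes "L2 f" "L2 g" shows "integrable lborel (\<lambda>x. f x * g x)"
proof (rule Bochner_Integration.integrable_bound)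
  show "integrable lborel (\<lambda>x. (cmod (f x))\<^sup>2 + (cmod (g x))\<^sup>2)"
    by (intro Bochner_Integration.integrable_add L2_integrable assms)
  note [measurable] = assms[THEN L2_borel]
  show "(\<lambda>x. f x * g x) \<in> borel_measurable lborel" by measurable
  have "cmod (f x) * cmod (g x) \<le> (cmod (f x))\<^sup>2 + (cmod (g x))\<^sup>2" for x
  proof -
    have "0 \<le> cmod (f x) * cmod (g x)" by simp
    then show ?thesis
      using sum_squares_bound[of "cmod (f x)" "cmod (g x)"] by linarith
  qed
  then show "AE x in lborel. norm (f x * g x) \<le> norm ((cmod (f x))\<^sup>2 + (cmod (g x))\<^sup>2)"
    by (auto simp: norm_mult intro!: AE_I2 order_trans[OF _ abs_ge_self])
qed

definition L2_norm :: "(real \<Rightarrow> complex) \<Rightarrow> real" where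
  "L2_norm f = sqrt (LINT x|lborel. (cmod (f x))\<^sup>2)"

lemma L2_norm_nonneg: "0 \<le> L2_norm f"
  by (simp add: L2_norm_def)

lemma L2_norm_squared: "(L2_norm f)\<^sup>2 = (LINT x|lborel. (cmod (f x))\<^sup>2)"
  by (simp add: L2_norm_def)

lemma nn_integral_L2_norm:
  "L2 f \<Longrightarrow> (\<integral>\<^sup>+x. ennreal ((cmod (f x))\<^sup>2) \<partial>lborel) = ennreal ((L2_norm f)\<^sup>2)"
  by (simp add: L2_norm_squared nn_integral_eq_integral L2_integrable)

lemma L2_Cauchy_Schwarz_norm:
  assumes "L2 f" "L2 g"
  shows "(LINT x|lborel. cmod (f x * g x)) \<le> L2_norm f * L2_norm g"
proof -
  note [measurable] = assms[THEN L2_borel]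
  have int: "integrable lborel (\<lambda>x. cmod (f x * g x))"
    using L2_mult_integrable[OF assms] by simp
  have "ennreal ((LINT x|lborel. cmod (f x * g x))\<^sup>2) = (\<integral>\<^sup>+x. ennreal (cmod (f x)) * ennreal (cmod (g x)) \<partial>lborel)\<^sup>2"
    using nn_integral_eq_integral[OF int]
    by (simp add: norm_mult ennreal_mult ennreal_power)
  also have "\<dots> \<le> (\<integral>\<^sup>+x. (ennreal (cmod (f x)))\<^sup>2 \<partial>lborel) * (\<integral>\<^sup>+x. (ennreal (cmod (g x)))\<^sup>2 \<partial>lborel)"
    by (rule Cauchy_Schwarz_nn_integral) auto
  also have "\<dots> = ennreal ((L2_norm f * L2_norm g)\<^sup>2)"
    using assms by (simp add: ennreal_power nn_integral_L2_norm ennreal_mult power_mult_distrib)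
  finally have "(LINT x|lborel. cmod (f x * g x))\<^sup>2 \<le> (L2_norm f * L2_norm g)\<^sup>2"
    by (subst (asm) ennreal_le_iff) auto
  then show ?thesis
    by (rule power2_le_imp_le) (auto intro!: mult_nonneg_nonneg L2_norm_nonneg)
qed

lemma L2_norm_triangle:
  assumes "L2 f" "L2 g"
  shows "L2_norm (\<lambda>x. f x + g x) \<le> L2_norm f + L2_norm g"
proof (rule power2_le_imp_le)
  have i: "integrable lborel (\<lambda>x. cmod (f x * g x))"
    using L2_mult_integrable[OF assms] by simp
  have "(L2_norm (\<lambda>x. f x + g x))\<^sup>2 \<le> (LINT x|lborel. (cmod (f x))\<^sup>2 + (cmod (g x))\<^sup>2 + 2 * cmod (f x * g x))"
    unfolding L2_norm_squared
  proof (rule integral_mono)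
    fix x
    have "(cmod (f x + g x))\<^sup>2 \<le> (cmod (f x) + cmod (g x))\<^sup>2"
      by (intro power_mono norm_triangle_ineq) auto
    then show "(cmod (f x + g x))\<^sup>2 \<le> (cmod (f x))\<^sup>2 + (cmod (g x))\<^sup>2 + 2 * cmod (f x * g x)"
      by (simp add: power2_sum norm_mult)
  qed (use assms i in \<open>auto intro!: L2_integrable L2_add\<close>)
  also have "\<dots> = (L2_norm f)\<^sup>2 + (L2_norm g)\<^sup>2 + 2 * (LINT x|lborel. cmod (f x * g x))"
    using assms i by (simp add: L2_norm_squared L2_integrable)
  also have "\<dots> \<le> (L2_norm f + L2_norm g)\<^sup>2"
    using L2_Cauchy_Schwarz_norm[OF assms] by (simp add: power2_sum)
  finally show "(L2_norm (\<lambda>x. f x + g x))\<^sup>2 \<le> (L2_norm f + L2_norm g)\<^sup>2" .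
qed (auto intro!: add_nonneg_nonneg L2_norm_nonneg)

lemma L2_norm_cong_AE:
  assumes "L2 f" "L2 g" "AE x in lborel. f x = g x"
  shows "L2_norm f = L2_norm g"
proof -
  note [measurable] = assms(1,2)[THEN L2_borel]
  show ?thesis
    unfolding L2_norm_def by (intro arg_cong[where f = sqrt] integral_cong_AE) (use assms(3) in auto)
qed

lemma L2_norm_eq_0_iff:
  assumes "L2 f" shows "L2_norm f = 0 \<longleftrightarrow> (AE x in lborel. f x = 0)"
  unfolding L2_norm_def
  by (simp add: integral_nonneg_eq_0_iff_AE[OF L2_integrable[OF assms]])

lemma L2_norm_cmult: "L2_norm (\<lambda>x. c * f x) = cmod c * L2_norm f"
  unfolding L2_norm_def by (simp add: norm_mult power_mult_distrib real_sqrt_mult)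

lemma L2_norm_mono:
  assumes "L2 f" "L2 g" "\<And>x. cmod (f x) \<le> cmod (g x)"
  shows "L2_norm f \<le> L2_norm g"
  unfolding L2_norm_def
  by (intro real_sqrt_le_mono integral_mono L2_integrable assms power_mono) auto

lemma L2_norm_bounded_mult:
  assumes f: "L2 f" and g: "g \<in> borel_measurable borel" and le: "\<And>x. cmod (g x) \<le> c"
  shows "L2_norm (\<lambda>x. g x * f x) \<le> c * L2_norm f"
proof -
  have c: "0 \<le> c" using order_trans[OF norm_ge_zero le[of 0]] .
  have "L2_norm (\<lambda>x. g x * f x) \<le> L2_norm (\<lambda>x. of_real c * f x)"
    by (rule L2_norm_mono[OF L2_bounded_mult[OF f g le] L2_cmult[OF f]])
       (use le c in \<open>auto simp: norm_mult intro!: mult_right_mono\<close>)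
  then show ?thesis using c by (simp add: L2_norm_cmult)
qed

text \<open>On classes modulo null sets \<open>L2_norm\<close> is a norm and not only a seminorm, so that limits in
  the space are unique and the contraction principle applies.\<close>

quotient_type l2 = "real \<Rightarrow> complex" / partial: "\<lambda>f g. L2 f \<and> L2 g \<and> (AE x in lborel. f x = g x)"
  morphisms rep_l2 abs_l2
proof (rule part_equivpI)
  show "\<exists>f. L2 f \<and> L2 f \<and> (AE x in lborel. f x = f x)"
    using L2_zero by auto
qed (auto intro!: sympI transpI)

lemma abs_rep_l2 [simp]: "abs_l2 (rep_l2 z) = z"
  by (rule Quotient3_abs_rep[OF Quotient3_l2])

lemma L2_rep_l2 [simp]: "L2 (rep_l2 z)"
  using Quotient3_rep_reflp[OF Quotient3_l2, of z] by auto

lemma rep_l2_borel [measurable]: "rep_l2 z \<in> borel_measurable borel"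
  using L2_rep_l2 L2_borel by blast

lemma abs_l2_eq_iff: "L2 f \<Longrightarrow> L2 g \<Longrightarrow> abs_l2 f = abs_l2 g \<longleftrightarrow> (AE x in lborel. f x = g x)"
  using Quotient3_rel[OF Quotient3_l2, of f g] by auto

lemma rep_abs_l2: "L2 f \<Longrightarrow> AE x in lborel. rep_l2 (abs_l2 f) x = f x"
  by (subst abs_l2_eq_iff[symmetric]) auto

lemma l2_eqI: "AE x in lborel. rep_l2 y x = rep_l2 z x \<Longrightarrow> y = z"
  using abs_l2_eq_iff[of "rep_l2 y" "rep_l2 z"] by simp

instantiation l2 :: real_normed_vector
begin

lift_definition zero_l2 :: l2 is "\<lambda>x. 0" by (simp add: L2_zero)
lift_definition plus_l2 :: "l2 \<Rightarrow> l2 \<Rightarrow> l2" is "\<lambda>f g x. f x + g x" by (auto simp: L2_add)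
lift_definition minus_l2 :: "l2 \<Rightarrow> l2 \<Rightarrow> l2" is "\<lambda>f g x. f x - g x" by (auto simp: L2_diff)
lift_definition uminus_l2 :: "l2 \<Rightarrow> l2" is "\<lambda>f x. - f x"
  using L2_cmult[of _ "-1"] by auto
lift_definition scaleR_l2 :: "real \<Rightarrow> l2 \<Rightarrow> l2" is "\<lambda>r f x. of_real r * f x"
  by (auto simp: L2_cmult)
lift_definition norm_l2 :: "l2 \<Rightarrow> real" is L2_norm
  by (auto simp: L2_norm_cong_AE)

definition dist_l2 :: "l2 \<Rightarrow> l2 \<Rightarrow> real" where "dist_l2 x y = norm (x - y)"
definition sgn_l2 :: "l2 \<Rightarrow> l2" where "sgn_l2 x = inverse (norm x) *\<^sub>R x"
definition uniformity_l2 :: "(l2 \<times> l2) filter" where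
  "uniformity_l2 = (INF e\<in>{0 <..}. principal {(x, y). dist x y < e})"
definition open_l2 :: "l2 set \<Rightarrow> bool" where
  "open_l2 U = (\<forall>x\<in>U. eventually (\<lambda>(x', y). x' = x \<longrightarrow> y \<in> U) uniformity)"

instance
proof
  fix x y z :: l2 and a b :: real
  show "dist x y = norm (x - y)" by (rule dist_l2_def)
  show "sgn x = inverse (norm x) *\<^sub>R x" by (rule sgn_l2_def)
  show "uniformity = (INF e\<in>{0 <..}. principal {(x, y :: l2). dist x y < e})"
    by (rule uniformity_l2_def)
  show "open U = (\<forall>x\<in>U. eventually (\<lambda>(x', y). x' = x \<longrightarrow> y \<in> U) uniformity)" for U :: "l2 set"
    by (rule open_l2_def)
  show "x + y + z = x + (y + z)" by transfer (auto simp: L2_add add.assoc)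
  show "x + y = y + x" by transfer (auto simp: L2_add add.commute)
  show "0 + x = x" by transfer auto
  show "- x + x = 0" by transfer (auto simp: L2_zero)
  show "x - y = x + - y" by transfer (auto simp: L2_diff)
  show "a *\<^sub>R (x + y) = a *\<^sub>R x + a *\<^sub>R y"
    by transfer (auto intro!: L2_add L2_cmult AE_I2 simp: distrib_left)
  show "(a + b) *\<^sub>R x = a *\<^sub>R x + b *\<^sub>R x"
    by transfer (auto intro!: L2_add L2_cmult AE_I2 simp: distrib_right simp del: of_real_add,
      simp add: distrib_right)
  show "a *\<^sub>R b *\<^sub>R x = (a * b) *\<^sub>R x"
    by transfer (auto intro!: L2_cmult AE_I2 simp del: of_real_mult, simp add: mult.assoc)
  show "1 *\<^sub>R x = x" by transfer auto
  show "norm x = 0 \<longleftrightarrow> x = 0" by transfer (auto simp: L2_norm_eq_0_iff L2_zero)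
  show "norm (x + y) \<le> norm x + norm y" by transfer (auto simp: L2_norm_triangle)
  show "norm (a *\<^sub>R x) = \<bar>a\<bar> * norm x" by transfer (auto simp: L2_norm_cmult)
qed

end

lemma norm_abs_l2: "L2 f \<Longrightarrow> norm (abs_l2 f) = L2_norm f"
  by (auto simp: norm_l2.abs_eq)

lemma norm_rep_l2: "L2_norm (rep_l2 z) = norm z"
  by (simp flip: norm_abs_l2)

lemma abs_l2_add: "L2 f \<Longrightarrow> L2 g \<Longrightarrow> abs_l2 (\<lambda>x. f x + g x) = abs_l2 f + abs_l2 g"
  by (auto simp: plus_l2.abs_eq)

lemma abs_l2_diff: "L2 f \<Longrightarrow> L2 g \<Longrightarrow> abs_l2 (\<lambda>x. f x - g x) = abs_l2 f - abs_l2 g"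
  by (auto simp: minus_l2.abs_eq)

lemma abs_l2_scaleR: "L2 f \<Longrightarrow> abs_l2 (\<lambda>x. of_real r * f x) = r *\<^sub>R abs_l2 f"
  by (auto simp: scaleR_l2.abs_eq)

lemma rep_l2_add: "AE x in lborel. rep_l2 (y + z) x = rep_l2 y x + rep_l2 z x"
  using rep_abs_l2[OF L2_add[OF L2_rep_l2 L2_rep_l2, of y z]] by (simp add: abs_l2_add)

lemma rep_l2_scaleR: "AE x in lborel. rep_l2 (r *\<^sub>R z) x = of_real r * rep_l2 z x"
  using rep_abs_l2[OF L2_cmult[OF L2_rep_l2, of "of_real r" z]] by (simp add: abs_l2_scaleR)

lemma rep_l2_zero: "AE x in lborel. rep_l2 0 x = 0"
  using rep_abs_l2[OF L2_zero] by (simp add: zero_l2_def[symmetric])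

lemma integrable_real_gaussian:
  assumes "0 < e" shows "integrable lborel (\<lambda>x::real. exp (- (e * x)\<^sup>2 / 2))"
proof -
  have "integrable lborel (\<lambda>x. sqrt (2 * pi) * std_normal_density x)"
    using integrable_std_normal_moment[of 0] by (intro integrable_mult_right) simp
  then have "integrable lborel (\<lambda>x::real. exp (- x\<^sup>2 / 2))"
    by (simp add: std_normal_density_def)
  then show ?thesis
    using lborel_integrable_real_affine[of "\<lambda>x::real. exp (- x\<^sup>2 / 2)" e 0] assms by simp
qed

text \<open>The Gaussian weight turns summability of the norms in $L^2$ into summability
  in $L^1$, hence almost everywhere.\<close>

lemma fast_L2_sequence_converges:
  fixes f :: "nat \<Rightarrow> real \<Rightarrow> complex"
  assumes f: "\<And>n. L2 (f n)"
    and fast: "\<And>n. L2_norm (\<lambda>x. f (Suc n) x - f n x) \<le> (1/2) ^ n"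
  obtains g where "g \<in> borel_measurable borel" "AE x in lborel. (\<lambda>n. f n x) \<longlonglongrightarrow> g x"
proof -
  have [measurable]: "\<And>n. f n \<in> borel_measurable borel"
    using f by (rule L2_borel)
  define \<rho> :: "real \<Rightarrow> complex" where "\<rho> x = of_real (exp (- x\<^sup>2 / 2))" for x
  have \<rho>: "L2 \<rho>"
  proof (rule L2_bound[OF _ integrable_real_gaussian[of 1]])
    show "\<rho> \<in> borel_measurable borel" unfolding \<rho>_def by measurable
    have "exp (- x\<^sup>2 / 2) ^ 2 \<le> (exp (- x\<^sup>2 / 2)) ^ 1" for x :: real
      by (rule power_decreasing) auto
    then show "(cmod (\<rho> x))\<^sup>2 \<le> exp (- (1 * x)\<^sup>2 / 2)" for x by (simp add: \<rho>_def)
  qed simp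
  have le: "(\<integral>\<^sup>+x. ennreal (cmod ((f (Suc n) x - f n x) * \<rho> x)) \<partial>lborel) \<le> ennreal (L2_norm \<rho> * (1/2) ^ n)" for n
  proof -
    have d: "L2 (\<lambda>x. f (Suc n) x - f n x)" by (intro L2_diff f)
    have "(LINT x|lborel. cmod ((f (Suc n) x - f n x) * \<rho> x)) \<le> (1/2) ^ n * L2_norm \<rho>"
      using L2_Cauchy_Schwarz_norm[OF d \<rho>] mult_right_mono[OF fast[of n] L2_norm_nonneg[of \<rho>]] by linarith
    then show ?thesis
      using L2_mult_integrable[OF d \<rho>]
      by (subst nn_integral_eq_integral) (auto intro!: ennreal_leI simp: mult.commute)
  qed
  have "(\<integral>\<^sup>+x. (\<Sum>n. ennreal (cmod ((f (Suc n) x - f n x) * \<rho> x))) \<partial>lborel)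
      = (\<Sum>n. \<integral>\<^sup>+x. ennreal (cmod ((f (Suc n) x - f n x) * \<rho> x)) \<partial>lborel)"
    by (rule nn_integral_suminf) (simp add: \<rho>_def)
  also have "\<dots> \<le> (\<Sum>n. ennreal (L2_norm \<rho> * (1/2) ^ n))"
    by (intro suminf_le le) auto
  also have "\<dots> = ennreal (\<Sum>n. L2_norm \<rho> * (1/2) ^ n)"
    by (intro suminf_ennreal2) (auto intro!: mult_nonneg_nonneg L2_norm_nonneg summable_mult summable_geometric)
  also have "\<dots> < \<infinity>" by simp
  finally have "(\<integral>\<^sup>+x. (\<Sum>n. ennreal (cmod ((f (Suc n) x - f n x) * \<rho> x))) \<partial>lborel) \<noteq> \<infinity>"
    by simp
  then have "AE x in lborel. (\<Sum>n. ennreal (cmod ((f (Suc n) x - f n x) * \<rho> x))) \<noteq> \<infinity>"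
    by (intro nn_integral_PInf_AE) (auto simp: \<rho>_def)
  then have conv: "AE x in lborel. convergent (\<lambda>n. f n x)"
  proof eventually_elim
    fix x assume *: "(\<Sum>n. ennreal (cmod ((f (Suc n) x - f n x) * \<rho> x))) \<noteq> \<infinity>"
    have "summable (\<lambda>n. cmod ((f (Suc n) x - f n x) * \<rho> x))"
      by (rule summable_suminf_not_top) (use * in auto)
    then have "summable (\<lambda>n. cmod (f (Suc n) x - f n x) * exp (- x\<^sup>2 / 2))"
      by (simp add: norm_mult \<rho>_def)
    then have "summable (\<lambda>n. cmod (f (Suc n) x - f n x))"
      using summable_mult2[of "\<lambda>n. cmod (f (Suc n) x - f n x) * exp (- x\<^sup>2 / 2)" "exp (x\<^sup>2 / 2)"]
      by (simp add: exp_minus mult.assoc)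
    then have "summable (\<lambda>n. f (Suc n) x - f n x)" by (rule summable_norm_cancel)
    then have "(\<lambda>n. \<Sum>i<n. f (Suc i) x - f i x) \<longlonglongrightarrow> (\<Sum>n. f (Suc n) x - f n x)"
      by (rule summable_LIMSEQ)
    then have "(\<lambda>n. f n x - f 0 x) \<longlonglongrightarrow> (\<Sum>n. f (Suc n) x - f n x)"
      by (simp add: sum_lessThan_telescope[of "\<lambda>n. f n x"])
    then have "(\<lambda>n. (f n x - f 0 x) + f 0 x) \<longlonglongrightarrow> (\<Sum>n. f (Suc n) x - f n x) + f 0 x"
      by (intro tendsto_add tendsto_const)
    then show "convergent (\<lambda>n. f n x)" by (auto simp: convergent_def)
  qed
  show thesis
  proof (rule that)
    show "(\<lambda>x. lim (\<lambda>n. f n x)) \<in> borel_measurable borel" by measurable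
    show "AE x in lborel. (\<lambda>n. f n x) \<longlonglongrightarrow> lim (\<lambda>n. f n x)"
      using conv by eventually_elim (simp add: convergent_LIMSEQ_iff)
  qed
qed

text \<open>Fatou's lemma.\<close>

lemma L2_norm_le_of_AE_limit:
  assumes f: "\<And>n. L2 (f n)" and g: "g \<in> borel_measurable borel"
    and lim: "AE x in lborel. (\<lambda>n. f n x) \<longlonglongrightarrow> g x"
    and bound: "\<And>n. L2_norm (f n) \<le> c"
  shows "L2 g" "L2_norm g \<le> c"
proof -
  have [measurable]: "\<And>n. f n \<in> borel_measurable borel" "g \<in> borel_measurable borel"
    using f g by (auto dest: L2_borel)
  have c: "0 \<le> c" using bound[of 0] L2_norm_nonneg[of "f 0"] by linarith
  have "(\<integral>\<^sup>+x. ennreal ((cmod (g x))\<^sup>2) \<partial>lborel) = (\<integral>\<^sup>+x. liminf (\<lambda>n. ennreal ((cmod (f n x))\<^sup>2)) \<partial>lborel)"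
  proof (rule nn_integral_cong_AE, use lim in eventually_elim)
    fix x assume "(\<lambda>n. f n x) \<longlonglongrightarrow> g x"
    then have "(\<lambda>n. ennreal ((cmod (f n x))\<^sup>2)) \<longlonglongrightarrow> ennreal ((cmod (g x))\<^sup>2)"
      by (intro tendsto_ennrealI tendsto_power tendsto_norm)
    then show "ennreal ((cmod (g x))\<^sup>2) = liminf (\<lambda>n. ennreal ((cmod (f n x))\<^sup>2))"
      using lim_imp_Liminf[OF trivial_limit_sequentially] by metis
  qed
  also have "\<dots> \<le> liminf (\<lambda>n. \<integral>\<^sup>+x. ennreal ((cmod (f n x))\<^sup>2) \<partial>lborel)"
    by (rule nn_integral_liminf) measurable
  also have "\<dots> \<le> ennreal (c\<^sup>2)"
    by (rule Liminf_le)
       (auto simp: nn_integral_L2_norm[OF f] intro!: always_eventually ennreal_leI power_mono bound L2_norm_nonneg)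
  finally have le: "(\<integral>\<^sup>+x. ennreal ((cmod (g x))\<^sup>2) \<partial>lborel) \<le> ennreal (c\<^sup>2)" .
  show "L2 g"
    by (rule L2I[OF g], rule integrableI_bounded) (use le in \<open>auto simp: order_le_less_trans\<close>)
  then show "L2_norm g \<le> c"
    using le c by (intro power2_le_imp_le[of "L2_norm g" c]) (simp_all add: nn_integral_L2_norm)
qed

text \<open>A Cauchy sequence has a subsequence with geometrically decreasing increments. Its almost
  everywhere limit is also its limit in norm, by Fatou's lemma applied to the differences.\<close>

instance l2 :: banach
proof
  fix X :: "nat \<Rightarrow> l2" assume X: "Cauchy X"
  have "\<exists>N. \<forall>m\<ge>N. \<forall>n\<ge>N. norm (X m - X n) < (1/2) ^ i" for i
    using X by (simp add: Cauchy_def dist_norm)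
  then obtain N where N: "\<And>i m n. m \<ge> N i \<Longrightarrow> n \<ge> N i \<Longrightarrow> norm (X m - X n) < (1/2) ^ i"
    by metis
  \<comment> \<open>The partial sums are increasing and dominate \<open>N\<close>.\<close>
  define k where "k i = (\<Sum>j\<le>i. N j)" for i
  have kN: "N i \<le> k i" for i
    unfolding k_def by (rule member_le_sum) auto
  have kS: "k i \<le> k (Suc i)" for i by (simp add: k_def)
  define f where "f i = rep_l2 (X (k i))" for i
  have f: "L2 (f i)" for i by (simp add: f_def)
  have norm_f: "L2_norm (\<lambda>x. f i x - f j x) = norm (X (k i) - X (k j))" for i j
    using norm_abs_l2[OF L2_diff[OF f[of i] f[of j]]] abs_l2_diff[OF f[of i] f[of j]]
    by (simp add: f_def)
  have k_mono: "k i \<le> k j" if "i \<le> j" for i j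
    using that by (rule lift_Suc_mono_le[of k, OF kS])
  have norm_f_le: "L2_norm (\<lambda>x. f i x - f j x) \<le> (1/2) ^ j" if "j \<le> i" for i j
    unfolding norm_f using N[of j "k i" "k j"] kN[of j] k_mono[OF that] by simp
  obtain g where g: "g \<in> borel_measurable borel" "AE x in lborel. (\<lambda>n. f n x) \<longlonglongrightarrow> g x"
    by (rule fast_L2_sequence_converges[of f]) (auto intro!: f norm_f_le)
  have lim: "L2 (\<lambda>x. g x - f j x)" "L2_norm (\<lambda>x. g x - f j x) \<le> (1/2) ^ j" for j
  proof -
    have "AE x in lborel. (\<lambda>n. f (n + j) x - f j x) \<longlonglongrightarrow> g x - f j x"
      using g(2) by eventually_elim (intro tendsto_diff tendsto_const LIMSEQ_ignore_initial_segment)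
    note * = L2_norm_le_of_AE_limit[OF _ _ this, of "(1/2) ^ j"]
    have [measurable]: "g \<in> borel_measurable borel" "f j \<in> borel_measurable borel"
      using g(1) L2_borel[OF f] by auto
    show "L2 (\<lambda>x. g x - f j x)" by (rule *(1)) (auto intro!: L2_diff f norm_f_le)
    show "L2_norm (\<lambda>x. g x - f j x) \<le> (1/2) ^ j" by (rule *(2)) (auto intro!: L2_diff f norm_f_le)
  qed
  have gL: "L2 g" using L2_add[OF lim(1)[of 0] f[of 0]] by simp
  have "X \<longlonglongrightarrow> abs_l2 g"
  proof (rule LIMSEQ_I)
    fix r :: real assume "0 < r"
    then obtain i where i: "(1/2) ^ i < r / 2"
      using real_arch_pow_inv[of "r / 2" "1/2"] by auto
    have "norm (X m - abs_l2 g) < r" if "m \<ge> N i" for m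
    proof -
      have "norm (abs_l2 g - X (k i)) \<le> (1/2) ^ i"
        using lim(2)[of i] norm_abs_l2[OF lim(1)[of i]] abs_l2_diff[OF gL f[of i]] by (simp add: f_def)
      moreover have "norm (X m - X (k i)) < (1/2) ^ i"
        using N[OF that kN] .
      moreover have "norm (X m - abs_l2 g) \<le> norm (X m - X (k i)) + norm (abs_l2 g - X (k i))"
        by (metis norm_triangle_ineq4 diff_diff_eq2 diff_add_cancel)
      ultimately show ?thesis using i by linarith
    qed
    then show "\<exists>n0. \<forall>n\<ge>n0. norm (X n - abs_l2 g) < r" by blast
  qed
  then show "convergent X" by (auto simp: convergent_def)
qed

text \<open>The pairing is bilinear, without complex conjugation, to fit the multiplication formula
  for the Fourier transform.\<close>

definition l2_pairing :: "l2 \<Rightarrow> l2 \<Rightarrow> complex" where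
  "l2_pairing y z = (LINT x|lborel. rep_l2 y x * rep_l2 z x)"

lemma l2_pairing_bounded_bilinear: "bounded_bilinear l2_pairing"
proof
  have i: "integrable lborel (\<lambda>x. rep_l2 y x * rep_l2 z x)" for y z
    by (rule L2_mult_integrable) auto
  have sym: "l2_pairing y z = l2_pairing z y" for y z
    by (simp add: l2_pairing_def mult.commute)
  fix a a' b b' :: l2 and r :: real
  have add: "l2_pairing (y + z) b = l2_pairing y b + l2_pairing z b" for y z b
  proof -
    have "l2_pairing (y + z) b = (LINT x|lborel. rep_l2 y x * rep_l2 b x + rep_l2 z x * rep_l2 b x)"
      unfolding l2_pairing_def
      by (rule integral_cong_AE) (use rep_l2_add[of y z] in \<open>auto simp: distrib_right\<close>)
    then show ?thesis by (simp add: l2_pairing_def i)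
  qed
  have scale: "l2_pairing (r *\<^sub>R y) b = r *\<^sub>R l2_pairing y b" for y b
  proof -
    have "l2_pairing (r *\<^sub>R y) b = (LINT x|lborel. r *\<^sub>R (rep_l2 y x * rep_l2 b x))"
      unfolding l2_pairing_def
      by (rule integral_cong_AE) (use rep_l2_scaleR[of r y] in \<open>auto simp: scaleR_conv_of_real\<close>)
    then show ?thesis by (simp add: l2_pairing_def i)
  qed
  show "l2_pairing (a + a') b = l2_pairing a b + l2_pairing a' b"
    and "l2_pairing a (b + b') = l2_pairing a b + l2_pairing a b'"
    and "l2_pairing (r *\<^sub>R a) b = r *\<^sub>R l2_pairing a b"
    and "l2_pairing a (r *\<^sub>R b) = r *\<^sub>R l2_pairing a b"
    using add[of a a' b] add[of b b' a] scale[of a b] scale[of b a] by (simp_all add: sym[of a])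
  show "\<exists>K. \<forall>a b. norm (l2_pairing a b) \<le> norm a * norm b * K"
  proof (intro exI[of _ 1] allI)
    fix a b
    have "norm (l2_pairing a b) \<le> (LINT x|lborel. cmod (rep_l2 a x * rep_l2 b x))"
      unfolding l2_pairing_def by (rule integral_norm_bound)
    also have "\<dots> \<le> norm a * norm b"
      using L2_Cauchy_Schwarz_norm[of "rep_l2 a" "rep_l2 b"] by (simp add: norm_rep_l2)
    finally show "norm (l2_pairing a b) \<le> norm a * norm b * 1" by simp
  qed
qed

lemma l2_pairing_abs:
  assumes "L2 f" "L2 g"
  shows "l2_pairing (abs_l2 f) (abs_l2 g) = (LINT x|lborel. f x * g x)"
  unfolding l2_pairing_def by (rule integral_cong_AE)
     (use rep_abs_l2[OF assms(1)] rep_abs_l2[OF assms(2)] assms in \<open>auto dest: L2_borel\<close>)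

section \<open>The Fourier integral\<close>

lemma integrable_bounded_mult:
  fixes f g :: "'a::euclidean_space \<Rightarrow> complex"
  assumes "integrable lborel f" "g \<in> borel_measurable borel" "\<And>x. cmod (g x) \<le> c"
  shows "integrable lborel (\<lambda>x. g x * f x)"
proof (rule Bochner_Integration.integrable_bound)
  show "integrable lborel (\<lambda>x. c *\<^sub>R f x)" using assms(1) by simp
  show "AE x in lborel. norm (g x * f x) \<le> norm (c *\<^sub>R f x)"
    using order_trans[OF assms(3) abs_ge_self] by (auto simp: norm_mult intro!: mult_right_mono)
qed (use assms in measurable)

lemma borel_measurable_cis [measurable (raw)]:
  "f \<in> borel_measurable M \<Longrightarrow> (\<lambda>x. cis (f x)) \<in> borel_measurable M"
  by (rule borel_measurable_continuous_on[where f = cis]) (auto intro: continuous_intros)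

lemma integrable_cis_mult:
  assumes "integrable lborel f" "g \<in> borel_measurable borel"
  shows "integrable lborel (\<lambda>x. cis (g x) * f x)"
  by (rule integrable_bounded_mult[OF assms(1), where c = 1]) (use assms(2) in auto)

lemma fourier_integral_integrable:
  "integrable lborel f \<Longrightarrow> integrable lborel (\<lambda>x. cis (- (x * \<xi>)) * f x)"
  by (rule integrable_cis_mult) auto

lemma cmod_fourier_integral_le:
  assumes "integrable lborel f"
  shows "cmod (fourier_integral f \<xi>) \<le> (LINT x|lborel. cmod (f x))"
  unfolding fourier_integral_def
  using integral_norm_bound[of lborel "\<lambda>x. cis (- (x * \<xi>)) * f x"] by (simp add: norm_mult)

lemma continuous_fourier_integral:
  assumes f: "integrable lborel f" shows "continuous_on UNIV (fourier_integral f)"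
proof (rule continuous_on_sequentiallyI)
  fix u and a :: real assume u: "u \<longlonglongrightarrow> a"
  have [measurable]: "f \<in> borel_measurable borel" using f by auto
  show "(\<lambda>n. fourier_integral f (u n)) \<longlonglongrightarrow> fourier_integral f a"
    unfolding fourier_integral_def
  proof (rule integral_dominated_convergence[where w = "\<lambda>x. cmod (f x)"])
    show "AE x in lborel. (\<lambda>n. cis (- (x * u n)) * f x) \<longlonglongrightarrow> cis (- (x * a)) * f x"
      using u by (intro AE_I2 tendsto_intros)
  qed (use f in \<open>auto simp: norm_mult\<close>)
qed

lemma fourier_integral_borel:
  "integrable lborel f \<Longrightarrow> fourier_integral f \<in> borel_measurable borel"
  by (intro borel_measurable_continuous_onI continuous_fourier_integral)

lemma fourier_integral_cong_AE:
  assumes "AE x in lborel. f x = g x" "f \<in> borel_measurable borel" "g \<in> borel_measurable borel"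
  shows "fourier_integral f = fourier_integral g"
  unfolding fourier_integral_def
  by (intro ext integral_cong_AE) (use assms in auto)

lemma fourier_integral_add:
  assumes "integrable lborel f" "integrable lborel g"
  shows "fourier_integral (\<lambda>x. f x + g x) \<xi> = fourier_integral f \<xi> + fourier_integral g \<xi>"
  using assms by (simp add: fourier_integral_def distrib_left fourier_integral_integrable)

lemma fourier_integral_diff:
  assumes "integrable lborel f" "integrable lborel g"
  shows "fourier_integral (\<lambda>x. f x - g x) \<xi> = fourier_integral f \<xi> - fourier_integral g \<xi>"
  using assms by (simp add: fourier_integral_def right_diff_distrib fourier_integral_integrable)

lemma fourier_integral_cmult:
  "fourier_integral (\<lambda>x. c * f x) \<xi> = c * fourier_integral f \<xi>"
  unfolding fourier_integral_def by (simp add: mult.left_commute[of _ c])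

lemma fourier_integral_cnj:
  "fourier_integral (\<lambda>x. cnj (f x)) \<xi> = cnj (fourier_integral f (- \<xi>))"
  using Bochner_Integration.integral_cnj[of lborel "\<lambda>x. cis (x * \<xi>) * f x"] by (simp add: fourier_integral_def cis_cnj)

lemma fourier_integral_modulate:
  "fourier_integral (\<lambda>x. cis (x * b) * f x) \<xi> = fourier_integral f (\<xi> - b)"
  unfolding fourier_integral_def
  by (simp add: cis_mult algebra_simps flip: mult.assoc)

lemma integrable_tensor:
  fixes f h :: "real \<Rightarrow> complex"
  assumes "integrable lborel f" "integrable lborel h"
  shows "integrable (lborel \<Otimes>\<^sub>M lborel) (\<lambda>(x, y). f x * h y)"
proof -
  have [measurable]: "f \<in> borel_measurable borel" "h \<in> borel_measurable borel"
    using assms by auto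
  show ?thesis
    by (rule lborel_pair.Fubini_integrable)
       (use assms in \<open>auto simp: norm_mult\<close>)
qed

text \<open>Fubini's theorem moves the transform from one factor to the other.\<close>

lemma fourier_integral_mult_formula:
  assumes f: "integrable lborel f" and h: "integrable lborel h"
  shows "(LINT \<xi>|lborel. fourier_integral f \<xi> * h \<xi>) = (LINT x|lborel. f x * fourier_integral h x)"
proof -
  have [measurable]: "f \<in> borel_measurable borel" "h \<in> borel_measurable borel"
    using assms by auto
  have "integrable (lborel \<Otimes>\<^sub>M lborel) (\<lambda>(x, y). cis (- (x * y)) * (f x * h y))"
    by (rule Bochner_Integration.integrable_bound[OF integrable_tensor[OF f h]])
       (auto simp: norm_mult split_beta)
  then have "(LINT y|lborel. LINT x|lborel. cis (- (x * y)) * (f x * h y))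
      = (LINT x|lborel. LINT y|lborel. cis (- (x * y)) * (f x * h y))"
    by (rule lborel_pair.Fubini_integral)
  then show ?thesis
    by (simp add: fourier_integral_def ac_simps flip: integral_mult_left_zero integral_mult_right_zero)
qed

text \<open>A rescaled form of the characteristic function of the normal distribution.\<close>

lemma fourier_integral_gaussian:
  assumes "0 < e"
  shows "fourier_integral (\<lambda>x. of_real (exp (- (e * x)\<^sup>2 / 2))) \<xi> = of_real (sqrt (2 * pi) / e * exp (- (\<xi> / e)\<^sup>2 / 2))"
proof -
  have "char std_normal_distribution t = (LINT x|lborel. std_normal_density x *\<^sub>R iexp (t * x))" for t
    unfolding char_def by (subst integral_density) (auto simp: normal_density_nonneg)
  then have *: "(LINT x|lborel. of_real (std_normal_density x) * cis (t * x)) = of_real (exp (- t\<^sup>2 / 2))" for t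
    using fun_cong[OF char_std_normal_distribution, of t] by (simp add: scaleR_conv_of_real cis_conv_exp)
  have "(LINT x|lborel. of_real (exp (- x\<^sup>2 / 2)) * cis (t * x)) = of_real (sqrt (2 * pi) * exp (- t\<^sup>2 / 2))" for t
  proof -
    have "(LINT x|lborel. of_real (exp (- x\<^sup>2 / 2)) * cis (t * x))
        = (LINT x|lborel. of_real (sqrt (2 * pi)) * (of_real (std_normal_density x) * cis (t * x)))"
      by (intro Bochner_Integration.integral_cong) (auto simp: std_normal_density_def)
    also have "\<dots> = of_real (sqrt (2 * pi) * exp (- t\<^sup>2 / 2))" by (simp add: *)
    finally show ?thesis .
  qed
  from this[of "- (\<xi> / e)"] show ?thesis
    using assms lborel_integral_real_affine[of e "\<lambda>x. of_real (exp (- x\<^sup>2 / 2)) * cis (- (\<xi> / e) * x)" 0]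
    by (simp add: fourier_integral_def mult.commute scaleR_conv_of_real field_simps)
qed

text \<open>Positive and negative part of a real function with vanishing Fourier integral are, up to
  a common factor, densities of probability measures with the same characteristic function; so the
  uniqueness theorem of Levy applies.\<close>

lemma fourier_integral_real_eq_0_imp_AE:
  fixes f :: "real \<Rightarrow> real"
  assumes f: "integrable lborel f" and 0: "\<And>\<xi>. fourier_integral (\<lambda>x. of_real (f x)) \<xi> = 0"
  shows "AE x in lborel. f x = 0"
proof -
  have [measurable]: "f \<in> borel_measurable borel" using f by auto
  define p n where "p x = max (f x) 0" and "n x = max (- f x) 0" for x
  have pn: "integrable lborel p" "integrable lborel n"
    unfolding p_def n_def using f by auto
  have [measurable]: "p \<in> borel_measurable borel" "n \<in> borel_measurable borel" using pn by auto
  have nonneg: "0 \<le> p x" "0 \<le> n x" for x by (auto simp: p_def n_def)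
  have fpn: "f x = p x - n x" for x by (auto simp: p_def n_def)
  have eq: "fourier_integral (\<lambda>x. of_real (p x)) \<xi> = fourier_integral (\<lambda>x. of_real (n x)) \<xi>" for \<xi>
    using 0[of \<xi>] pn by (simp add: fpn fourier_integral_diff)
  define c where "c = (LINT x|lborel. p x)"
  have c: "(LINT x|lborel. n x) = c"
    using eq[of 0] by (simp add: fourier_integral_def c_def of_real_eq_iff[where 'a = complex])
  show ?thesis
  proof (cases "c = 0")
    case True
    then have "AE x in lborel. p x = 0" "AE x in lborel. n x = 0"
      using c integral_nonneg_eq_0_iff_AE[OF pn(1)] integral_nonneg_eq_0_iff_AE[OF pn(2)] nonneg
      by (auto simp: c_def)
    then show ?thesis by eventually_elim (simp add: fpn)
  next
    case False
    moreover have "0 \<le> c" unfolding c_def by (simp add: nonneg)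
    ultimately have c0: "0 < c" by simp
    have dist: "real_distribution (density lborel (\<lambda>x. ennreal (g x / c)))"
      and char_eq: "char (density lborel (\<lambda>x. ennreal (g x / c))) t = fourier_integral (\<lambda>x. of_real (g x)) (- t) / c"
      if g: "integrable lborel g" "\<And>x. 0 \<le> g x" "(LINT x|lborel. g x) = c" for g t
    proof -
      have [measurable]: "g \<in> borel_measurable borel" using g by auto
      have "(\<integral>\<^sup>+x. ennreal (g x / c) \<partial>lborel) = ennreal (LINT x|lborel. g x / c)"
        by (rule nn_integral_eq_integral) (use g c0 in auto)
      then show "real_distribution (density lborel (\<lambda>x. ennreal (g x / c)))"
        using g c0 by (intro real_distribution.intro prob_spaceI real_distribution_axioms.intro)
          (auto simp: emeasure_density)
      have "char (density lborel (\<lambda>x. ennreal (g x / c))) t = (LINT x|lborel. (g x / c) *\<^sub>R iexp (t * x))"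
        unfolding char_def by (rule integral_density) (use g c0 in auto)
      also have "\<dots> = (LINT x|lborel. (cis (x * t) * of_real (g x)) / c)"
        by (intro Bochner_Integration.integral_cong) (auto simp: cis_conv_exp scaleR_conv_of_real field_simps)
      finally show "char (density lborel (\<lambda>x. ennreal (g x / c))) t = fourier_integral (\<lambda>x. of_real (g x)) (- t) / c"
        by (simp add: fourier_integral_def)
    qed
    have "density lborel (\<lambda>x. ennreal (p x / c)) = density lborel (\<lambda>x. ennreal (n x / c))"
      by (rule Levy_uniqueness) (auto intro!: dist ext pn nonneg c simp: char_eq pn nonneg c eq c_def[symmetric])
    then have "AE x in lborel. ennreal (p x / c) = ennreal (n x / c)"
      by (intro sigma_finite_measure.density_unique[OF sigma_finite_lborel]) auto
    then show ?thesis
    proof eventually_elim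
      fix x assume "ennreal (p x / c) = ennreal (n x / c)"
      then have "p x / c = n x / c" using nonneg c0 by (subst (asm) ennreal_inj) auto
      then show "f x = 0" using c0 by (simp add: fpn)
    qed
  qed
qed

text \<open>If the transform of \<open>f\<close> vanishes, then so does that of \<open>cnj f\<close>, and hence those of the
  real and the imaginary part.\<close>

lemma fourier_integral_eq_0_imp_AE:
  assumes f: "integrable lborel f" and 0: "\<And>\<xi>. fourier_integral f \<xi> = 0"
  shows "AE x in lborel. f x = 0"
proof -
  have int: "integrable lborel (\<lambda>x. cnj (f x))" using f by simp
  have "fourier_integral (\<lambda>x. of_real (Re (f x))) \<xi> = fourier_integral (\<lambda>x. 1/2 * (f x + cnj (f x))) \<xi>" for \<xi>
    by (simp add: complex_add_cnj)
  then have "AE x in lborel. Re (f x) = 0"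
    using f int 0 by (intro fourier_integral_real_eq_0_imp_AE)
      (auto simp only: fourier_integral_cmult fourier_integral_add fourier_integral_cnj, auto)
  moreover have "fourier_integral (\<lambda>x. of_real (Im (f x))) \<xi> = fourier_integral (\<lambda>x. 1/(2*\<i>) * (f x - cnj (f x))) \<xi>" for \<xi>
    by (intro arg_cong[where f = "\<lambda>f. fourier_integral f \<xi>"] ext) (simp add: complex_eq_iff)
  then have "AE x in lborel. Im (f x) = 0"
    using f int 0 by (intro fourier_integral_real_eq_0_imp_AE)
      (auto simp only: fourier_integral_cmult fourier_integral_diff fourier_integral_cnj, auto)
  ultimately show ?thesis by eventually_elim (simp add: complex_eq_iff)
qed

section \<open>Bessel's inequality and the Plancherel transform\<close>

lemma gaussian_kernel_integral:
  assumes "0 < e"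
  shows "(\<integral>\<^sup>+y. ennreal (sqrt (2 * pi) / e * exp (- ((y - x) / e)\<^sup>2 / 2)) \<partial>lborel) = ennreal (2 * pi)"
proof -
  have "complex_of_real (LINT y|lborel. exp (- (1 / e * y)\<^sup>2 / 2)) = of_real (sqrt (2 * pi) * e)"
    using fourier_integral_gaussian[of "1 / e" 0] assms by (simp add: fourier_integral_def)
  then have 1: "(LINT y|lborel. exp (- (1 / e * y)\<^sup>2 / 2)) = sqrt (2 * pi) * e"
    by (simp only: of_real_eq_iff)
  have "(LINT y|lborel. exp (- ((y - x) / e)\<^sup>2 / 2)) = sqrt (2 * pi) * e"
    using lborel_integral_real_affine[of 1 "\<lambda>y. exp (- (1 / e * y)\<^sup>2 / 2)" "- x"] 1 by simp
  moreover have "integrable lborel (\<lambda>y. exp (- ((y - x) / e)\<^sup>2 / 2))"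
    using lborel_integrable_real_affine[OF integrable_real_gaussian[of "1 / e"], of 1 "- x"] assms by simp
  ultimately show ?thesis
    using assms by (subst nn_integral_eq_integral) auto
qed

text \<open>Schur's test for a symmetric positive kernel of mass $2\pi$: each product of values of \<open>f\<close> is
  estimated by half the sum of their squares, and one variable is integrated out.\<close>

lemma gaussian_form_le:
  fixes f :: "real \<Rightarrow> complex"
  assumes f: "L2 f" and e: "0 < e"
  shows "(\<integral>\<^sup>+x. \<integral>\<^sup>+y. ennreal (cmod (f x) * cmod (f y) * (sqrt (2 * pi) / e * exp (- ((y - x) / e)\<^sup>2 / 2))) \<partial>lborel \<partial>lborel)
    \<le> ennreal (2 * pi * (L2_norm f)\<^sup>2)"
proof -
  note [measurable] = L2_borel[OF f]
  define k where "k x y = sqrt (2 * pi) / e * exp (- ((y - x) / e)\<^sup>2 / 2)" for x y :: real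
  have k0: "0 \<le> k x y" and ksym: "k x y = k y x" for x y
    using e by (auto simp: k_def power2_commute power_divide)
  have [measurable]: "(\<lambda>(x, y). k x y) \<in> borel_measurable (borel \<Otimes>\<^sub>M borel)"
    unfolding k_def by measurable
  have kint: "(\<integral>\<^sup>+y. ennreal (k x y) \<partial>lborel) = ennreal (2 * pi)" for x
    unfolding k_def by (rule gaussian_kernel_integral[OF e])
  have A: "(\<integral>\<^sup>+x. \<integral>\<^sup>+y. ennreal ((cmod (f x))\<^sup>2 * k x y / 2) \<partial>lborel \<partial>lborel) = ennreal (pi * (L2_norm f)\<^sup>2)"
  proof -
    have "(\<integral>\<^sup>+x. \<integral>\<^sup>+y. ennreal ((cmod (f x))\<^sup>2 * k x y / 2) \<partial>lborel \<partial>lborel)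
        = (\<integral>\<^sup>+x. ennreal pi * ennreal ((cmod (f x))\<^sup>2) \<partial>lborel)"
    proof (rule nn_integral_cong)
      fix x
      have "(\<integral>\<^sup>+y. ennreal ((cmod (f x))\<^sup>2 * k x y / 2) \<partial>lborel)
          = (\<integral>\<^sup>+y. ennreal ((cmod (f x))\<^sup>2 / 2) * ennreal (k x y) \<partial>lborel)"
        by (intro nn_integral_cong) (simp add: k0 flip: ennreal_mult)
      then have "(\<integral>\<^sup>+y. ennreal ((cmod (f x))\<^sup>2 * k x y / 2) \<partial>lborel) = ennreal ((cmod (f x))\<^sup>2 / 2) * ennreal (2 * pi)"
        by (simp add: nn_integral_cmult kint)
      then show "(\<integral>\<^sup>+y. ennreal ((cmod (f x))\<^sup>2 * k x y / 2) \<partial>lborel) = ennreal pi * ennreal ((cmod (f x))\<^sup>2)"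
        by (simp flip: ennreal_mult add: mult.commute)
    qed
    also have "\<dots> = ennreal (pi * (L2_norm f)\<^sup>2)"
      by (subst nn_integral_cmult) (auto simp: nn_integral_L2_norm[OF f] ennreal_mult)
    finally show ?thesis .
  qed
  have B: "(\<integral>\<^sup>+x. \<integral>\<^sup>+y. ennreal ((cmod (f y))\<^sup>2 * k x y / 2) \<partial>lborel \<partial>lborel) = ennreal (pi * (L2_norm f)\<^sup>2)"
    using A by (subst lborel_pair.Fubini') (auto simp: ksym)
  have "(\<integral>\<^sup>+x. \<integral>\<^sup>+y. ennreal (cmod (f x) * cmod (f y) * k x y) \<partial>lborel \<partial>lborel)
      \<le> (\<integral>\<^sup>+x. \<integral>\<^sup>+y. (ennreal ((cmod (f x))\<^sup>2 * k x y / 2) + ennreal ((cmod (f y))\<^sup>2 * k x y / 2)) \<partial>lborel \<partial>lborel)"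
  proof (intro nn_integral_mono)
    fix x y
    have "cmod (f x) * cmod (f y) \<le> (cmod (f x))\<^sup>2 / 2 + (cmod (f y))\<^sup>2 / 2"
      using sum_squares_bound[of "cmod (f x)" "cmod (f y)"] by simp
    from mult_right_mono[OF this k0[of x y]]
    show "ennreal (cmod (f x) * cmod (f y) * k x y) \<le> ennreal ((cmod (f x))\<^sup>2 * k x y / 2) + ennreal ((cmod (f y))\<^sup>2 * k x y / 2)"
      using k0[of x y] by (simp add: distrib_right ennreal_leI flip: ennreal_plus)
  qed
  also have "\<dots> = ennreal (pi * (L2_norm f)\<^sup>2) + ennreal (pi * (L2_norm f)\<^sup>2)"
    by (simp add: nn_integral_add A B)
  also have "\<dots> = ennreal (2 * pi * (L2_norm f)\<^sup>2)"
    by (simp flip: ennreal_plus)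
  finally show ?thesis by (simp add: k_def)
qed

lemma integrable_complex_gaussian:
  "0 < e \<Longrightarrow> integrable lborel (\<lambda>x. complex_of_real (exp (- (e * x)\<^sup>2 / 2)))"
  using integrable_real_gaussian[of e] by simp

text \<open>Damping the frequency integral by a Gaussian makes Fubini's theorem applicable and turns
  the Fourier kernel into a positive kernel of mass $2\pi$.\<close>

lemma gaussian_damped_bessel:
  assumes f: "integrable lborel f" "L2 f" and e: "0 < e"
  shows "(LINT \<xi>|lborel. (cmod (fourier_integral f \<xi>))\<^sup>2 * exp (- (e * \<xi>)\<^sup>2 / 2)) \<le> 2 * pi * (L2_norm f)\<^sup>2"
proof -
  define g where "g \<xi> = complex_of_real (exp (- (e * \<xi>)\<^sup>2 / 2))" for \<xi>
  define k where "k z = sqrt (2 * pi) / e * exp (- (z / e)\<^sup>2 / 2)" for z :: real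
  let ?F = "fourier_integral f"
  have [measurable]: "f \<in> borel_measurable borel" "?F \<in> borel_measurable borel"
    using f fourier_integral_borel by (auto dest: L2_borel)
  have gint: "integrable lborel g" unfolding g_def by (rule integrable_complex_gaussian[OF e])
  then have [measurable]: "g \<in> borel_measurable borel" by auto
  have g_even: "g (- \<xi>) = g \<xi>" for \<xi> by (simp add: g_def)
  have fc: "integrable lborel (\<lambda>x. cnj (f x))" using f by simp
  define h where "h \<xi> = cnj (?F \<xi>) * g \<xi>" for \<xi>
  have h: "integrable lborel h"
    unfolding h_def by (rule integrable_bounded_mult[OF gint]) (use cmod_fourier_integral_le[OF f(1)] in auto)
  have Fh: "fourier_integral h x = (LINT y|lborel. cnj (f y) * of_real (k (y - x)))" for x
  proof -
    have "fourier_integral h x = (LINT \<xi>|lborel. cis (\<xi> * x) * h (- \<xi>))"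
      using lborel_integral_reflect[of "\<lambda>\<xi>. cis (- (\<xi> * x)) * h \<xi>"] by (simp add: fourier_integral_def)
    also have "\<dots> = (LINT \<xi>|lborel. fourier_integral (\<lambda>x. cnj (f x)) \<xi> * (cis (\<xi> * x) * g \<xi>))"
      by (simp add: h_def g_even fourier_integral_cnj ac_simps)
    also have "\<dots> = (LINT y|lborel. cnj (f y) * fourier_integral (\<lambda>\<xi>. cis (\<xi> * x) * g \<xi>) y)"
      by (rule fourier_integral_mult_formula[OF fc]) (auto intro: integrable_cis_mult gint)
    finally show ?thesis
      unfolding fourier_integral_modulate unfolding g_def fourier_integral_gaussian[OF e] by (simp add: k_def)
  qed
  have "complex_of_real (LINT \<xi>|lborel. (cmod (?F \<xi>))\<^sup>2 * exp (- (e * \<xi>)\<^sup>2 / 2)) = (LINT \<xi>|lborel. ?F \<xi> * h \<xi>)"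
    unfolding integral_complex_of_real[symmetric]
    by (intro Bochner_Integration.integral_cong refl) (simp add: h_def g_def complex_norm_square del: of_real_power)
  also have "\<dots> = (LINT x|lborel. f x * fourier_integral h x)"
    by (rule fourier_integral_mult_formula[OF f(1) h])
  finally have eq: "complex_of_real (LINT \<xi>|lborel. (cmod (?F \<xi>))\<^sup>2 * exp (- (e * \<xi>)\<^sup>2 / 2)) = (LINT x|lborel. f x * fourier_integral h x)" .
  have [measurable]: "fourier_integral h \<in> borel_measurable borel" by (rule fourier_integral_borel[OF h])
  have fFh: "integrable lborel (\<lambda>x. f x * fourier_integral h x)"
    using integrable_bounded_mult[OF f(1) _ cmod_fourier_integral_le[OF h]] by (simp add: mult.commute)
  have k0: "0 \<le> k z" for z using e by (simp add: k_def)
  have [measurable]: "k \<in> borel_measurable borel" unfolding k_def by measurable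
  have kb: "k z \<le> sqrt (2 * pi) / e" for z
    unfolding k_def using e by (intro mult_right_le_one_le) auto
  have "ennreal \<bar>LINT \<xi>|lborel. (cmod (?F \<xi>))\<^sup>2 * exp (- (e * \<xi>)\<^sup>2 / 2)\<bar> = ennreal (cmod (LINT x|lborel. f x * fourier_integral h x))"
    by (simp flip: eq)
  also have "\<dots> \<le> (\<integral>\<^sup>+x. ennreal (cmod (f x * fourier_integral h x)) \<partial>lborel)"
    by (rule integral_norm_bound_ennreal[OF fFh])
  also have "\<dots> \<le> (\<integral>\<^sup>+x. \<integral>\<^sup>+y. ennreal (cmod (f x) * cmod (f y) * k (y - x)) \<partial>lborel \<partial>lborel)"
  proof (rule nn_integral_mono)
    fix x
    have "integrable lborel (\<lambda>y. cnj (f y) * of_real (k (y - x)))"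
      using integrable_bounded_mult[OF fc, of "\<lambda>y. of_real (k (y - x))" "sqrt (2 * pi) / e"] kb k0
      by (simp add: mult.commute)
    from integral_norm_bound_ennreal[OF this]
    have "ennreal (cmod (fourier_integral h x)) \<le> (\<integral>\<^sup>+y. ennreal (cmod (f y) * k (y - x)) \<partial>lborel)"
      by (simp add: Fh norm_mult k0)
    then have "ennreal (cmod (f x)) * ennreal (cmod (fourier_integral h x))
        \<le> ennreal (cmod (f x)) * (\<integral>\<^sup>+y. ennreal (cmod (f y) * k (y - x)) \<partial>lborel)"
      by (rule mult_left_mono) simp
    then show "ennreal (cmod (f x * fourier_integral h x)) \<le> (\<integral>\<^sup>+y. ennreal (cmod (f x) * cmod (f y) * k (y - x)) \<partial>lborel)"
      by (simp add: norm_mult ennreal_mult k0 mult.assoc flip: nn_integral_cmult)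
  qed
  also have "\<dots> \<le> ennreal (2 * pi * (L2_norm f)\<^sup>2)"
    unfolding k_def by (rule gaussian_form_le[OF f(2) e])
  finally have "\<bar>LINT \<xi>|lborel. (cmod (?F \<xi>))\<^sup>2 * exp (- (e * \<xi>)\<^sup>2 / 2)\<bar> \<le> 2 * pi * (L2_norm f)\<^sup>2"
    by (subst (asm) ennreal_le_iff) auto
  then show ?thesis by linarith
qed

text \<open>Fatou's lemma removes the damping. Its square root is absorbed into the transform, so that
  the damped integral is the square of an $L^2$ norm.\<close>

lemma bessel_inequality:
  assumes f: "integrable lborel f" "L2 f"
  shows L2_fourier_integral: "L2 (fourier_integral f)"
    and L2_norm_fourier_integral_le: "L2_norm (fourier_integral f) \<le> sqrt (2 * pi) * L2_norm f"
proof -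
  define e :: "nat \<Rightarrow> real" where "e n = inverse (real (Suc n))" for n
  have e: "0 < e n" for n by (simp add: e_def)
  have [measurable]: "fourier_integral f \<in> borel_measurable borel"
    by (rule fourier_integral_borel[OF f(1)])
  \<comment> \<open>The exponent is half that of the damping factor.\<close>
  define F where "F n \<xi> = fourier_integral f \<xi> * of_real (exp (- (e n * \<xi>)\<^sup>2 / 4))" for n \<xi>
  have sq: "(cmod (F n \<xi>))\<^sup>2 = (cmod (fourier_integral f \<xi>))\<^sup>2 * exp (- (e n * \<xi>)\<^sup>2 / 2)" for n \<xi>
  proof -
    have "(exp (- (e n * \<xi>)\<^sup>2 / 4))\<^sup>2 = exp (- (e n * \<xi>)\<^sup>2 / 2)"
      by (simp add: power2_eq_square flip: exp_add)
    then show ?thesis by (simp add: F_def norm_mult power_mult_distrib)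
  qed
  have FL: "L2 (F n)" for n
  proof (rule L2_bound[where g = "\<lambda>\<xi>. (LINT x|lborel. cmod (f x))\<^sup>2 * exp (- (e n * \<xi>)\<^sup>2 / 2)"])
    show "F n \<in> borel_measurable borel" unfolding F_def by measurable
    show "(cmod (F n \<xi>))\<^sup>2 \<le> (LINT x|lborel. cmod (f x))\<^sup>2 * exp (- (e n * \<xi>)\<^sup>2 / 2)" for \<xi>
      unfolding sq by (intro mult_right_mono power_mono cmod_fourier_integral_le f) auto
  qed (use integrable_real_gaussian[OF e[of n]] in simp)
  have bound: "L2_norm (F n) \<le> sqrt (2 * pi) * L2_norm f" for n
  proof (rule power2_le_imp_le)
    have "(L2_norm (F n))\<^sup>2 = (LINT \<xi>|lborel. (cmod (fourier_integral f \<xi>))\<^sup>2 * exp (- (e n * \<xi>)\<^sup>2 / 2))"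
      unfolding L2_norm_squared sq ..
    also have "\<dots> \<le> 2 * pi * (L2_norm f)\<^sup>2" by (rule gaussian_damped_bessel[OF f e])
    finally show "(L2_norm (F n))\<^sup>2 \<le> (sqrt (2 * pi) * L2_norm f)\<^sup>2"
      by (simp add: power_mult_distrib)
  qed (simp add: L2_norm_nonneg)
  have "e \<longlonglongrightarrow> 0" unfolding e_def by (rule LIMSEQ_inverse_real_of_nat)
  then have "(\<lambda>n. F n \<xi>) \<longlonglongrightarrow> fourier_integral f \<xi> * of_real (exp (- (0 * \<xi>)\<^sup>2 / 4))" for \<xi>
    unfolding F_def by (intro tendsto_intros) auto
  then have "AE \<xi> in lborel. (\<lambda>n. F n \<xi>) \<longlonglongrightarrow> fourier_integral f \<xi>" by simp
  note lim = L2_norm_le_of_AE_limit[of F, OF FL _ this bound]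
  show "L2 (fourier_integral f)" by (rule lim(1)) measurable
  show "L2_norm (fourier_integral f) \<le> sqrt (2 * pi) * L2_norm f" by (rule lim(2)) measurable
qed

definition truncate :: "real \<Rightarrow> (real \<Rightarrow> complex) \<Rightarrow> real \<Rightarrow> complex" where
  "truncate R f = (\<lambda>x. indicator {-R..R} x * f x)"

lemma L2_truncate: "L2 f \<Longrightarrow> L2 (truncate R f)"
  unfolding truncate_def by (rule L2_bounded_mult[where c = 1]) (auto simp: indicator_def)

lemma integrable_truncate:
  assumes "L2 f" shows "integrable lborel (truncate R f)"
proof -
  have "L2 (indicator {-R..R} :: real \<Rightarrow> complex)"
  proof (rule L2_bound[where g = "indicator {-R..R}"])
    show "integrable lborel (indicator {-R..R} :: real \<Rightarrow> real)" by (rule integrable_real_indicator) (auto simp: emeasure_lborel_Icc_eq)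
  qed (auto simp: indicator_def)
  then show ?thesis unfolding truncate_def using assms by (rule L2_mult_integrable)
qed

lemma tendsto_truncate:
  assumes f: "L2 f" shows "((\<lambda>R. abs_l2 (truncate R f)) \<longlongrightarrow> abs_l2 f) at_top"
proof -
  note [measurable] = L2_borel[OF f]
  have "((\<lambda>R. LINT x|lborel. (cmod (truncate R f x - f x))\<^sup>2) \<longlongrightarrow> integral\<^sup>L (lborel :: real measure) (\<lambda>x. 0)) at_top"
  proof (rule integral_dominated_convergence_at_top[where w = "\<lambda>x. (cmod (f x))\<^sup>2"])
    show "AE x in lborel. ((\<lambda>R. (cmod (truncate R f x - f x))\<^sup>2) \<longlongrightarrow> 0) at_top"
    proof (intro AE_I2 tendsto_eventually)
      fix x :: real
      show "\<forall>\<^sub>F R in at_top. (cmod (truncate R f x - f x))\<^sup>2 = 0"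
        using eventually_ge_at_top[of "\<bar>x\<bar>"] by eventually_elim (auto simp: truncate_def indicator_def)
    qed
    show "\<forall>\<^sub>F R in at_top. AE x in lborel. norm ((cmod (truncate R f x - f x))\<^sup>2) \<le> (cmod (f x))\<^sup>2"
      by (intro always_eventually allI AE_I2) (auto simp: truncate_def indicator_def)
  qed (use L2_integrable[OF f] in \<open>auto simp: truncate_def\<close>)
  then have "((\<lambda>R. sqrt (LINT x|lborel. (cmod (truncate R f x - f x))\<^sup>2)) \<longlongrightarrow> sqrt 0) at_top"
    by (intro tendsto_real_sqrt) simp
  then have "((\<lambda>R. norm (abs_l2 (truncate R f) - abs_l2 f)) \<longlongrightarrow> 0) at_top"
    by (simp add: abs_l2_diff[symmetric] norm_abs_l2 L2_diff L2_truncate f L2_norm_def)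
  then show ?thesis by (simp add: tendsto_norm_zero_iff LIM_zero_iff)
qed

text \<open>Plancherel transforms are limits in the Banach space of classes.\<close>

lemma plancherel_transform_iff:
  "plancherel_transform f F \<longleftrightarrow> L2 f \<and> L2 F \<and>
     ((\<lambda>R. abs_l2 (fourier_integral (truncate R f))) \<longlongrightarrow> abs_l2 F) at_top"
proof (cases "L2 f \<and> L2 F")
  case True
  then have f: "L2 f" and F: "L2 F" by auto
  have L: "L2 (fourier_integral (truncate R f))" for R
    using f by (intro L2_fourier_integral integrable_truncate L2_truncate)
  have "(\<integral>\<^sup>+\<xi>. ennreal ((cmod (F \<xi> - fourier_integral (\<lambda>x. indicator {-R..R} x * f x) \<xi>))\<^sup>2) \<partial>lborel)
      = ennreal ((norm (abs_l2 (fourier_integral (truncate R f)) - abs_l2 F))\<^sup>2)" for R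
    using nn_integral_L2_norm[OF L2_diff[OF F L[of R]]] norm_abs_l2[OF L2_diff[OF F L[of R]]]
    unfolding abs_l2_diff[OF F L] norm_minus_commute[of "abs_l2 F"] by (simp add: truncate_def)
  then have "plancherel_transform f F \<longleftrightarrow>
      ((\<lambda>R. ennreal ((norm (abs_l2 (fourier_integral (truncate R f)) - abs_l2 F))\<^sup>2)) \<longlongrightarrow> ennreal 0) at_top"
    by (simp add: plancherel_transform_def f F)
  also have "\<dots> \<longleftrightarrow> ((\<lambda>R. (norm (abs_l2 (fourier_integral (truncate R f)) - abs_l2 F))\<^sup>2) \<longlongrightarrow> 0) at_top"
    by (subst tendsto_ennreal_iff) auto
  also have "\<dots> \<longleftrightarrow> ((\<lambda>R. abs_l2 (fourier_integral (truncate R f))) \<longlongrightarrow> abs_l2 F) at_top"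
    by (simp add: power_tendsto_0_iff tendsto_norm_zero_iff LIM_zero_iff)
  finally show ?thesis by (simp add: f F)
qed (auto simp: plancherel_transform_def)

lemma fourier_integral_diff_l2_le:
  assumes "integrable lborel f" "L2 f" "integrable lborel g" "L2 g"
  shows "norm (abs_l2 (fourier_integral f) - abs_l2 (fourier_integral g)) \<le> sqrt (2 * pi) * norm (abs_l2 f - abs_l2 g)"
proof -
  have "fourier_integral (\<lambda>x. f x - g x) = (\<lambda>\<xi>. fourier_integral f \<xi> - fourier_integral g \<xi>)"
    by (rule ext) (rule fourier_integral_diff[OF assms(1,3)])
  then show ?thesis
    using L2_norm_fourier_integral_le[of "\<lambda>x. f x - g x"] assms
    by (simp add: abs_l2_diff[symmetric] norm_abs_l2 L2_diff L2_fourier_integral)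
qed

lemma plancherel_transform_L1:
  assumes "integrable lborel f" "L2 f" shows "plancherel_transform f (fourier_integral f)"
  unfolding plancherel_transform_iff
proof (intro conjI assms L2_fourier_integral)
  have "((\<lambda>R. sqrt (2 * pi) * norm (abs_l2 (truncate R f) - abs_l2 f)) \<longlongrightarrow> 0) at_top"
    by (intro tendsto_mult_right_zero tendsto_norm_zero LIM_zero tendsto_truncate assms)
  moreover have "\<forall>\<^sub>F R in at_top. norm (abs_l2 (fourier_integral (truncate R f)) - abs_l2 (fourier_integral f))
      \<le> sqrt (2 * pi) * norm (abs_l2 (truncate R f) - abs_l2 f)"
    by (intro always_eventually allI fourier_integral_diff_l2_le assms integrable_truncate L2_truncate)
  ultimately have "((\<lambda>R. abs_l2 (fourier_integral (truncate R f)) - abs_l2 (fourier_integral f)) \<longlongrightarrow> 0) at_top"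
    by (rule Lim_null_comparison[rotated])
  then show "((\<lambda>R. abs_l2 (fourier_integral (truncate R f))) \<longlongrightarrow> abs_l2 (fourier_integral f)) at_top"
    by (simp add: LIM_zero_iff)
qed

text \<open>By Bessel's inequality the transforms of the truncations inherit the Cauchy property from
  the truncations.\<close>

lemma plancherel_transform_exists:
  assumes f: "L2 f" shows "\<exists>F. plancherel_transform f F"
proof -
  define t where "t R = abs_l2 (truncate R f)" for R
  define T where "T R = abs_l2 (fourier_integral (truncate R f))" for R
  have le: "norm (T R - T R') \<le> sqrt (2 * pi) * norm (t R - t R')" for R R'
    unfolding t_def T_def by (intro fourier_integral_diff_l2_le integrable_truncate L2_truncate f)
  have t: "(t \<longlongrightarrow> abs_l2 f) at_top" unfolding t_def by (rule tendsto_truncate[OF f])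
  have tn: "(\<lambda>n. t (real n)) \<longlonglongrightarrow> abs_l2 f"
    by (rule filterlim_compose[OF t filterlim_real_sequentially])
  have "Cauchy (\<lambda>n. T (real n))"
  proof (rule CauchyI)
    fix r :: real assume "0 < r"
    then have "0 < r / sqrt (2 * pi)" by simp
    from CauchyD[OF LIMSEQ_imp_Cauchy[OF tn] this] obtain M where
      M: "\<And>m n. m \<ge> M \<Longrightarrow> n \<ge> M \<Longrightarrow> norm (t (real m) - t (real n)) < r / sqrt (2 * pi)" by blast
    have "norm (T (real m) - T (real n)) < r" if "m \<ge> M" "n \<ge> M" for m n
      using le[of "real m" "real n"] M[OF that] by (simp add: field_simps)
    then show "\<exists>M. \<forall>m\<ge>M. \<forall>n\<ge>M. norm (T (real m) - T (real n)) < r" by blast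
  qed
  then obtain z where z: "(\<lambda>n. T (real n)) \<longlonglongrightarrow> z"
    using Cauchy_convergent_iff convergent_def by blast
  have le': "norm (T R - z) \<le> sqrt (2 * pi) * norm (t R - abs_l2 f)" for R
  proof (rule LIMSEQ_le)
    show "(\<lambda>n. norm (T R - T (real n))) \<longlonglongrightarrow> norm (T R - z)" by (intro tendsto_intros z)
    show "(\<lambda>n. sqrt (2 * pi) * norm (t R - t (real n))) \<longlonglongrightarrow> sqrt (2 * pi) * norm (t R - abs_l2 f)"
      by (intro tendsto_intros tn)
  qed (use le in auto)
  have "((\<lambda>R. sqrt (2 * pi) * norm (t R - abs_l2 f)) \<longlongrightarrow> 0) at_top"
    by (intro tendsto_mult_right_zero tendsto_norm_zero LIM_zero t)
  then have "((\<lambda>R. T R - z) \<longlongrightarrow> 0) at_top"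
    by (rule Lim_null_comparison[rotated]) (auto intro: always_eventually le')
  then have "(T \<longlongrightarrow> z) at_top" by (simp add: LIM_zero_iff)
  then have "plancherel_transform f (rep_l2 z)"
    by (simp add: plancherel_transform_iff f T_def[symmetric])
  then show ?thesis by blast
qed

lemma plancherel_transform_unique:
  assumes "plancherel_transform f F" "plancherel_transform f F'"
  shows "AE \<xi> in lborel. F \<xi> = F' \<xi>"
proof -
  have "abs_l2 F = abs_l2 F'"
    using assms by (auto simp: plancherel_transform_iff intro: tendsto_unique[OF trivial_limit_at_top_linorder])
  then show ?thesis using assms by (simp add: plancherel_transform_iff abs_l2_eq_iff)
qed

lemma fourier_plancherel: "L2 f \<Longrightarrow> plancherel_transform f (fourier f)"
  unfolding fourier_def
  using plancherel_transform_L1[of f] someI_ex[OF plancherel_transform_exists[of f]] by simp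

lemma fourier_eq_AE: "plancherel_transform f F \<Longrightarrow> AE \<xi> in lborel. fourier f \<xi> = F \<xi>"
  by (rule plancherel_transform_unique[OF fourier_plancherel]) (auto simp: plancherel_transform_def)

lemma L2_fourier: "L2 f \<Longrightarrow> L2 (fourier f)"
  using fourier_plancherel by (simp add: plancherel_transform_def)

lemma fourier_borel: "L2 f \<Longrightarrow> fourier f \<in> borel_measurable borel"
  by (intro L2_borel L2_fourier)

lemma tendsto_fourier_truncate:
  "L2 f \<Longrightarrow> ((\<lambda>R. abs_l2 (fourier_integral (truncate R f))) \<longlongrightarrow> abs_l2 (fourier f)) at_top"
  using fourier_plancherel by (simp add: plancherel_transform_iff)

text \<open>The transforms agree at every frequency: the Fourier integral and the predicate from which
  a Plancherel transform is chosen depend on the class of the function only.\<close>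

lemma fourier_cong_AE:
  assumes fg: "AE x in lborel. f x = g x" and "L2 f" "L2 g" shows "fourier f = fourier g"
proof -
  note [measurable] = assms(2,3)[THEN L2_borel]
  have "fourier_integral (\<lambda>x. indicator {-R..R} x * f x) = fourier_integral (\<lambda>x. indicator {-R..R} x * g x)" for R
    by (rule fourier_integral_cong_AE) (use fg in auto)
  then have "plancherel_transform f = plancherel_transform g"
    using assms by (intro ext) (simp add: plancherel_transform_def)
  moreover have "integrable lborel f \<longleftrightarrow> integrable lborel g"
    by (rule integrable_cong_AE) (use fg in auto)
  moreover have "fourier_integral f = fourier_integral g"
    by (rule fourier_integral_cong_AE) (use fg in auto)
  ultimately show ?thesis by (simp add: fourier_def)
qed

lemma fourier_add:
  assumes f: "L2 f" and g: "L2 g"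
  shows "AE \<xi> in lborel. fourier (\<lambda>x. f x + g x) \<xi> = fourier f \<xi> + fourier g \<xi>"
proof (rule fourier_eq_AE)
  have "fourier_integral (truncate R (\<lambda>x. f x + g x)) = (\<lambda>\<xi>. fourier_integral (truncate R f) \<xi> + fourier_integral (truncate R g) \<xi>)" for R
    using fourier_integral_add[OF integrable_truncate[OF f, of R] integrable_truncate[OF g, of R]]
    by (intro ext) (simp add: truncate_def distrib_left)
  then have eq: "abs_l2 (fourier_integral (truncate R (\<lambda>x. f x + g x)))
      = abs_l2 (fourier_integral (truncate R f)) + abs_l2 (fourier_integral (truncate R g))" for R
    by (simp add: abs_l2_add f g L2_fourier_integral integrable_truncate L2_truncate)
  show "plancherel_transform (\<lambda>x. f x + g x) (\<lambda>\<xi>. fourier f \<xi> + fourier g \<xi>)"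
    unfolding plancherel_transform_iff eq
    by (simp add: abs_l2_add f g L2_fourier L2_add tendsto_add tendsto_fourier_truncate)
qed

lemma L2_norm_tendsto_iff:
  assumes "\<And>R. L2 (F R)" "L2 F'"
  shows "((\<lambda>R. abs_l2 (F R)) \<longlongrightarrow> abs_l2 F') A \<longleftrightarrow> ((\<lambda>R. L2_norm (\<lambda>\<xi>. F R \<xi> - F' \<xi>)) \<longlongrightarrow> 0) A"
proof -
  have "norm (abs_l2 (F R) - abs_l2 F') = L2_norm (\<lambda>\<xi>. F R \<xi> - F' \<xi>)" for R
    using assms by (simp add: abs_l2_diff[symmetric] norm_abs_l2 L2_diff)
  then show ?thesis
    using tendsto_norm_zero_iff[of "\<lambda>R. abs_l2 (F R) - abs_l2 F'" A] by (simp add: LIM_zero_iff)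
qed

lemma fourier_cmult:
  assumes f: "L2 f"
  shows "AE \<xi> in lborel. fourier (\<lambda>x. c * f x) \<xi> = c * fourier f \<xi>"
proof (rule fourier_eq_AE)
  have L: "L2 (fourier_integral (truncate R f))" for R
    by (intro L2_fourier_integral integrable_truncate L2_truncate f)
  have eq: "fourier_integral (truncate R (\<lambda>x. c * f x)) = (\<lambda>\<xi>. c * fourier_integral (truncate R f) \<xi>)" for R
    by (intro ext) (simp add: truncate_def mult.left_commute[of _ c] fourier_integral_cmult)
  have "((\<lambda>R. L2_norm (\<lambda>\<xi>. fourier_integral (truncate R f) \<xi> - fourier f \<xi>)) \<longlongrightarrow> 0) at_top"
    using tendsto_fourier_truncate[OF f] L by (subst (asm) L2_norm_tendsto_iff) (auto simp: L2_fourier f)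
  from tendsto_mult_right_zero[OF this, of "cmod c"]
  show "plancherel_transform (\<lambda>x. c * f x) (\<lambda>\<xi>. c * fourier f \<xi>)"
    unfolding plancherel_transform_iff eq
    by (subst L2_norm_tendsto_iff)
       (auto simp: L2_cmult f L L2_fourier L2_norm_cmult simp flip: right_diff_distrib)
qed

lemma L2_norm_cnj_reflect: "L2_norm (\<lambda>\<xi>. cnj (F (- \<xi>))) = L2_norm F"
  unfolding L2_norm_def using lborel_integral_reflect[of "\<lambda>\<xi>. (cmod (F \<xi>))\<^sup>2"] by simp

lemma fourier_cnj:
  assumes f: "L2 f"
  shows "AE \<xi> in lborel. fourier (\<lambda>x. cnj (f x)) \<xi> = cnj (fourier f (- \<xi>))"
proof (rule fourier_eq_AE)
  have L: "L2 (fourier_integral (truncate R f))" for R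
    by (intro L2_fourier_integral integrable_truncate L2_truncate f)
  have "truncate R (\<lambda>x. cnj (f x)) = (\<lambda>x. cnj (truncate R f x))" for R
    by (auto simp: truncate_def indicator_def)
  then have eq: "fourier_integral (truncate R (\<lambda>x. cnj (f x))) = (\<lambda>\<xi>. cnj (fourier_integral (truncate R f) (- \<xi>)))" for R
    by (intro ext) (simp add: fourier_integral_cnj)
  have "((\<lambda>R. L2_norm (\<lambda>\<xi>. fourier_integral (truncate R f) \<xi> - fourier f \<xi>)) \<longlongrightarrow> 0) at_top"
    using tendsto_fourier_truncate[OF f] L by (subst (asm) L2_norm_tendsto_iff) (auto simp: L2_fourier f)
  then show "plancherel_transform (\<lambda>x. cnj (f x)) (\<lambda>\<xi>. cnj (fourier f (- \<xi>)))"
    unfolding plancherel_transform_iff eq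
    using L2_norm_cnj_reflect[of "\<lambda>\<xi>. fourier_integral (truncate R f) \<xi> - fourier f \<xi>" for R]
    by (subst L2_norm_tendsto_iff) (auto intro!: L2_cnj L2_reflect f L L2_fourier)
qed

section \<open>Fourier inversion\<close>

text \<open>The limit of the formula for truncations, by continuity of the pairing.\<close>

lemma fourier_mult_formula:
  assumes f: "L2 f" and h: "integrable lborel h" "L2 h"
  shows "(LINT \<xi>|lborel. fourier f \<xi> * h \<xi>) = (LINT x|lborel. f x * fourier_integral h x)"
proof -
  interpret pairing: bounded_bilinear l2_pairing
    by (rule l2_pairing_bounded_bilinear)
  have t: "L2 (truncate R f)" "integrable lborel (truncate R f)" for R
    using f by (auto intro: L2_truncate integrable_truncate)
  have eq: "l2_pairing (abs_l2 (fourier_integral (truncate R f))) (abs_l2 h)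
      = l2_pairing (abs_l2 (truncate R f)) (abs_l2 (fourier_integral h))" for R
    using fourier_integral_mult_formula[OF t(2) h(1), of R]
    by (simp add: l2_pairing_abs L2_fourier_integral t h)
  have "((\<lambda>R. l2_pairing (abs_l2 (fourier_integral (truncate R f))) (abs_l2 h))
      \<longlongrightarrow> l2_pairing (abs_l2 (fourier f)) (abs_l2 h)) at_top"
    by (intro pairing.tendsto tendsto_const tendsto_fourier_truncate f)
  moreover have "((\<lambda>R. l2_pairing (abs_l2 (truncate R f)) (abs_l2 (fourier_integral h)))
      \<longlongrightarrow> l2_pairing (abs_l2 f) (abs_l2 (fourier_integral h))) at_top"
    by (intro pairing.tendsto tendsto_const tendsto_truncate f)
  ultimately have "l2_pairing (abs_l2 (fourier f)) (abs_l2 h)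
      = l2_pairing (abs_l2 f) (abs_l2 (fourier_integral h))"
    unfolding eq by (rule tendsto_unique[OF trivial_limit_at_top_linorder])
  then show ?thesis by (simp add: l2_pairing_abs f h L2_fourier L2_fourier_integral)
qed

definition gauss :: "real \<Rightarrow> complex" where
  "gauss x = of_real (exp (- x\<^sup>2 / 2))"

lemma gauss_borel [measurable]: "gauss \<in> borel_measurable borel"
  unfolding gauss_def by measurable

lemma gauss_nonzero: "gauss x \<noteq> 0"
  by (simp add: gauss_def)

lemma gauss_even [simp]: "gauss (- x) = gauss x"
  by (simp add: gauss_def)

lemma integrable_gauss: "integrable lborel gauss"
  using integrable_complex_gaussian[of 1] by (simp add: gauss_def[abs_def])

lemma L2_gauss: "L2 gauss"
proof (rule L2_bound[where g = "\<lambda>x. exp (- (1 * x)\<^sup>2 / 2)"])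
  have "(exp (- x\<^sup>2 / 2))\<^sup>2 \<le> exp (- x\<^sup>2 / 2) ^ 1" for x :: real
    by (rule power_decreasing) auto
  then show "(cmod (gauss x))\<^sup>2 \<le> exp (- (1 * x)\<^sup>2 / 2)" for x
    by (simp add: gauss_def)
qed (use integrable_real_gaussian[of 1] in auto)

lemma fourier_integral_gauss: "fourier_integral gauss \<xi> = of_real (sqrt (2 * pi)) * gauss \<xi>"
  using fourier_integral_gaussian[of 1 \<xi>] by (simp add: gauss_def[abs_def])

lemma L2_translate: "L2 f \<Longrightarrow> L2 (\<lambda>x. f (x + b))"
  using lborel_integrable_real_affine[of "\<lambda>x. (cmod (f x))\<^sup>2" 1 b]
    measurable_compose[of "\<lambda>x. x + b" borel borel f borel]
  by (auto simp: L2_def add.commute)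

lemma integrable_translate:
  fixes f :: "real \<Rightarrow> 'a :: {banach, second_countable_topology}"
  shows "integrable lborel f \<Longrightarrow> integrable lborel (\<lambda>x. f (x + b))"
  using lborel_integrable_real_affine[of f 1 b] by (simp add: add.commute)

lemma integral_translate:
  fixes f :: "real \<Rightarrow> 'a :: {banach, second_countable_topology}"
  shows "(LINT x|lborel. f (x + b)) = (LINT x|lborel. f x)"
  using lborel_integral_real_affine[of 1 f b] by (simp add: add.commute)

lemma fourier_integral_translate:
  "fourier_integral (\<lambda>x. f (x + b)) \<xi> = cis (b * \<xi>) * fourier_integral f \<xi>"
proof -
  have "fourier_integral (\<lambda>x. f (x + b)) \<xi> = (LINT x|lborel. cis (- ((x - b) * \<xi>)) * f x)"
    using integral_translate[of "\<lambda>x. cis (- ((x - b) * \<xi>)) * f x" b] by (simp add: fourier_integral_def)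
  also have "\<dots> = (LINT x|lborel. cis (b * \<xi>) * (cis (- (x * \<xi>)) * f x))"
    by (simp add: cis_mult algebra_simps flip: mult.assoc)
  finally show ?thesis by (simp add: fourier_integral_def)
qed

text \<open>Modulated Gaussians separate functions: the pairings are the Fourier integral of the
  integrable function \<open>u * gauss\<close>.\<close>

lemma AE_eq_0_if_modulated_gauss_pairings_vanish:
  assumes "integrable lborel (\<lambda>\<xi>. u \<xi> * gauss \<xi>)"
    and "\<And>b. (LINT \<xi>|lborel. u \<xi> * (cis (\<xi> * b) * gauss \<xi>)) = 0"
  shows "AE \<xi> in lborel. u \<xi> = 0"
proof -
  have "fourier_integral (\<lambda>\<xi>. u \<xi> * gauss \<xi>) b = 0" for b
    using assms(2)[of "- b"] by (simp add: fourier_integral_def ac_simps)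
  then have "AE \<xi> in lborel. u \<xi> * gauss \<xi> = 0"
    by (intro fourier_integral_eq_0_imp_AE assms)
  then show ?thesis by (simp add: gauss_nonzero)
qed

lemma L2_modulated_gauss: "L2 (\<lambda>\<xi>. cis (\<xi> * b) * gauss \<xi>)"
  by (rule L2_bounded_mult[OF L2_gauss, where c = 1]) auto

definition inv_fourier :: "(real \<Rightarrow> complex) \<Rightarrow> real \<Rightarrow> complex" where
  "inv_fourier F x = fourier_integral F (- x) / of_real (2 * pi)"

lemma L2_inv_fourier:
  assumes "integrable lborel F" "L2 F" shows "L2 (inv_fourier F)"
  using L2_cmult[OF L2_reflect[OF L2_fourier_integral[OF assms]], of "1 / of_real (2 * pi)"]
  by (simp add: inv_fourier_def[abs_def])

text \<open>Paired with a modulated Gaussian \<open>h\<close>, the transform of \<open>inv_fourier F\<close> is moved to \<open>h\<close> and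
  the one inside \<open>inv_fourier F\<close> is moved to the transform of \<open>h\<close>. Two transforms with a reflection in
  between return \<open>h\<close> up to the factor $2\pi$.\<close>

lemma fourier_inv_fourier:
  assumes F: "integrable lborel F" "L2 F"
  shows "AE \<xi> in lborel. fourier (inv_fourier F) \<xi> = F \<xi>"
proof -
  define f where "f = inv_fourier F"
  have f: "L2 f" unfolding f_def by (rule L2_inv_fourier[OF F])
  have "AE \<xi> in lborel. fourier f \<xi> - F \<xi> = 0"
  proof (rule AE_eq_0_if_modulated_gauss_pairings_vanish)
    show "integrable lborel (\<lambda>\<xi>. (fourier f \<xi> - F \<xi>) * gauss \<xi>)"
      by (intro L2_mult_integrable L2_diff L2_gauss F L2_fourier f)
    fix b
    define h where "h \<xi> = cis (\<xi> * b) * gauss \<xi>" for \<xi>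
    have h: "integrable lborel h" "L2 h"
      unfolding h_def by (auto intro: integrable_cis_mult integrable_gauss L2_modulated_gauss)
    have Fh: "fourier_integral h x = of_real (sqrt (2 * pi)) * gauss (x - b)" for x
      unfolding h_def by (simp add: fourier_integral_modulate fourier_integral_gauss)
    have Fhr: "fourier_integral h (- x) = of_real (sqrt (2 * pi)) * gauss (x + b)" for x
      unfolding Fh using gauss_even[of "x + b"] by (simp only: minus_add_distrib diff_conv_add_uminus)
    have "fourier_integral (\<lambda>x. fourier_integral h (- x)) \<xi> = of_real (sqrt (2 * pi)) * (cis (b * \<xi>) * (of_real (sqrt (2 * pi)) * gauss \<xi>))" for \<xi>
      unfolding Fhr by (simp add: fourier_integral_cmult fourier_integral_translate fourier_integral_gauss)
    then have FFh: "fourier_integral (\<lambda>x. fourier_integral h (- x)) \<xi> = of_real (2 * pi) * h \<xi>" for \<xi>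
      by (simp add: h_def mult.commute flip: of_real_mult)
    have "(LINT \<xi>|lborel. fourier f \<xi> * h \<xi>) = (LINT x|lborel. f x * fourier_integral h x)"
      by (rule fourier_mult_formula[OF f h])
    also have "\<dots> = (LINT x|lborel. f (- x) * fourier_integral h (- x))"
      by (rule lborel_integral_reflect[symmetric])
    also have "\<dots> = (LINT x|lborel. fourier_integral F x * fourier_integral h (- x)) / of_real (2 * pi)"
      by (simp add: f_def inv_fourier_def)
    also have "(LINT x|lborel. fourier_integral F x * fourier_integral h (- x)) = (LINT \<xi>|lborel. F \<xi> * (of_real (2 * pi) * h \<xi>))"
      unfolding FFh[symmetric]
      by (rule fourier_integral_mult_formula[OF F(1)]) (auto simp: Fhr intro!: integrable_translate integrable_gauss)
    also have "\<dots> = of_real (2 * pi) * (LINT \<xi>|lborel. F \<xi> * h \<xi>)"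
      by (subst integral_mult_right_zero[symmetric]) (simp add: ac_simps)
    finally have "(LINT \<xi>|lborel. fourier f \<xi> * h \<xi>) = (LINT \<xi>|lborel. F \<xi> * h \<xi>)" by simp
    then show "(LINT \<xi>|lborel. (fourier f \<xi> - F \<xi>) * (cis (\<xi> * b) * gauss \<xi>)) = 0"
      unfolding h_def[symmetric]
      by (simp add: left_diff_distrib L2_mult_integrable L2_fourier f F h)
  qed
  then show ?thesis by (simp add: f_def)
qed

text \<open>The test functions are the translated Gaussians, since their transforms are the modulated
  Gaussians.\<close>

lemma fourier_eq_0_imp_AE:
  assumes g: "L2 g" and 0: "AE \<xi> in lborel. fourier g \<xi> = 0"
  shows "AE x in lborel. g x = 0"
proof (rule AE_eq_0_if_modulated_gauss_pairings_vanish)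
  show "integrable lborel (\<lambda>x. g x * gauss x)" by (intro L2_mult_integrable g L2_gauss)
  fix b
  define h where "h \<xi> = gauss (\<xi> + b)" for \<xi>
  have h: "integrable lborel h" "L2 h"
    unfolding h_def by (auto intro: integrable_translate integrable_gauss L2_translate L2_gauss)
  have [measurable]: "fourier g \<in> borel_measurable borel" "h \<in> borel_measurable borel"
    using fourier_borel[OF g] L2_borel[OF h(2)] by auto
  have "(LINT x|lborel. g x * fourier_integral h x) = (LINT \<xi>|lborel. fourier g \<xi> * h \<xi>)"
    by (rule fourier_mult_formula[OF g h, symmetric])
  also have "\<dots> = (LINT \<xi>::real|lborel. 0)"
    by (rule integral_cong_AE) (use 0 in auto)
  finally have "of_real (sqrt (2 * pi)) * (LINT x|lborel. g x * (cis (x * b) * gauss x)) = 0"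
    by (subst integral_mult_right_zero[symmetric])
      (simp add: h_def[abs_def] fourier_integral_translate fourier_integral_gauss ac_simps)
  then show "(LINT x|lborel. g x * (cis (x * b) * gauss x)) = 0" by simp
qed

lemma fourier_diff:
  assumes "L2 f" "L2 g"
  shows "AE \<xi> in lborel. fourier (\<lambda>x. f x - g x) \<xi> = fourier f \<xi> - fourier g \<xi>"
  using fourier_add[OF assms(1) L2_cmult[OF assms(2), of "-1"]] fourier_cmult[OF assms(2), of "-1"]
  by eventually_elim simp

text \<open>The transform of the difference of both sides vanishes.\<close>

lemma fourier_inversion:
  assumes f: "L2 f" and F: "integrable lborel (fourier f)"
  shows "AE x in lborel. f x = inv_fourier (fourier f) x"
proof -
  have g: "L2 (inv_fourier (fourier f))" by (intro L2_inv_fourier F L2_fourier f)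
  have "AE \<xi> in lborel. fourier (\<lambda>x. f x - inv_fourier (fourier f) x) \<xi> = 0"
    using fourier_diff[OF f g] fourier_inv_fourier[OF F L2_fourier[OF f]] by eventually_elim simp
  then have "AE x in lborel. f x - inv_fourier (fourier f) x = 0"
    by (rule fourier_eq_0_imp_AE[OF L2_diff[OF f g]])
  then show ?thesis by simp
qed

lemma inv_fourier_cong_AE:
  assumes "AE \<xi> in lborel. F \<xi> = F' \<xi>" "F \<in> borel_measurable borel" "F' \<in> borel_measurable borel"
  shows "inv_fourier F = inv_fourier F'"
  using fourier_integral_cong_AE[OF assms] by (intro ext) (simp add: inv_fourier_def)

lemma L2_Re_Im:
  assumes "L2 f" shows "L2 (\<lambda>x. of_real (Re (f x)))" "L2 (\<lambda>x. of_real (Im (f x)))"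
proof -
  note [measurable] = L2_borel[OF assms]
  have "\<bar>Re z\<bar>\<^sup>2 \<le> (cmod z)\<^sup>2" "\<bar>Im z\<bar>\<^sup>2 \<le> (cmod z)\<^sup>2" for z
    using power_mono[OF abs_Re_le_cmod[of z], of 2] power_mono[OF abs_Im_le_cmod[of z], of 2] by auto
  then show "L2 (\<lambda>x. of_real (Re (f x)))" "L2 (\<lambda>x. of_real (Im (f x)))"
    by (auto intro!: L2_bound[OF _ L2_integrable[OF assms]])
qed

lemma fourier_Re_Im:
  assumes f: "L2 f"
  shows "AE \<xi> in lborel. fourier f \<xi> = Re_hat f \<xi> + \<i> * Im_hat f \<xi>"
    and "AE \<xi> in lborel. Re_hat f (- \<xi>) = cnj (Re_hat f \<xi>)"
    and "AE \<xi> in lborel. Im_hat f (- \<xi>) = cnj (Im_hat f \<xi>)"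
proof -
  note R = L2_Re_Im(1)[OF f] and I = L2_Re_Im(2)[OF f]
  have eq: "fourier f = fourier (\<lambda>x. of_real (Re (f x)) + \<i> * of_real (Im (f x)))"
    by (simp flip: complex_eq)
  show "AE \<xi> in lborel. fourier f \<xi> = Re_hat f \<xi> + \<i> * Im_hat f \<xi>"
    unfolding eq Re_hat_def Im_hat_def
    using fourier_add[OF R L2_cmult[OF I, of \<i>]] fourier_cmult[OF I, of \<i>]
    by eventually_elim (simp flip: complex_eq)
  show "AE \<xi> in lborel. Re_hat f (- \<xi>) = cnj (Re_hat f \<xi>)"
    using fourier_cnj[OF R] unfolding Re_hat_def by (auto elim: eventually_mono)
  show "AE \<xi> in lborel. Im_hat f (- \<xi>) = cnj (Im_hat f \<xi>)"
    using fourier_cnj[OF I] unfolding Im_hat_def by (auto elim: eventually_mono)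
qed

text \<open>For integrable functions the transforms are integrals and the identities hold at every
  frequency. This is the case of the nonlinearity.\<close>

lemma Re_Im_hat_L1:
  assumes f: "integrable lborel f"
  shows "fourier_integral f \<xi> = Re_hat f \<xi> + \<i> * Im_hat f \<xi>"
    and "Re_hat f (- \<xi>) = cnj (Re_hat f \<xi>)" and "Im_hat f (- \<xi>) = cnj (Im_hat f \<xi>)"
proof -
  have R: "integrable lborel (\<lambda>x. complex_of_real (Re (f x)))" and I: "integrable lborel (\<lambda>x. complex_of_real (Im (f x)))"
    using f by simp_all
  have eqs: "Re_hat f = fourier_integral (\<lambda>x. of_real (Re (f x)))" "Im_hat f = fourier_integral (\<lambda>x. of_real (Im (f x)))"
    unfolding Re_hat_def Im_hat_def fourier_def using R I by simp_all
  have "fourier_integral f \<xi> = fourier_integral (\<lambda>x. of_real (Re (f x)) + \<i> * of_real (Im (f x))) \<xi>"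
    by (simp flip: complex_eq)
  then show "fourier_integral f \<xi> = Re_hat f \<xi> + \<i> * Im_hat f \<xi>"
    unfolding eqs fourier_integral_add[OF R integrable_mult_right[OF I]] fourier_integral_cmult .
  show "Re_hat f (- \<xi>) = cnj (Re_hat f \<xi>)" "Im_hat f (- \<xi>) = cnj (Im_hat f \<xi>)"
    unfolding eqs using fourier_integral_cnj[of "\<lambda>x. of_real (Re (f x))" "- \<xi>"] fourier_integral_cnj[of "\<lambda>x. of_real (Im (f x))" "- \<xi>"]
    by simp_all
qed

definition cscale :: "complex \<Rightarrow> l2 \<Rightarrow> l2" where "cscale c z = abs_l2 (\<lambda>\<xi>. c * rep_l2 z \<xi>)"

lemma cscale_of_real: "cscale (of_real r) z = r *\<^sub>R z"
  unfolding cscale_def by (subst abs_l2_scaleR) auto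

lemma norm_cscale: "norm (cscale c z) = cmod c * norm z"
  unfolding cscale_def by (simp add: norm_abs_l2 L2_cmult L2_norm_cmult norm_rep_l2)

lemma rep_cscale: "AE \<xi> in lborel. rep_l2 (cscale c z) \<xi> = c * rep_l2 z \<xi>"
  unfolding cscale_def by (intro rep_abs_l2 L2_cmult L2_rep_l2)

lemma bounded_linear_cscale: "bounded_linear (cscale c)"
proof (rule bounded_linear_intro[where K = "cmod c"])
  fix y z and r :: real
  show "cscale c (y + z) = cscale c y + cscale c z"
    by (rule l2_eqI)
      (use rep_cscale[of c "y + z"] rep_cscale[of c y] rep_cscale[of c z] rep_l2_add[of y z] rep_l2_add[of "cscale c y" "cscale c z"]
       in \<open>eventually_elim, simp add: distrib_left\<close>)
  show "cscale c (r *\<^sub>R y) = r *\<^sub>R cscale c y"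
    by (rule l2_eqI)
      (use rep_cscale[of c "r *\<^sub>R y"] rep_cscale[of c y] rep_l2_scaleR[of r y] rep_l2_scaleR[of r "cscale c y"]
       in \<open>eventually_elim, simp\<close>)
qed (simp add: norm_cscale mult.commute)

text \<open>Complex conjugation of a function, expressed by its transform.\<close>

definition star :: "l2 \<Rightarrow> l2" where "star z = abs_l2 (\<lambda>\<xi>. cnj (rep_l2 z (- \<xi>)))"

lemma L2_star: "L2 (\<lambda>\<xi>. cnj (rep_l2 z (- \<xi>)))"
  by (intro L2_cnj L2_reflect L2_rep_l2)

lemma rep_star: "AE \<xi> in lborel. rep_l2 (star z) \<xi> = cnj (rep_l2 z (- \<xi>))"
  unfolding star_def by (intro rep_abs_l2 L2_star)

lemma norm_star: "norm (star z) = norm z"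
  unfolding star_def by (simp add: norm_abs_l2 L2_star L2_norm_cnj_reflect norm_rep_l2)

lemma bounded_linear_star: "bounded_linear star"
proof (rule bounded_linear_intro[where K = 1])
  fix y z and r :: real
  show "star (y + z) = star y + star z"
    by (rule l2_eqI)
      (use rep_star[of "y + z"] rep_star[of y] rep_star[of z] lborel_AE_reflect[OF rep_l2_add[of y z]] rep_l2_add[of "star y" "star z"]
       in \<open>eventually_elim, simp\<close>)
  show "star (r *\<^sub>R y) = r *\<^sub>R star y"
    by (rule l2_eqI)
      (use rep_star[of "r *\<^sub>R y"] rep_star[of y] lborel_AE_reflect[OF rep_l2_scaleR[of r y]] rep_l2_scaleR[of r "star y"]
       in \<open>eventually_elim, simp\<close>)
qed (simp add: norm_star)

lemma L2_norm_translate: "L2_norm (\<lambda>x. f (x + b)) = L2_norm f"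
  unfolding L2_norm_def using integral_translate[of "\<lambda>x. (cmod (f x))\<^sup>2" b] by simp

lemma L2_convolution_arg: "L2 f \<Longrightarrow> L2 (\<lambda>\<eta>. f (\<xi> - \<eta>))"
  using L2_reflect[OF L2_translate[of f \<xi>]] by (simp add: add.commute)

lemma fourier_integral_convolution:
  assumes F: "integrable lborel F" and H: "integrable lborel H"
  shows "fourier_integral (\<lambda>\<xi>. LINT \<eta>|lborel. F (\<xi> - \<eta>) * H \<eta>) x = fourier_integral F x * fourier_integral H x"
proof -
  have [measurable]: "F \<in> borel_measurable borel" "H \<in> borel_measurable borel"
    using assms by auto
  have tr: "integrable lborel (\<lambda>\<xi>. F (\<xi> - \<eta>))" "(LINT \<xi>|lborel. cmod (F (\<xi> - \<eta>))) = (LINT \<xi>|lborel. cmod (F \<xi>))" for \<eta>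
    using integrable_translate[OF F, of "- \<eta>"] integral_translate[of "\<lambda>\<xi>. cmod (F \<xi>)" "- \<eta>"] by simp_all
  have "integrable (lborel \<Otimes>\<^sub>M lborel) (\<lambda>(\<eta>, \<xi>). cis (- (\<xi> * x)) * (F (\<xi> - \<eta>) * H \<eta>))"
  proof (rule lborel_pair.Fubini_integrable)
    show "integrable lborel (\<lambda>\<eta>. LINT \<xi>|lborel. norm (case (\<eta>, \<xi>) of (\<eta>, \<xi>) \<Rightarrow> cis (- (\<xi> * x)) * (F (\<xi> - \<eta>) * H \<eta>)))"
      using H by (simp add: norm_mult tr)
    show "AE \<eta> in lborel. integrable lborel (\<lambda>\<xi>. case (\<eta>, \<xi>) of (\<eta>, \<xi>) \<Rightarrow> cis (- (\<xi> * x)) * (F (\<xi> - \<eta>) * H \<eta>))"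
      using tr by (auto intro!: integrable_cis_mult)
  qed measurable
  then have "(LINT \<xi>|lborel. LINT \<eta>|lborel. cis (- (\<xi> * x)) * (F (\<xi> - \<eta>) * H \<eta>))
      = (LINT \<eta>|lborel. LINT \<xi>|lborel. cis (- (\<xi> * x)) * (F (\<xi> - \<eta>) * H \<eta>))"
    by (rule lborel_pair.Fubini_integral)
  also have "\<dots> = (LINT \<eta>|lborel. fourier_integral F x * (cis (- (\<eta> * x)) * H \<eta>))"
  proof (intro Bochner_Integration.integral_cong refl)
    fix \<eta>
    have "(LINT \<xi>|lborel. cis (- (\<xi> * x)) * (F (\<xi> - \<eta>) * H \<eta>)) = fourier_integral (\<lambda>\<xi>. F (\<xi> + - \<eta>)) x * H \<eta>"
      by (simp add: fourier_integral_def flip: integral_mult_left_zero mult.assoc)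
    also have "\<dots> = fourier_integral F x * (cis (- (\<eta> * x)) * H \<eta>)"
      unfolding fourier_integral_translate by simp
    finally show "(LINT \<xi>|lborel. cis (- (\<xi> * x)) * (F (\<xi> - \<eta>) * H \<eta>)) = fourier_integral F x * (cis (- (\<eta> * x)) * H \<eta>)" .
  qed
  finally show ?thesis by (simp add: fourier_integral_def)
qed

section \<open>The Sobolev space as a weighted space of transforms\<close>

text \<open>Comparison with the power $|x|^{-2s}$, which is integrable at infinity for $s > 1/2$.\<close>

lemma integrable_bracket_powr:
  assumes s: "1/2 < (s::real)"
  shows "integrable lborel (\<lambda>\<xi>::real. (1 + \<xi>\<^sup>2) powr (- s))"
proof -
  have "((\<lambda>x::real. x powr (- 2 * s)) has_integral - (1 powr (- 2 * s + 1)) / (- 2 * s + 1)) {1..}"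
    by (rule has_integral_powr_to_inf) (use s in auto)
  then have "(\<lambda>x::real. x powr (- 2 * s)) absolutely_integrable_on {1..}"
    by (intro nonnegative_absolutely_integrable_1) (auto simp: integrable_on_def)
  then have 1: "integrable lborel (\<lambda>x::real. indicator {1..} x * x powr (- 2 * s))"
    by (subst (asm) set_integrable_def, subst (asm) integrable_completion) auto
  then have "integrable lborel (\<lambda>x::real. indicator {1..} (- x) * (- x) powr (- 2 * s))"
    using lborel_integrable_reflect[of "\<lambda>x::real. indicator {1..} x * x powr (- 2 * s)"] by simp
  with 1 have *: "integrable lborel (\<lambda>x::real. indicator {-1..1} x + (indicator {1..} x * x powr (- 2 * s)
      + indicator {1..} (- x) * (- x) powr (- 2 * s)))" (is "integrable lborel ?b")
    by (intro Bochner_Integration.integrable_add) (auto intro!: integrable_real_indicator)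
  have "(1 + x\<^sup>2) powr (- s) \<le> ?b x" for x :: real
  proof -
    have le1: "(1 + x\<^sup>2) powr (- s) \<le> 1"
      using powr_mono[of "- s" 0 "1 + x\<^sup>2"] s by (simp split: if_splits)
    have le2: "(1 + x\<^sup>2) powr (- s) \<le> \<bar>x\<bar> powr (- 2 * s)" if "1 \<le> \<bar>x\<bar>"
    proof -
      have "\<bar>x\<bar> powr (- 2 * s) = (x\<^sup>2) powr (- s)"
        using powr_powr[of "\<bar>x\<bar>" 2 "- s"] by simp
      then show ?thesis
        using that s by (auto intro!: powr_mono2')
    qed
    consider "\<bar>x\<bar> \<le> 1" | "1 \<le> x" | "1 \<le> - x" by linarith
    then show ?thesis
      using le1 le2 by cases (auto simp: indicator_def abs_if split: if_splits)
  qed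
  then show ?thesis
    by (intro Bochner_Integration.integrable_bound[OF *] AE_I2) (auto intro: order_trans[OF _ abs_ge_self])
qed

lemma one_plus_sq_pos: "0 < 1 + (\<xi>::real)\<^sup>2"
  by (simp add: add_pos_nonneg)

locale sobolev =
  fixes s :: real
  assumes s: "1/2 < s"
begin

text \<open>\<open>W\<close> is the weight of the norm of $H^s$ and \<open>m\<close> its square root. \<open>E\<close> assigns coordinates in \<open>l2\<close> to
  an element of $H^s$, \<open>spec\<close> recovers its transform from the coordinates, and \<open>D\<close> the function itself.
  The values of \<open>D\<close> are integrals that depend on the class only, so \<open>D\<close> is linear at every point and not
  merely almost everywhere.\<close>

definition W :: "real \<Rightarrow> real" where "W \<xi> = (1 + \<xi>\<^sup>2) powr s"
definition m :: "real \<Rightarrow> real" where "m \<xi> = (1 + \<xi>\<^sup>2) powr (s / 2)"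
definition E :: "(real \<Rightarrow> complex) \<Rightarrow> l2" where
  "E f = abs_l2 (\<lambda>\<xi>. of_real (m \<xi>) * fourier f \<xi>)"
definition spec :: "l2 \<Rightarrow> real \<Rightarrow> complex" where
  "spec z \<xi> = rep_l2 z \<xi> / of_real (m \<xi>)"
definition D :: "l2 \<Rightarrow> real \<Rightarrow> complex" where "D z = inv_fourier (spec z)"

lemma m_ge_1: "1 \<le> m \<xi>"
  unfolding m_def using s by (intro ge_one_powr_ge_zero) auto

lemma m_pos: "0 < m \<xi>"
  using m_ge_1[of \<xi>] by simp

lemma m_nonzero [simp]: "m \<xi> \<noteq> 0"
  using m_pos[of \<xi>] by simp

lemma m_even [simp]: "m (- \<xi>) = m \<xi>"
  by (simp add: m_def)

lemma m_sq: "(m \<xi>)\<^sup>2 = W \<xi>"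
  using powr_powr[of "1 + \<xi>\<^sup>2" "s / 2" 2] one_plus_sq_pos[of \<xi>] by (simp add: m_def W_def)

lemma m_borel [measurable]: "m \<in> borel_measurable borel"
  unfolding m_def[abs_def] by measurable

lemma W_borel [measurable]: "W \<in> borel_measurable borel"
  unfolding W_def[abs_def] by measurable

lemma W_pos: "0 < W \<xi>"
  using m_pos[of \<xi>] by (simp flip: m_sq)

lemma inverse_W: "1 / W \<xi> = (1 + \<xi>\<^sup>2) powr (- s)"
  by (simp add: W_def powr_minus_divide)

lemma integrable_inverse_W: "integrable lborel (\<lambda>\<xi>. 1 / W \<xi>)"
  unfolding inverse_W by (rule integrable_bracket_powr[OF s])

lemma L2_inverse_m: "L2 (\<lambda>\<xi>. 1 / of_real (m \<xi>))"
  by (rule L2_bound[OF _ integrable_inverse_W]) (auto simp: norm_divide power_divide m_sq m_pos less_imp_le)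

lemma cmod_weighted_squared:
  "(cmod (of_real (m \<xi>) * z))\<^sup>2 = (1 + \<xi>\<^sup>2) powr s * (cmod z)\<^sup>2"
  using m_sq[of \<xi>] by (simp add: norm_mult power_mult_distrib W_def)

lemma Hs_iff: "f \<in> Hs s \<longleftrightarrow> L2 f \<and> L2 (\<lambda>\<xi>. of_real (m \<xi>) * fourier f \<xi>)"
  using fourier_borel[of f]
  by (auto simp: Hs_def L2_def[of "\<lambda>\<xi>. of_real (m \<xi>) * fourier f \<xi>"] cmod_weighted_squared)

lemma Hs_L2: "f \<in> Hs s \<Longrightarrow> L2 f"
  by (simp add: Hs_iff)

lemma Hs_norm_eq: "f \<in> Hs s \<Longrightarrow> Hs_norm s f = norm (E f)"
  by (simp add: Hs_norm_def E_def norm_abs_l2 Hs_iff L2_norm_def cmod_weighted_squared)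

text \<open>The coordinates can be read off from any representative of the weighted transform.\<close>

lemma Hs_if_transform:
  assumes f: "L2 f" and h: "L2 h" and AE: "AE \<xi> in lborel. h \<xi> = of_real (m \<xi>) * fourier f \<xi>"
  shows "f \<in> Hs s" "E f = abs_l2 h"
proof -
  note [measurable] = fourier_borel[OF f]
  have L: "L2 (\<lambda>\<xi>. of_real (m \<xi>) * fourier f \<xi>)" by (rule L2_AE_cong[OF h _ AE]) measurable
  then show "f \<in> Hs s" using f by (simp add: Hs_iff)
  show "E f = abs_l2 h" unfolding E_def abs_l2_eq_iff[OF L h] using AE by (auto elim: eventually_mono)
qed

lemma rep_E: "f \<in> Hs s \<Longrightarrow> AE \<xi> in lborel. rep_l2 (E f) \<xi> = of_real (m \<xi>) * fourier f \<xi>"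
  unfolding E_def by (rule rep_abs_l2) (simp add: Hs_iff)

lemma spec_borel [measurable]: "spec z \<in> borel_measurable borel"
  unfolding spec_def[abs_def] by measurable

lemma integrable_spec: "integrable lborel (spec z)"
  using L2_mult_integrable[OF L2_rep_l2 L2_inverse_m, of z] by (simp add: spec_def[abs_def])

lemma cmod_spec_le: "cmod (spec z \<xi>) \<le> cmod (rep_l2 z \<xi>)"
  using m_ge_1[of \<xi>] mult_left_mono[OF m_ge_1[of \<xi>], of "cmod (rep_l2 z \<xi>)"]
  by (simp add: spec_def norm_divide divide_le_eq)

lemma L2_spec: "L2 (spec z)"
  by (rule L2_bound[OF _ L2_integrable[OF L2_rep_l2[of z]]]) (auto intro!: power_mono cmod_spec_le)

lemma L2_D: "L2 (D z)"
  unfolding D_def by (intro L2_inv_fourier integrable_spec L2_spec)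

lemma fourier_D: "AE \<xi> in lborel. fourier (D z) \<xi> = spec z \<xi>"
  unfolding D_def by (intro fourier_inv_fourier integrable_spec L2_spec)

lemma m_fourier_D: "AE \<xi> in lborel. of_real (m \<xi>) * fourier (D z) \<xi> = rep_l2 z \<xi>"
  using fourier_D[of z] by eventually_elim (simp add: spec_def)

lemma D_Hs: "D z \<in> Hs s" and E_D [simp]: "E (D z) = z"
proof -
  have "AE \<xi> in lborel. rep_l2 z \<xi> = of_real (m \<xi>) * fourier (D z) \<xi>"
    using m_fourier_D[of z] by (auto elim: eventually_mono)
  from Hs_if_transform[OF L2_D L2_rep_l2 this] show "D z \<in> Hs s" "E (D z) = z" by simp_all
qed

lemma spec_E: "f \<in> Hs s \<Longrightarrow> AE \<xi> in lborel. spec (E f) \<xi> = fourier f \<xi>"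
  using rep_E[of f] by (simp add: spec_def) (auto elim: eventually_mono)

lemma D_E: assumes f: "f \<in> Hs s" shows "AE x in lborel. D (E f) x = f x"
proof -
  note [measurable] = fourier_borel[OF Hs_L2[OF f]]
  have eq: "D (E f) = inv_fourier (fourier f)"
    unfolding D_def by (rule inv_fourier_cong_AE) (auto intro: spec_E f)
  have "integrable lborel (fourier f)"
    using integrable_cong_AE[of "spec (E f)" lborel "fourier f"] spec_E[OF f] integrable_spec[of "E f"] by simp
  from fourier_inversion[OF Hs_L2[OF f] this] show ?thesis
    unfolding eq by eventually_elim simp
qed

lemma E_eq_iff: assumes "f \<in> Hs s" "g \<in> Hs s" shows "E f = E g \<longleftrightarrow> (AE x in lborel. f x = g x)"
proof
  assume "E f = E g"
  then have "AE x in lborel. D (E g) x = f x" using D_E[OF assms(1)] by simp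
  with D_E[OF assms(2)] show "AE x in lborel. f x = g x" by eventually_elim simp
next
  assume "AE x in lborel. f x = g x"
  then have "fourier f = fourier g" by (intro fourier_cong_AE Hs_L2 assms)
  then show "E f = E g" by (simp add: E_def)
qed

lemma Hs_cong_AE:
  assumes "f \<in> Hs s" "AE x in lborel. f x = g x" "g \<in> borel_measurable borel"
  shows "g \<in> Hs s" "E g = E f"
proof -
  have g: "L2 g" by (rule L2_AE_cong[OF Hs_L2[OF assms(1)] assms(3,2)])
  have "fourier f = fourier g" by (rule fourier_cong_AE[OF assms(2) Hs_L2[OF assms(1)] g])
  then show "g \<in> Hs s" "E g = E f" using assms(1) g by (simp_all add: Hs_iff E_def)
qed

lemma Hs_add:
  assumes f: "f \<in> Hs s" and g: "g \<in> Hs s"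
  shows "(\<lambda>x. f x + g x) \<in> Hs s" "E (\<lambda>x. f x + g x) = E f + E g"
proof -
  have L: "L2 f" "L2 g" using f g by (auto intro: Hs_L2)
  have "AE \<xi> in lborel. rep_l2 (E f + E g) \<xi> = of_real (m \<xi>) * fourier (\<lambda>x. f x + g x) \<xi>"
    using fourier_add[OF L] rep_l2_add[of "E f" "E g"] rep_E[OF f] rep_E[OF g] by eventually_elim (simp add: distrib_left)
  from Hs_if_transform[OF L2_add[OF L] L2_rep_l2 this]
  show "(\<lambda>x. f x + g x) \<in> Hs s" "E (\<lambda>x. f x + g x) = E f + E g" by simp_all
qed

lemma Hs_cmult:
  assumes f: "f \<in> Hs s"
  shows "(\<lambda>x. c * f x) \<in> Hs s" "E (\<lambda>x. c * f x) = cscale c (E f)"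
proof -
  have "AE \<xi> in lborel. rep_l2 (cscale c (E f)) \<xi> = of_real (m \<xi>) * fourier (\<lambda>x. c * f x) \<xi>"
    using fourier_cmult[OF Hs_L2[OF f], of c] rep_cscale[of c "E f"] rep_E[OF f] by eventually_elim simp
  from Hs_if_transform[OF L2_cmult[OF Hs_L2[OF f]] L2_rep_l2 this]
  show "(\<lambda>x. c * f x) \<in> Hs s" "E (\<lambda>x. c * f x) = cscale c (E f)" by simp_all
qed

lemma Hs_cnj:
  assumes f: "f \<in> Hs s"
  shows "(\<lambda>x. cnj (f x)) \<in> Hs s" "E (\<lambda>x. cnj (f x)) = star (E f)"
proof -
  have "AE \<xi> in lborel. rep_l2 (star (E f)) \<xi> = of_real (m \<xi>) * fourier (\<lambda>x. cnj (f x)) \<xi>"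
    using fourier_cnj[OF Hs_L2[OF f]] rep_star[of "E f"] lborel_AE_reflect[OF rep_E[OF f]] by eventually_elim simp
  from Hs_if_transform[OF L2_cnj[OF Hs_L2[OF f]] L2_rep_l2 this]
  show "(\<lambda>x. cnj (f x)) \<in> Hs s" "E (\<lambda>x. cnj (f x)) = star (E f)" by simp_all
qed

lemma Hs_scaleR:
  "f \<in> Hs s \<Longrightarrow> E (\<lambda>x. of_real r * f x) = r *\<^sub>R E f"
  by (simp add: Hs_cmult cscale_of_real)

lemma Hs_diff:
  assumes "f \<in> Hs s" "g \<in> Hs s"
  shows "(\<lambda>x. f x - g x) \<in> Hs s" "E (\<lambda>x. f x - g x) = E f - E g"
  using Hs_add[OF assms(1) Hs_cmult(1)[OF assms(2), of "of_real (-1)"]] Hs_scaleR[OF assms(2), of "-1"] by simp_all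

lemma D_add: "D (y + z) x = D y x + D z x"
proof -
  have "D (y + z) = inv_fourier (\<lambda>\<xi>. spec y \<xi> + spec z \<xi>)"
    unfolding D_def
    by (rule inv_fourier_cong_AE) (use rep_l2_add[of y z] in \<open>auto simp: spec_def add_divide_distrib elim: eventually_mono\<close>)
  then show ?thesis
    by (simp add: D_def inv_fourier_def fourier_integral_add integrable_spec add_divide_distrib)
qed

lemma D_scaleR: "D (r *\<^sub>R z) x = of_real r * D z x"
proof -
  have "D (r *\<^sub>R z) = inv_fourier (\<lambda>\<xi>. of_real r * spec z \<xi>)"
    unfolding D_def
    by (rule inv_fourier_cong_AE) (use rep_l2_scaleR[of r z] in \<open>auto simp: spec_def elim: eventually_mono\<close>)
  then show ?thesis
    by (simp add: D_def inv_fourier_def fourier_integral_cmult)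
qed

text \<open>Bessel's inequality for the inverse transform.\<close>

lemma L2_norm_D_le: "L2_norm (D z) \<le> norm z"
proof -
  have "L2_norm (D z) = L2_norm (\<lambda>x. 1 / of_real (2 * pi) * cnj (cnj (fourier_integral (spec z) (- x))))"
    by (simp add: D_def inv_fourier_def[abs_def])
  also have "\<dots> = 1 / (2 * pi) * L2_norm (\<lambda>x. cnj (fourier_integral (\<lambda>x. cnj (spec z x)) x))"
    unfolding L2_norm_cmult by (simp add: fourier_integral_cnj norm_divide)
  also have "L2_norm (\<lambda>x. cnj (fourier_integral (\<lambda>x. cnj (spec z x)) x)) = L2_norm (fourier_integral (\<lambda>x. cnj (spec z x)))"
    by (simp add: L2_norm_def)
  also have "\<dots> \<le> sqrt (2 * pi) * L2_norm (\<lambda>x. cnj (spec z x))"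
    by (rule L2_norm_fourier_integral_le) (auto intro: integrable_spec L2_cnj L2_spec)
  also have "L2_norm (\<lambda>x. cnj (spec z x)) = L2_norm (spec z)" by (simp add: L2_norm_def)
  also have "L2_norm (spec z) \<le> norm z"
    unfolding norm_rep_l2[symmetric] by (rule L2_norm_mono[OF L2_spec L2_rep_l2 cmod_spec_le])
  finally have "L2_norm (D z) \<le> 1 / (2 * pi) * (sqrt (2 * pi) * norm z)"
    by (simp add: divide_right_mono mult_left_mono)
  also have "\<dots> = norm z / sqrt (2 * pi)"
    using real_sqrt_pow2[of "2 * pi"] pi_gt_zero by (simp add: field_simps power2_eq_square)
  also have "\<dots> \<le> norm z / 1"
    using pi_gt3 by (intro divide_left_mono) auto
  finally show ?thesis by simp
qed

section \<open>The algebra property\<close>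

text \<open>The transform of a product is the convolution of the transforms up to the factor $2\pi$
  (\<open>fourier_D_mult\<close>).\<close>

definition conv :: "l2 \<Rightarrow> l2 \<Rightarrow> real \<Rightarrow> complex" where
  "conv y z \<xi> = (LINT \<eta>|lborel. spec y (\<xi> - \<eta>) * spec z \<eta>)"

lemma conv_borel [measurable]: "conv y z \<in> borel_measurable borel"
  unfolding conv_def[abs_def] by measurable

definition \<kappa> :: real where "\<kappa> = (LINT \<xi>|lborel. 1 / W \<xi>)"

lemma \<kappa>_nonneg: "0 \<le> \<kappa>"
  unfolding \<kappa>_def using W_pos by (intro integral_nonneg_AE AE_I2) (simp add: less_imp_le)

lemma nn_integral_inverse_W: "(\<integral>\<^sup>+\<eta>. ennreal (1 / W \<eta>) \<partial>lborel) = ennreal \<kappa>"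
  unfolding \<kappa>_def by (intro nn_integral_eq_integral integrable_inverse_W AE_I2) (simp add: W_pos less_imp_le)

text \<open>One of \<open>\<xi> - \<eta>\<close> and \<open>\<eta>\<close> has at least half the size of \<open>\<xi>\<close>.\<close>

lemma W_triangle: "W \<xi> \<le> 4 powr s * (W (\<xi> - \<eta>) + W \<eta>)"
proof -
  have "\<xi>\<^sup>2 \<le> 2 * (\<xi> - \<eta>)\<^sup>2 + 2 * \<eta>\<^sup>2"
    using zero_le_power2[of "\<xi> - 2 * \<eta>"] by (simp add: power2_eq_square algebra_simps)
  then have le: "1 + \<xi>\<^sup>2 \<le> 4 * max (1 + (\<xi> - \<eta>)\<^sup>2) (1 + \<eta>\<^sup>2)"
    using zero_le_power2[of \<eta>] zero_le_power2[of "\<xi> - \<eta>"] by (auto simp: max_def)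
  have "W \<xi> \<le> (4 * max (1 + (\<xi> - \<eta>)\<^sup>2) (1 + \<eta>\<^sup>2)) powr s"
    unfolding W_def using s one_plus_sq_pos[of \<xi>] by (intro powr_mono2 le) auto
  also have "\<dots> = 4 powr s * (max (1 + (\<xi> - \<eta>)\<^sup>2) (1 + \<eta>\<^sup>2)) powr s"
    using one_plus_sq_pos[of \<eta>] by (intro powr_mult)
  also have "(max (1 + (\<xi> - \<eta>)\<^sup>2) (1 + \<eta>\<^sup>2)) powr s \<le> W (\<xi> - \<eta>) + W \<eta>"
    using W_pos[of \<eta>] W_pos[of "\<xi> - \<eta>"] by (auto simp: max_def W_def)
  finally show ?thesis by (simp add: mult_left_mono)
qed

text \<open>By the triangle inequality for the weight the integrand is at most a constant times the sum of
  the two integrable functions $1/W(\<eta>)$ and $1/W(\<xi>-\<eta>)$.\<close>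

lemma weighted_kernel_bound:
  "(\<integral>\<^sup>+\<eta>. ennreal (W \<xi> / (W (\<xi> - \<eta>) * W \<eta>)) \<partial>lborel) \<le> ennreal (2 * 4 powr s * \<kappa>)"
proof -
  have tr: "(\<integral>\<^sup>+\<eta>. ennreal (1 / W (\<xi> - \<eta>)) \<partial>lborel) = ennreal \<kappa>"
    using nn_integral_real_affine[of "\<lambda>\<eta>. ennreal (1 / W \<eta>)" "-1" \<xi>] nn_integral_inverse_W by simp
  have "(\<integral>\<^sup>+\<eta>. ennreal (W \<xi> / (W (\<xi> - \<eta>) * W \<eta>)) \<partial>lborel)
      \<le> (\<integral>\<^sup>+\<eta>. ennreal (4 powr s) * (ennreal (1 / W \<eta>) + ennreal (1 / W (\<xi> - \<eta>))) \<partial>lborel)"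
  proof (rule nn_integral_mono)
    fix \<eta>
    have p: "0 < W \<eta>" "0 < W (\<xi> - \<eta>)" by (rule W_pos)+
    have "W \<xi> / (W (\<xi> - \<eta>) * W \<eta>) \<le> 4 powr s * (W (\<xi> - \<eta>) + W \<eta>) / (W (\<xi> - \<eta>) * W \<eta>)"
      using p by (intro divide_right_mono W_triangle) auto
    also have "\<dots> = 4 powr s * (1 / W \<eta> + 1 / W (\<xi> - \<eta>))"
      using p by (simp add: field_simps)
    finally have "ennreal (W \<xi> / (W (\<xi> - \<eta>) * W \<eta>)) \<le> ennreal (4 powr s * (1 / W \<eta> + 1 / W (\<xi> - \<eta>)))"
      by (rule ennreal_leI)
    also have "\<dots> = ennreal (4 powr s) * (ennreal (1 / W \<eta>) + ennreal (1 / W (\<xi> - \<eta>)))"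
      using p by (simp add: ennreal_mult ennreal_plus)
    finally show "ennreal (W \<xi> / (W (\<xi> - \<eta>) * W \<eta>)) \<le> ennreal (4 powr s) * (ennreal (1 / W \<eta>) + ennreal (1 / W (\<xi> - \<eta>)))" .
  qed
  also have "\<dots> = ennreal (4 powr s) * (ennreal \<kappa> + ennreal \<kappa>)"
    by (simp add: nn_integral_cmult nn_integral_add nn_integral_inverse_W tr)
  also have "\<dots> = ennreal (2 * 4 powr s * \<kappa>)"
    by (simp add: \<kappa>_nonneg flip: ennreal_plus ennreal_mult)
  finally show ?thesis .
qed

text \<open>The inequality of Cauchy and Schwarz separates the weighted transforms from the weights.\<close>

lemma weighted_conv_pointwise:
  "ennreal (W \<xi> * (cmod (conv y z \<xi>))\<^sup>2)
    \<le> ennreal (2 * 4 powr s * \<kappa>) * (\<integral>\<^sup>+\<eta>. ennreal ((cmod (rep_l2 y (\<xi> - \<eta>)))\<^sup>2 * (cmod (rep_l2 z \<eta>))\<^sup>2) \<partial>lborel)"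
proof -
  define a b where "a \<eta> = cmod (rep_l2 y (\<xi> - \<eta>)) * cmod (rep_l2 z \<eta>)"
    and "b \<eta> = 1 / (m (\<xi> - \<eta>) * m \<eta>)" for \<eta>
  have [measurable]: "a \<in> borel_measurable borel" "b \<in> borel_measurable borel"
    unfolding a_def[abs_def] b_def[abs_def] by measurable
  have ab0: "0 \<le> a \<eta>" "0 \<le> b \<eta>" for \<eta> using m_pos by (auto simp: a_def b_def less_imp_le)
  have a2: "(a \<eta>)\<^sup>2 = (cmod (rep_l2 y (\<xi> - \<eta>)))\<^sup>2 * (cmod (rep_l2 z \<eta>))\<^sup>2"
    and b2: "(b \<eta>)\<^sup>2 = 1 / (W (\<xi> - \<eta>) * W \<eta>)" for \<eta>
    by (simp_all add: a_def b_def power_mult_distrib power_divide m_sq)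
  have "integrable lborel (\<lambda>\<eta>. spec y (\<xi> - \<eta>) * spec z \<eta>)"
    by (intro L2_mult_integrable L2_convolution_arg L2_spec)
  from integral_norm_bound_ennreal[OF this]
  have "ennreal (cmod (conv y z \<xi>)) \<le> (\<integral>\<^sup>+\<eta>. ennreal (cmod (spec y (\<xi> - \<eta>) * spec z \<eta>)) \<partial>lborel)"
    by (simp add: conv_def)
  also have "\<dots> = (\<integral>\<^sup>+\<eta>. ennreal (a \<eta>) * ennreal (b \<eta>) \<partial>lborel)"
    using m_pos by (intro nn_integral_cong)
      (simp add: a_def b_def spec_def norm_mult norm_divide less_imp_le flip: ennreal_mult)
  finally have "(ennreal (cmod (conv y z \<xi>)))\<^sup>2 \<le> (\<integral>\<^sup>+\<eta>. ennreal (a \<eta>) * ennreal (b \<eta>) \<partial>lborel)\<^sup>2"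
    by (rule power_mono) simp
  also have "\<dots> \<le> (\<integral>\<^sup>+\<eta>. (ennreal (a \<eta>))\<^sup>2 \<partial>lborel) * (\<integral>\<^sup>+\<eta>. (ennreal (b \<eta>))\<^sup>2 \<partial>lborel)"
    by (rule Cauchy_Schwarz_nn_integral) auto
  finally have le: "ennreal ((cmod (conv y z \<xi>))\<^sup>2) \<le> (\<integral>\<^sup>+\<eta>. ennreal ((a \<eta>)\<^sup>2) \<partial>lborel) * (\<integral>\<^sup>+\<eta>. ennreal ((b \<eta>)\<^sup>2) \<partial>lborel)"
    by (simp add: ennreal_power ab0)
  have "ennreal (W \<xi>) * (\<integral>\<^sup>+\<eta>. ennreal ((b \<eta>)\<^sup>2) \<partial>lborel) = (\<integral>\<^sup>+\<eta>. ennreal (W \<xi> / (W (\<xi> - \<eta>) * W \<eta>)) \<partial>lborel)"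
    by (subst nn_integral_cmult[symmetric])
       (auto simp: b2 W_pos less_imp_le intro!: nn_integral_cong simp flip: ennreal_mult)
  also have "\<dots> \<le> ennreal (2 * 4 powr s * \<kappa>)" by (rule weighted_kernel_bound)
  finally have Wb: "ennreal (W \<xi>) * (\<integral>\<^sup>+\<eta>. ennreal ((b \<eta>)\<^sup>2) \<partial>lborel) \<le> ennreal (2 * 4 powr s * \<kappa>)" .
  have "ennreal (W \<xi> * (cmod (conv y z \<xi>))\<^sup>2) = ennreal (W \<xi>) * ennreal ((cmod (conv y z \<xi>))\<^sup>2)"
    by (simp add: ennreal_mult W_pos less_imp_le)
  also have "\<dots> \<le> ennreal (W \<xi>) * ((\<integral>\<^sup>+\<eta>. ennreal ((a \<eta>)\<^sup>2) \<partial>lborel) * (\<integral>\<^sup>+\<eta>. ennreal ((b \<eta>)\<^sup>2) \<partial>lborel))"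
    by (intro mult_left_mono le) simp
  also have "\<dots> = (ennreal (W \<xi>) * (\<integral>\<^sup>+\<eta>. ennreal ((b \<eta>)\<^sup>2) \<partial>lborel)) * (\<integral>\<^sup>+\<eta>. ennreal ((a \<eta>)\<^sup>2) \<partial>lborel)"
    by (simp add: ac_simps)
  also have "\<dots> \<le> ennreal (2 * 4 powr s * \<kappa>) * (\<integral>\<^sup>+\<eta>. ennreal ((a \<eta>)\<^sup>2) \<partial>lborel)"
    by (intro mult_right_mono Wb) simp
  finally show ?thesis by (simp add: a2)
qed

definition Cmul :: real where "Cmul = sqrt (2 * 4 powr s * \<kappa>)"

lemma Cmul_nonneg: "0 \<le> Cmul"
  by (simp add: Cmul_def \<kappa>_nonneg)

text \<open>Tonelli's theorem and translation invariance, after the pointwise estimate.\<close>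

lemma L2_weighted_conv:
  shows "L2 (\<lambda>\<xi>. of_real (m \<xi>) * conv y z \<xi>)"
    and "L2_norm (\<lambda>\<xi>. of_real (m \<xi>) * conv y z \<xi>) \<le> Cmul * norm y * norm z"
proof -
  define h where "h \<xi> = of_real (m \<xi>) * conv y z \<xi>" for \<xi>
  have [measurable]: "h \<in> borel_measurable borel" unfolding h_def[abs_def] by measurable
  have "(\<integral>\<^sup>+\<xi>. ennreal ((cmod (h \<xi>))\<^sup>2) \<partial>lborel) = (\<integral>\<^sup>+\<xi>. ennreal (W \<xi> * (cmod (conv y z \<xi>))\<^sup>2) \<partial>lborel)"
    by (simp add: h_def norm_mult power_mult_distrib m_sq)
  also have "\<dots> \<le> (\<integral>\<^sup>+\<xi>. ennreal (2 * 4 powr s * \<kappa>) *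
      (\<integral>\<^sup>+\<eta>. ennreal ((cmod (rep_l2 y (\<xi> - \<eta>)))\<^sup>2 * (cmod (rep_l2 z \<eta>))\<^sup>2) \<partial>lborel) \<partial>lborel)"
    by (intro nn_integral_mono weighted_conv_pointwise)
  also have "\<dots> = ennreal (2 * 4 powr s * \<kappa>) *
      (\<integral>\<^sup>+\<xi>. \<integral>\<^sup>+\<eta>. ennreal ((cmod (rep_l2 y (\<xi> - \<eta>)))\<^sup>2 * (cmod (rep_l2 z \<eta>))\<^sup>2) \<partial>lborel \<partial>lborel)"
    by (rule nn_integral_cmult) measurable
  also have "(\<integral>\<^sup>+\<xi>. \<integral>\<^sup>+\<eta>. ennreal ((cmod (rep_l2 y (\<xi> - \<eta>)))\<^sup>2 * (cmod (rep_l2 z \<eta>))\<^sup>2) \<partial>lborel \<partial>lborel)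
      = (\<integral>\<^sup>+\<eta>. \<integral>\<^sup>+\<xi>. ennreal ((cmod (rep_l2 y (\<xi> - \<eta>)))\<^sup>2 * (cmod (rep_l2 z \<eta>))\<^sup>2) \<partial>lborel \<partial>lborel)"
    by (rule lborel_pair.Fubini'[symmetric]) measurable
  also have "\<dots> = (\<integral>\<^sup>+\<eta>. ennreal ((norm y)\<^sup>2) * ennreal ((cmod (rep_l2 z \<eta>))\<^sup>2) \<partial>lborel)"
  proof (rule nn_integral_cong)
    fix \<eta>
    have "(\<integral>\<^sup>+\<xi>. ennreal ((cmod (rep_l2 y (\<xi> - \<eta>)))\<^sup>2) \<partial>lborel) = ennreal ((norm y)\<^sup>2)"
      using nn_integral_L2_norm[OF L2_translate[OF L2_rep_l2, of y "- \<eta>"]]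
        L2_norm_translate[of "rep_l2 y" "- \<eta>"] by (simp add: norm_rep_l2)
    then show "(\<integral>\<^sup>+\<xi>. ennreal ((cmod (rep_l2 y (\<xi> - \<eta>)))\<^sup>2 * (cmod (rep_l2 z \<eta>))\<^sup>2) \<partial>lborel)
        = ennreal ((norm y)\<^sup>2) * ennreal ((cmod (rep_l2 z \<eta>))\<^sup>2)"
      by (simp add: ennreal_mult nn_integral_multc)
  qed
  also have "\<dots> = ennreal ((norm y)\<^sup>2) * ennreal ((norm z)\<^sup>2)"
    by (simp add: nn_integral_cmult nn_integral_L2_norm norm_rep_l2)
  also have "ennreal (2 * 4 powr s * \<kappa>) * (ennreal ((norm y)\<^sup>2) * ennreal ((norm z)\<^sup>2)) = ennreal ((Cmul * norm y * norm z)\<^sup>2)"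
    by (simp add: Cmul_def \<kappa>_nonneg power_mult_distrib ac_simps flip: ennreal_mult)
  finally have le: "(\<integral>\<^sup>+\<xi>. ennreal ((cmod (h \<xi>))\<^sup>2) \<partial>lborel) \<le> ennreal ((Cmul * norm y * norm z)\<^sup>2)" .
  have L: "L2 h"
    by (rule L2I, measurable, rule integrableI_bounded) (use le in \<open>auto simp: order_le_less_trans\<close>)
  have "(L2_norm h)\<^sup>2 \<le> (Cmul * norm y * norm z)\<^sup>2"
    using le by (simp add: nn_integral_L2_norm[OF L])
  then have "L2_norm h \<le> Cmul * norm y * norm z"
    by (rule power2_le_imp_le) (simp add: Cmul_nonneg)
  with L show "L2 (\<lambda>\<xi>. of_real (m \<xi>) * conv y z \<xi>)"
    "L2_norm (\<lambda>\<xi>. of_real (m \<xi>) * conv y z \<xi>) \<le> Cmul * norm y * norm z"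
    by (simp_all add: h_def[abs_def])
qed

lemma integrable_conv: "integrable lborel (conv y z)"
  using L2_mult_integrable[OF L2_weighted_conv(1)[of y z] L2_inverse_m] by simp

lemma L2_conv: "L2 (conv y z)"
proof (rule L2_bound[OF _ L2_integrable[OF L2_weighted_conv(1)[of y z]]])
  show "(cmod (conv y z \<xi>))\<^sup>2 \<le> (cmod (of_real (m \<xi>) * conv y z \<xi>))\<^sup>2" for \<xi>
    using mult_right_mono[OF m_ge_1[of \<xi>], of "cmod (conv y z \<xi>)"] m_pos[of \<xi>]
    by (intro power_mono) (auto simp: norm_mult)
qed measurable

lemma D_mult_eq_inv_fourier: "D y x * D z x = inv_fourier (\<lambda>\<xi>. 1 / of_real (2 * pi) * conv y z \<xi>) x"
  unfolding D_def inv_fourier_def fourier_integral_cmult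
  unfolding conv_def[abs_def] fourier_integral_convolution[OF integrable_spec integrable_spec] by simp

lemma fourier_D_mult:
  "AE \<xi> in lborel. fourier (\<lambda>x. D y x * D z x) \<xi> = conv y z \<xi> / of_real (2 * pi)"
  unfolding D_mult_eq_inv_fourier
  using fourier_inv_fourier[of "\<lambda>\<xi>. 1 / of_real (2 * pi) * conv y z \<xi>"]
  by (simp add: integrable_conv L2_cmult[OF L2_conv, of "1 / of_real (2 * pi)", simplified])

lemma D_mult_Hs:
  shows "(\<lambda>x. D y x * D z x) \<in> Hs s" and "norm (E (\<lambda>x. D y x * D z x)) \<le> Cmul * norm y * norm z"
proof -
  let ?p = "\<lambda>x. D y x * D z x" and ?c = "\<lambda>\<xi>. 1 / of_real (2 * pi) * (of_real (m \<xi>) * conv y z \<xi>)"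
  have "L2 (inv_fourier (\<lambda>\<xi>. 1 / of_real (2 * pi) * conv y z \<xi>))"
    by (intro L2_inv_fourier integrable_mult_right integrable_conv L2_cmult L2_conv)
  then have L: "L2 ?p" by (simp add: D_mult_eq_inv_fourier)
  have c: "L2 ?c" by (intro L2_cmult L2_weighted_conv)
  have AE: "AE \<xi> in lborel. ?c \<xi> = of_real (m \<xi>) * fourier ?p \<xi>"
    using fourier_D_mult[of y z] by eventually_elim simp
  note Hs = Hs_if_transform[OF L c AE]
  show "?p \<in> Hs s" by (rule Hs(1))
  have "norm (E ?p) = L2_norm ?c" unfolding Hs(2) by (rule norm_abs_l2[OF c])
  also have "\<dots> = 1 / (2 * pi) * L2_norm (\<lambda>\<xi>. of_real (m \<xi>) * conv y z \<xi>)"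
    unfolding L2_norm_cmult by (simp add: norm_divide)
  also have "\<dots> \<le> 1 * L2_norm (\<lambda>\<xi>. of_real (m \<xi>) * conv y z \<xi>)"
    using pi_gt3 by (intro mult_right_mono L2_norm_nonneg) auto
  also have "\<dots> \<le> Cmul * norm y * norm z"
    using L2_weighted_conv(2)[of y z] by simp
  finally show "norm (E ?p) \<le> Cmul * norm y * norm z" .
qed

definition mul :: "l2 \<Rightarrow> l2 \<Rightarrow> l2" where "mul y z = E (\<lambda>x. D y x * D z x)"

lemma bounded_bilinear_mul: "bounded_bilinear mul"
proof
  fix a a' b b' :: l2 and r :: real
  show "mul (a + a') b = mul a b + mul a' b"
    unfolding mul_def by (simp add: D_add distrib_right Hs_add D_mult_Hs)
  show "mul a (b + b') = mul a b + mul a b'"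
    unfolding mul_def by (simp add: D_add distrib_left Hs_add D_mult_Hs)
  show "mul (r *\<^sub>R a) b = r *\<^sub>R mul a b"
    unfolding mul_def by (simp add: D_scaleR mult.assoc Hs_scaleR D_mult_Hs)
  show "mul a (r *\<^sub>R b) = r *\<^sub>R mul a b"
    unfolding mul_def by (simp add: D_scaleR mult.left_commute[of _ "of_real r"] Hs_scaleR D_mult_Hs)
  show "\<exists>K. \<forall>a b. norm (mul a b) \<le> norm a * norm b * K"
    unfolding mul_def using D_mult_Hs(2) by (intro exI[of _ Cmul]) (simp add: ac_simps)
qed

lemma Hs_mult:
  assumes f: "f \<in> Hs s" and g: "g \<in> Hs s"
  shows "(\<lambda>x. f x * g x) \<in> Hs s" "E (\<lambda>x. f x * g x) = mul (E f) (E g)"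
proof -
  have [measurable]: "f \<in> borel_measurable borel" "g \<in> borel_measurable borel"
    using f g Hs_L2 L2_borel by auto
  have AE: "AE x in lborel. D (E f) x * D (E g) x = f x * g x"
    using D_E[OF f] D_E[OF g] by eventually_elim simp
  note * = Hs_cong_AE[OF D_mult_Hs(1) AE]
  show "(\<lambda>x. f x * g x) \<in> Hs s" by (rule *(1)) measurable
  show "E (\<lambda>x. f x * g x) = mul (E f) (E g)" unfolding mul_def by (rule *(2)) measurable
qed

text \<open>As a Fourier integral it is defined at every frequency and depends continuously on all three
  arguments.\<close>

definition hat_mul :: "l2 \<Rightarrow> l2 \<Rightarrow> real \<Rightarrow> complex" where
  "hat_mul y z = fourier_integral (\<lambda>x. D y x * D z x)"

lemma integrable_D_mult: "integrable lborel (\<lambda>x. D y x * D z x)"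
  by (intro L2_mult_integrable L2_D)

lemma norm_hat_mul_le: "cmod (hat_mul y z \<xi>) \<le> norm y * norm z"
proof -
  have "cmod (hat_mul y z \<xi>) \<le> (LINT x|lborel. cmod (D y x * D z x))"
    unfolding hat_mul_def by (rule cmod_fourier_integral_le[OF integrable_D_mult])
  also have "\<dots> \<le> L2_norm (D y) * L2_norm (D z)"
    by (rule L2_Cauchy_Schwarz_norm[OF L2_D L2_D])
  also have "\<dots> \<le> norm y * norm z"
    by (intro mult_mono L2_norm_D_le L2_norm_nonneg) auto
  finally show ?thesis .
qed

lemma hat_mul_diff_left: "hat_mul (y - y') z \<xi> = hat_mul y z \<xi> - hat_mul y' z \<xi>"
proof -
  have "D y x = D (y - y') x + D y' x" for x
    using D_add[of "y - y'" y' x] by simp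
  then have "hat_mul y z \<xi> = fourier_integral (\<lambda>x. D (y - y') x * D z x + D y' x * D z x) \<xi>"
    by (simp add: hat_mul_def distrib_right)
  then show ?thesis by (simp add: fourier_integral_add integrable_D_mult hat_mul_def)
qed

lemma hat_mul_diff_right: "hat_mul y (z - z') \<xi> = hat_mul y z \<xi> - hat_mul y z' \<xi>"
  using hat_mul_diff_left[of z z' y] by (simp add: hat_mul_def mult.commute)

text \<open>Joint continuity makes the nonlinearity measurable in time and frequency together, as
  Fubini's theorem requires.\<close>

lemma continuous_hat_mul: "continuous_on UNIV (\<lambda>(y, z, \<xi>). hat_mul y z \<xi>)"
  unfolding continuous_on_def
proof (intro ballI)
  fix q :: "l2 \<times> l2 \<times> real"
  obtain y z \<xi> where q: "q = (y, z, \<xi>)" by (cases q)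
  let ?A = "nhds (y, z, \<xi>)"
  have t: "(fst \<longlongrightarrow> y) ?A" "((\<lambda>p. fst (snd p)) \<longlongrightarrow> z) ?A" "((\<lambda>p. snd (snd p)) \<longlongrightarrow> \<xi>) ?A"
    using tendsto_fst[OF filterlim_ident[of ?A]] tendsto_fst[OF tendsto_snd[OF filterlim_ident[of ?A]]]
      tendsto_snd[OF tendsto_snd[OF filterlim_ident[of ?A]]] by simp_all
  have c: "((\<lambda>p. hat_mul y z (snd (snd p))) \<longlongrightarrow> hat_mul y z \<xi>) ?A"
    using continuous_fourier_integral[OF integrable_D_mult, of y z] t(3)
    unfolding hat_mul_def by (rule continuous_on_tendsto_compose) auto
  have g: "((\<lambda>p. norm (fst p - y) * norm (fst (snd p)) + norm y * norm (fst (snd p) - z)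
      + norm (hat_mul y z (snd (snd p)) - hat_mul y z \<xi>)) \<longlongrightarrow> norm (y - y) * norm z + norm y * norm (z - z)
      + norm (hat_mul y z \<xi> - hat_mul y z \<xi>)) ?A"
    by (intro tendsto_intros t c)
  have "norm (hat_mul (fst p) (fst (snd p)) (snd (snd p)) - hat_mul y z \<xi>)
      \<le> norm (fst p - y) * norm (fst (snd p)) + norm y * norm (fst (snd p) - z)
      + norm (hat_mul y z (snd (snd p)) - hat_mul y z \<xi>)" for p
  proof -
    let ?y = "fst p" and ?z = "fst (snd p)" and ?x = "snd (snd p)"
    have "hat_mul ?y ?z ?x - hat_mul y z \<xi> = hat_mul (?y - y) ?z ?x + hat_mul y (?z - z) ?x + (hat_mul y z ?x - hat_mul y z \<xi>)"
      by (simp add: hat_mul_diff_left hat_mul_diff_right)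
    then show ?thesis
      using norm_triangle_le[OF add_mono[OF norm_triangle_le[OF add_mono[OF norm_hat_mul_le norm_hat_mul_le]] order_refl]]
      by metis
  qed
  then have "((\<lambda>p. hat_mul (fst p) (fst (snd p)) (snd (snd p)) - hat_mul y z \<xi>) \<longlongrightarrow> 0) ?A"
    by (intro Lim_null_comparison[OF _ g[simplified]]) (auto intro: always_eventually)
  then have "((\<lambda>p. hat_mul (fst p) (fst (snd p)) (snd (snd p))) \<longlongrightarrow> hat_mul y z \<xi>) ?A"
    by (rule LIM_zero_cancel)
  then show "((\<lambda>(y, z, \<xi>). hat_mul y z \<xi>) \<longlongrightarrow> (case q of (y, z, \<xi>) \<Rightarrow> hat_mul y z \<xi>)) (at q)"
    unfolding q split_beta using tendsto_mono[of "at (y, z, \<xi>)" ?A] by (simp add: at_within_def)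
qed

end

section \<open>Semilinear evolution equations in a Banach space\<close>

text \<open>The function $e^{-ct} \int_a^t d$ is nonincreasing and vanishes at \<open>a\<close>.\<close>

lemma gronwall_zero:
  fixes d :: "real \<Rightarrow> real"
  assumes cont: "continuous_on {a..b} d" and le: "\<And>t. t \<in> {a..b} \<Longrightarrow> d t \<le> c * integral {a..t} d"
    and c: "0 \<le> c" and t: "t \<in> {a..b}"
  shows "d t \<le> 0"
proof -
  define h where "h t = integral {a..t} d" for t
  \<comment> \<open>The assumption says that \<open>h\<close> satisfies the differential inequality \<open>h' \<le> c * h\<close>.\<close>
  define g where "g t = exp (- c * t) * h t" for t
  have hcont: "continuous_on {a..b} h"
    unfolding h_def by (rule indefinite_integral_continuous_1[OF integrable_continuous_real[OF cont]])
  have hder: "(h has_real_derivative d x) (at x)" if "a < x" "x < b" for x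
  proof -
    have "(h has_real_derivative d x) (at x within {a..b})"
      unfolding h_def using that by (intro integral_has_real_derivative cont) auto
    moreover have "at x within {a..b} = at x"
      using that by (intro at_within_interior) (auto simp: interior_atLeastAtMost_real)
    ultimately show ?thesis by simp
  qed
  have "g t \<le> g a"
  proof (rule DERIV_nonpos_imp_decreasing_open[of a t g])
    show "a \<le> t" using t by simp
    show "continuous_on {a..t} g"
      unfolding g_def using t by (intro continuous_intros continuous_on_subset[OF hcont]) auto
    fix x assume x: "a < x" "x < t"
    have "(g has_real_derivative (- c * exp (- c * x) * h x + exp (- c * x) * d x)) (at x)"
      unfolding g_def using x t by (auto intro!: derivative_eq_intros hder)
    moreover have "- c * exp (- c * x) * h x + exp (- c * x) * d x = exp (- c * x) * (d x - c * h x)"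
      by (simp add: algebra_simps)
    moreover have "exp (- c * x) * (d x - c * h x) \<le> 0"
      using le[of x] x t by (intro mult_nonneg_nonpos) (auto simp: h_def)
    ultimately show "\<exists>y. (g has_real_derivative y) (at x) \<and> y \<le> 0" by metis
  qed
  then have "h t \<le> 0" by (simp add: g_def h_def mult_le_0_iff)
  then have "c * h t \<le> 0" using c by (rule mult_nonneg_nonpos[rotated])
  with le[OF t] show ?thesis by (simp add: h_def)
qed

text \<open>\<open>\<beta> r\<close> bounds the norms of the group for times between \<open>- r\<close> and \<open>r\<close>, and \<open>\<gamma> r\<close> is a Lipschitz constant
  of the nonlinearity on the ball of radius \<open>r\<close>. By the last assumption the latter is arbitrarily small
  on small balls, so that the nonlinearity has vanishing derivative at the origin.\<close>

locale semilinear =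
  fixes V :: "real \<Rightarrow> 'a::banach \<Rightarrow> 'a" and K :: "'a \<Rightarrow> 'a" and \<beta> \<gamma> :: "real \<Rightarrow> real"
  assumes bounded_linear_V: "bounded_linear (V t)"
    and V_0: "V 0 x = x"
    and V_add: "V (p + q) x = V p (V q x)"
    and V_continuous: "continuous_on UNIV (\<lambda>t. V t x)"
    and V_bound: "\<bar>t\<bar> \<le> r \<Longrightarrow> norm (V t x) \<le> \<beta> r * norm x"
    and \<beta>_ge_1: "1 \<le> \<beta> r"
    and K_0: "K 0 = 0"
    and K_lipschitz: "norm x \<le> r \<Longrightarrow> norm y \<le> r \<Longrightarrow> norm (K x - K y) \<le> \<gamma> r * norm (x - y)"
    and \<gamma>_nonneg: "0 \<le> r \<Longrightarrow> 0 \<le> \<gamma> r"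
    and \<gamma>_small: "0 < c \<Longrightarrow> \<exists>r>0. \<gamma> r \<le> c"
begin

definition duhamel :: "real \<Rightarrow> real \<Rightarrow> (real \<Rightarrow> 'a) \<Rightarrow> 'a" where
  "duhamel a t u = integral {a..t} (\<lambda>\<sigma>. V (t - \<sigma>) (K (u \<sigma>)))"

definition mild :: "real \<Rightarrow> real \<Rightarrow> 'a \<Rightarrow> (real \<Rightarrow> 'a) \<Rightarrow> bool" where
  "mild a b u0 u \<longleftrightarrow> continuous_on {a..b} u \<and> (\<forall>t\<in>{a..b}. u t = V (t - a) u0 + duhamel a t u)"

text \<open>Strong continuity and local boundedness together give joint continuity.\<close>

lemma V_tendsto:
  assumes f: "(f \<longlongrightarrow> x) F" and \<tau>: "(\<tau> \<longlongrightarrow> t) F"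
  shows "((\<lambda>p. V (\<tau> p) (f p)) \<longlongrightarrow> V t x) F"
proof -
  have V: "((\<lambda>p. V (\<tau> p) x) \<longlongrightarrow> V t x) F"
    using V_continuous[of x] \<tau> by (rule continuous_on_tendsto_compose) auto
  have "\<forall>\<^sub>F p in F. \<bar>\<tau> p - t\<bar> < 1"
    using tendstoD[OF \<tau>, of 1] by (simp add: dist_real_def)
  then have "\<forall>\<^sub>F p in F. norm (V (\<tau> p) (f p) - V (\<tau> p) x) \<le> \<beta> (\<bar>t\<bar> + 1) * norm (f p - x)"
  proof eventually_elim
    fix p assume "\<bar>\<tau> p - t\<bar> < 1"
    then have "norm (V (\<tau> p) (f p - x)) \<le> \<beta> (\<bar>t\<bar> + 1) * norm (f p - x)"
      by (intro V_bound) linarith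
    then show "norm (V (\<tau> p) (f p) - V (\<tau> p) x) \<le> \<beta> (\<bar>t\<bar> + 1) * norm (f p - x)"
      by (simp add: bounded_linear.linear[OF bounded_linear_V] linear_diff)
  qed
  moreover have "((\<lambda>p. \<beta> (\<bar>t\<bar> + 1) * norm (f p - x)) \<longlongrightarrow> 0) F"
    by (intro tendsto_mult_right_zero tendsto_norm_zero LIM_zero f)
  ultimately have "((\<lambda>p. V (\<tau> p) (f p) - V (\<tau> p) x) \<longlongrightarrow> 0) F"
    by (rule Lim_null_comparison)
  from tendsto_add[OF this V] show ?thesis by simp
qed

lemma V_continuous_on:
  "continuous_on S f \<Longrightarrow> continuous_on S \<tau> \<Longrightarrow> continuous_on S (\<lambda>p. V (\<tau> p) (f p))"
  by (auto simp: continuous_on_def intro!: V_tendsto)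

text \<open>The nonlinearity is Lipschitz on the ball of radius \<open>norm x + 1\<close>, a neighbourhood of \<open>x\<close>.\<close>

lemma K_continuous: "continuous_on UNIV K"
proof (clarsimp simp: continuous_on_def)
  fix x :: 'a
  have "\<forall>\<^sub>F y in at x. norm (y - x) < 1"
    using tendstoD[OF tendsto_ident_at[of x UNIV], of 1] by (simp add: dist_norm)
  then have "\<forall>\<^sub>F y in at x. norm (K y - K x) \<le> \<gamma> (norm x + 1) * norm (y - x)"
  proof eventually_elim
    fix y assume "norm (y - x) < 1"
    then show "norm (K y - K x) \<le> \<gamma> (norm x + 1) * norm (y - x)"
      using norm_triangle_sub[of y x] by (intro K_lipschitz) auto
  qed
  moreover have "((\<lambda>y. \<gamma> (norm x + 1) * norm (y - x)) \<longlongrightarrow> 0) (at x)"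
    by (intro tendsto_mult_right_zero tendsto_norm_zero LIM_zero tendsto_ident_at)
  ultimately have "((\<lambda>y. K y - K x) \<longlongrightarrow> 0) (at x)"
    by (rule Lim_null_comparison)
  then show "(K \<longlongrightarrow> K x) (at x)" by (rule LIM_zero_cancel)
qed

lemma K_continuous_on: "continuous_on S u \<Longrightarrow> continuous_on S (\<lambda>t. K (u t))"
  by (rule continuous_on_compose2[OF K_continuous]) auto

lemma integrand_continuous:
  "continuous_on S u \<Longrightarrow> continuous_on S (\<lambda>\<sigma>. V (t - \<sigma>) (K (u \<sigma>)))"
  by (intro V_continuous_on K_continuous_on continuous_intros)

lemma V_integral:
  fixes f :: "real \<Rightarrow> 'a"
  assumes "continuous_on {a..b} f"
  shows "V t (integral {a..b} f) = integral {a..b} (\<lambda>\<sigma>. V t (f \<sigma>))"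
  using integral_linear[OF integrable_continuous_real[OF assms] bounded_linear_V[of t]]
  by (simp add: o_def)

text \<open>By the group law the free evolution up to the present factors out of the integral.\<close>

lemma V_duhamel:
  assumes "continuous_on {a..t} u"
  shows "V r (duhamel a t u) = integral {a..t} (\<lambda>\<sigma>. V (r + t - \<sigma>) (K (u \<sigma>)))"
  unfolding duhamel_def using V_integral[OF integrand_continuous[OF assms, of t], of r]
  by (simp add: add_diff_eq flip: V_add)

text \<open>The free evolution \<open>V t\<close> is taken out of the integral, whose integrand then does not depend on
  the upper limit \<open>t\<close>.\<close>

lemma duhamel_continuous:
  assumes u: "continuous_on {a..b} u"
  shows "continuous_on {a..b} (\<lambda>t. duhamel a t u)"
proof -
  have "continuous_on {a..b} (\<lambda>t. V t (integral {a..t} (\<lambda>\<sigma>. V (0 - \<sigma>) (K (u \<sigma>)))))"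
    by (intro V_continuous_on continuous_on_id indefinite_integral_continuous_1
        integrable_continuous_real integrand_continuous u)
  moreover have "V t (integral {a..t} (\<lambda>\<sigma>. V (0 - \<sigma>) (K (u \<sigma>)))) = duhamel a t u" if "t \<in> {a..b}" for t
  proof -
    have "continuous_on {a..t} u" using u that by (auto intro: continuous_on_subset)
    from V_integral[OF integrand_continuous[OF this, of 0], of t] show ?thesis
      by (simp add: duhamel_def flip: V_add)
  qed
  ultimately show ?thesis by (simp cong: continuous_on_cong_simp)
qed

lemma duhamel_diff_le:
  assumes u: "continuous_on {a..t} u" and v: "continuous_on {a..t} v" and at: "a \<le> t" "t - a \<le> r"
    and bound: "\<And>\<sigma>. \<sigma> \<in> {a..t} \<Longrightarrow> norm (u \<sigma>) \<le> M \<and> norm (v \<sigma>) \<le> M"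
  shows "norm (duhamel a t u - duhamel a t v) \<le> \<beta> r * \<gamma> M * integral {a..t} (\<lambda>\<sigma>. norm (u \<sigma> - v \<sigma>))"
proof -
  have "duhamel a t u - duhamel a t v = integral {a..t} (\<lambda>\<sigma>. V (t - \<sigma>) (K (u \<sigma>)) - V (t - \<sigma>) (K (v \<sigma>)))"
    unfolding duhamel_def
    by (intro Henstock_Kurzweil_Integration.integral_diff[symmetric] integrable_continuous_real integrand_continuous u v)
  also have "norm \<dots> \<le> integral {a..t} (\<lambda>\<sigma>. \<beta> r * \<gamma> M * norm (u \<sigma> - v \<sigma>))"
  proof (rule integral_norm_bound_integral)
    show "(\<lambda>\<sigma>. V (t - \<sigma>) (K (u \<sigma>)) - V (t - \<sigma>) (K (v \<sigma>))) integrable_on {a..t}"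
      by (intro integrable_continuous_real continuous_on_diff integrand_continuous u v)
    show "(\<lambda>\<sigma>. \<beta> r * \<gamma> M * norm (u \<sigma> - v \<sigma>)) integrable_on {a..t}"
      by (intro integrable_continuous_real continuous_intros u v)
    fix \<sigma> assume \<sigma>: "\<sigma> \<in> {a..t}"
    have "norm (V (t - \<sigma>) (K (u \<sigma>)) - V (t - \<sigma>) (K (v \<sigma>))) = norm (V (t - \<sigma>) (K (u \<sigma>) - K (v \<sigma>)))"
      by (simp add: bounded_linear.linear[OF bounded_linear_V] linear_diff)
    also have "\<dots> \<le> \<beta> r * norm (K (u \<sigma>) - K (v \<sigma>))"
      using \<sigma> at by (intro V_bound) auto
    also have "\<dots> \<le> \<beta> r * (\<gamma> M * norm (u \<sigma> - v \<sigma>))"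
      using \<beta>_ge_1[of r] bound[OF \<sigma>] by (intro mult_left_mono K_lipschitz) auto
    finally show "norm (V (t - \<sigma>) (K (u \<sigma>)) - V (t - \<sigma>) (K (v \<sigma>))) \<le> \<beta> r * \<gamma> M * norm (u \<sigma> - v \<sigma>)"
      by (simp add: mult.assoc)
  qed
  finally show ?thesis by simp
qed

text \<open>Two solutions are continuous on a compact interval, hence take values in a common ball, on
  which the nonlinearity is Lipschitz.\<close>

lemma mild_unique:
  assumes u: "mild a b u0 u" and v: "mild a b u0 v" and t: "t \<in> {a..b}"
  shows "u t = v t"
proof -
  have cont: "continuous_on {a..b} u" "continuous_on {a..b} v" using u v by (auto simp: mild_def)
  then have "bounded (u ` {a..b})" "bounded (v ` {a..b})"
    by (auto intro!: compact_imp_bounded compact_continuous_image)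
  then obtain M1 M2 where "\<forall>x\<in>u ` {a..b}. norm x \<le> M1" "\<forall>x\<in>v ` {a..b}. norm x \<le> M2"
    unfolding bounded_iff by blast
  then have M: "\<And>\<sigma>. \<sigma> \<in> {a..b} \<Longrightarrow> norm (u \<sigma>) \<le> max 0 (max M1 M2) \<and> norm (v \<sigma>) \<le> max 0 (max M1 M2)"
    by (auto simp: le_max_iff_disj)
  let ?M = "max 0 (max M1 M2)"
  have "norm (u t - v t) \<le> 0"
  proof (rule gronwall_zero[where d = "\<lambda>t. norm (u t - v t)" and c = "\<beta> (b - a) * \<gamma> ?M"])
    show "continuous_on {a..b} (\<lambda>t. norm (u t - v t))" by (intro continuous_intros cont)
    show "0 \<le> \<beta> (b - a) * \<gamma> ?M" using \<beta>_ge_1[of "b - a"] by (intro mult_nonneg_nonneg \<gamma>_nonneg) auto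
    fix t assume t: "t \<in> {a..b}"
    have "u t - v t = duhamel a t u - duhamel a t v" using u v t by (simp add: mild_def)
    also have "norm \<dots> \<le> \<beta> (b - a) * \<gamma> ?M * integral {a..t} (\<lambda>\<sigma>. norm (u \<sigma> - v \<sigma>))"
      using t M by (intro duhamel_diff_le continuous_on_subset[OF cont(1)] continuous_on_subset[OF cont(2)]) auto
    finally show "norm (u t - v t) \<le> \<beta> (b - a) * \<gamma> ?M * integral {a..t} (\<lambda>\<sigma>. norm (u \<sigma> - v \<sigma>))" .
  qed (rule t)
  then show ?thesis by simp
qed

text \<open>The contraction principle in the ball of radius \<open>M\<close>: the free evolution uses half of the radius
  and the Duhamel term the other half. Curves are defined on the whole line, and times are projected to
  the interval, so that the space of bounded continuous functions can serve as the space of curves.\<close>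

lemma mild_exists:
  assumes ab: "a \<le> b" "b - a \<le> r" and M: "0 \<le> M" and u0: "\<beta> r * norm u0 \<le> M / 2"
    and small: "(b - a) * (\<beta> r * \<gamma> M) \<le> 1 / 2"
  shows "\<exists>u. mild a b u0 u"
proof -
  define p where "p t = max a (min b t)" for t :: real
  have p: "p t \<in> {a..b}" for t using ab by (auto simp: p_def)
  have p_id: "p t = t" if "t \<in> {a..b}" for t using that by (auto simp: p_def)
  have p_cont: "continuous_on UNIV p" unfolding p_def by (intro continuous_intros)
  define \<Psi> where "\<Psi> u t = V (t - a) u0 + duhamel a t u" for u t
  have \<Psi>_cont: "continuous_on {a..b} (\<Psi> u)" if "continuous_on UNIV u" for u
    unfolding \<Psi>_def using that
    by (intro continuous_on_add V_continuous_on duhamel_continuous continuous_intros) (auto intro: continuous_on_subset)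
  define \<Phi> :: "(real \<Rightarrow>\<^sub>C 'a) \<Rightarrow> (real \<Rightarrow>\<^sub>C 'a)" where "\<Phi> f = Bcontfun (\<lambda>t. \<Psi> f (p t))" for f
  have \<Phi>: "apply_bcontfun (\<Phi> f) t = \<Psi> f (p t)" for f t
  proof -
    have "continuous_on {a..b} (\<Psi> f)" by (rule \<Psi>_cont) simp
    then have "continuous_on UNIV (\<lambda>t. \<Psi> f (p t))" "bounded (\<Psi> f ` {a..b})"
      using p by (auto intro!: continuous_on_compose2[OF _ p_cont] compact_imp_bounded compact_continuous_image)
    moreover have "range (\<lambda>t. \<Psi> f (p t)) \<subseteq> \<Psi> f ` {a..b}" using p by auto
    ultimately have "(\<lambda>t. \<Psi> f (p t)) \<in> bcontfun"
      by (auto simp: bcontfun_def intro: bounded_subset)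
    then show ?thesis by (simp add: \<Phi>_def Bcontfun_inverse)
  qed
  have ball: "norm f \<le> M \<longleftrightarrow> (\<forall>t. norm (apply_bcontfun f t) \<le> M)" for f :: "real \<Rightarrow>\<^sub>C 'a"
    using norm_bounded[of f] by (auto intro: norm_bound order_trans)
  have diff: "norm (\<Psi> f t - \<Psi> g t) \<le> 1 / 2 * dist f g"
    if "norm f \<le> M" "norm g \<le> M" "t \<in> {a..b}" for f g :: "real \<Rightarrow>\<^sub>C 'a" and t
  proof -
    have "norm (\<Psi> f t - \<Psi> g t) = norm (duhamel a t f - duhamel a t g)" by (simp add: \<Psi>_def)
    also have "\<dots> \<le> \<beta> r * \<gamma> M * integral {a..t} (\<lambda>\<sigma>. norm (apply_bcontfun f \<sigma> - apply_bcontfun g \<sigma>))"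
      using that ab ball by (intro duhamel_diff_le) auto
    also have "integral {a..t} (\<lambda>\<sigma>. norm (apply_bcontfun f \<sigma> - apply_bcontfun g \<sigma>)) \<le> integral {a..t} (\<lambda>\<sigma>. dist f g)"
      by (intro integral_le integrable_continuous_real continuous_intros) (auto simp: dist_bounded simp flip: dist_norm)
    also have "\<dots> \<le> (b - a) * dist f g" using that by (auto intro!: mult_right_mono)
    also have "\<beta> r * \<gamma> M * ((b - a) * dist f g) = (b - a) * (\<beta> r * \<gamma> M) * dist f g" by simp
    also have "\<dots> \<le> 1 / 2 * dist f g" by (intro mult_right_mono small) auto
    finally show ?thesis using \<beta>_ge_1[of r] \<gamma>_nonneg[OF M] by (simp add: mult_left_mono)
  qed
  have zero: "norm (\<Psi> (0 :: real \<Rightarrow>\<^sub>C 'a) t) \<le> M / 2" if "t \<in> {a..b}" for t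
  proof -
    have "duhamel a t (0 :: real \<Rightarrow>\<^sub>C 'a) = 0"
      by (simp add: duhamel_def K_0 linear_0 bounded_linear.linear[OF bounded_linear_V])
    then have "norm (\<Psi> (0 :: real \<Rightarrow>\<^sub>C 'a) t) \<le> \<beta> r * norm u0"
      using that ab by (auto simp: \<Psi>_def intro!: V_bound)
    then show ?thesis using u0 by simp
  qed
  have "\<exists>!f\<in>cball 0 M. \<Phi> f = f"
  proof (rule Banach_fix[where c = "1 / 2"])
    show "Topological_Spaces.complete (cball (0 :: real \<Rightarrow>\<^sub>C 'a) M)" by (simp add: complete_eq_closed)
    show "cball (0 :: real \<Rightarrow>\<^sub>C 'a) M \<noteq> {}" using M by simp
    show "\<Phi> ` cball 0 M \<subseteq> cball 0 M"
    proof (clarsimp simp only: mem_cball_0 ball image_subset_iff)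
      fix f :: "real \<Rightarrow>\<^sub>C 'a" and t assume f: "\<forall>t. norm (apply_bcontfun f t) \<le> M"
      have "norm (\<Psi> f (p t)) \<le> norm (\<Psi> (0 :: real \<Rightarrow>\<^sub>C 'a) (p t)) + norm (\<Psi> f (p t) - \<Psi> (0 :: real \<Rightarrow>\<^sub>C 'a) (p t))"
        by (rule norm_triangle_sub)
      also have "\<dots> \<le> M / 2 + 1 / 2 * dist f 0"
        using f M p by (intro add_mono zero diff) (auto simp: ball)
      also have "dist f 0 \<le> M" using f ball[of f] by (simp add: dist_commute)
      finally show "norm (apply_bcontfun (\<Phi> f) t) \<le> M" by (simp add: \<Phi>)
    qed
    show "dist (\<Phi> f) (\<Phi> g) \<le> 1 / 2 * dist f g" if "f \<in> cball 0 M" "g \<in> cball 0 M" for f g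
    proof (rule dist_bound)
      fix t
      show "dist (apply_bcontfun (\<Phi> f) t) (apply_bcontfun (\<Phi> g) t) \<le> 1 / 2 * dist f g"
        using diff[of f g "p t"] that p by (simp add: \<Phi> dist_norm[of "\<Psi> _ _"])
    qed
  qed auto
  then obtain f where f: "\<Phi> f = f" by auto
  have "mild a b u0 (apply_bcontfun f)"
    unfolding mild_def
  proof (intro conjI ballI)
    fix t assume t: "t \<in> {a..b}"
    show "apply_bcontfun f t = V (t - a) u0 + duhamel a t f"
      using \<Phi>[of f t] by (simp add: f p_id[OF t] \<Psi>_def)
  qed simp
  then show ?thesis by blast
qed

lemma mild_subinterval: "mild a b u0 u \<Longrightarrow> c \<le> b \<Longrightarrow> mild a c u0 u"
  by (auto simp: mild_def intro: continuous_on_subset)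

lemma mild_initial: "mild a b u0 u \<Longrightarrow> a \<le> b \<Longrightarrow> u a = u0"
  by (auto simp: mild_def duhamel_def V_0)

lemma duhamel_cong: "(\<And>\<sigma>. \<sigma> \<in> {a..t} \<Longrightarrow> u \<sigma> = v \<sigma>) \<Longrightarrow> duhamel a t u = duhamel a t v"
  unfolding duhamel_def by (intro Henstock_Kurzweil_Integration.integral_cong) auto

lemma mild_cong: "(\<And>t. t \<in> {a..b} \<Longrightarrow> u t = v t) \<Longrightarrow> mild a b u0 u \<longleftrightarrow> mild a b u0 v"
  unfolding mild_def
  by (intro conj_cong continuous_on_cong ball_cong refl arg_cong2[where f = "(=)"] arg_cong2[where f = "(+)"] duhamel_cong) auto

text \<open>At the time \<open>c\<close> of gluing the first solution is substituted for its own Duhamel formula, which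
  the group law then carries forward from \<open>c\<close> to \<open>t\<close>.\<close>

lemma mild_glue:
  assumes u: "mild a c u0 u" and v: "mild c b (u c) v" and ac: "a \<le> c" "c \<le> b"
  shows "mild a b u0 (\<lambda>t. if t \<le> c then u t else v t)"
proof -
  let ?w = "\<lambda>t. if t \<le> c then u t else v t"
  have cu: "continuous_on {a..c} u" and cv: "continuous_on {c..b} v" using u v by (auto simp: mild_def)
  have vc: "v c = u c" using mild_initial[OF v] ac by simp
  have cw: "continuous_on {a..b} ?w"
  proof -
    have "continuous_on ({a..c} \<union> {c..b}) ?w"
      by (rule continuous_on_cases) (use cu cv vc in auto)
    moreover have "{a..c} \<union> {c..b} = {a..b}" using ac by auto
    ultimately show ?thesis by simp
  qed
  show ?thesis
    unfolding mild_def
  proof (intro conjI ballI cw)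
    fix t assume t: "t \<in> {a..b}"
    show "?w t = V (t - a) u0 + duhamel a t ?w"
    proof (cases "t \<le> c")
      case True
      then have "duhamel a t ?w = duhamel a t u" by (intro duhamel_cong) auto
      then show ?thesis using True t u by (simp add: mild_def)
    next
      case False
      have w_u: "?w \<sigma> = u \<sigma>" if "\<sigma> \<in> {a..c}" for \<sigma> using that by simp
      have w_v: "?w \<sigma> = v \<sigma>" if "\<sigma> \<in> {c..t}" for \<sigma> using that vc by (cases "\<sigma> = c") auto
      have "u c = V (c - a) u0 + duhamel a c u" using u ac by (simp add: mild_def)
      then have "V (t - c) (u c) = V (t - a) u0 + V (t - c) (duhamel a c u)"
        using V_add[of "t - c" "c - a" u0] by (simp add: bounded_linear.linear[OF bounded_linear_V] linear_add)
      also have "V (t - c) (duhamel a c u) = integral {a..c} (\<lambda>\<sigma>. V (t - \<sigma>) (K (u \<sigma>)))"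
        using V_duhamel[OF cu, of "t - c"] by simp
      also have "\<dots> = integral {a..c} (\<lambda>\<sigma>. V (t - \<sigma>) (K (?w \<sigma>)))"
        by (intro Henstock_Kurzweil_Integration.integral_cong) (simp add: w_u)
      finally have 1: "V (t - c) (u c) = V (t - a) u0 + integral {a..c} (\<lambda>\<sigma>. V (t - \<sigma>) (K (?w \<sigma>)))" .
      have 2: "duhamel c t v = integral {c..t} (\<lambda>\<sigma>. V (t - \<sigma>) (K (?w \<sigma>)))"
        unfolding duhamel_def using w_v by (intro Henstock_Kurzweil_Integration.integral_cong) metis
      have "?w t = V (t - c) (u c) + duhamel c t v" using v False t by (simp add: mild_def)
      also have "\<dots> = V (t - a) u0 + (integral {a..c} (\<lambda>\<sigma>. V (t - \<sigma>) (K (?w \<sigma>))) + integral {c..t} (\<lambda>\<sigma>. V (t - \<sigma>) (K (?w \<sigma>))))"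
        by (simp add: 1 2 add.assoc)
      also have "integral {a..c} (\<lambda>\<sigma>. V (t - \<sigma>) (K (?w \<sigma>))) + integral {c..t} (\<lambda>\<sigma>. V (t - \<sigma>) (K (?w \<sigma>))) = duhamel a t ?w"
        unfolding duhamel_def using False t ac
        by (intro Henstock_Kurzweil_Integration.integral_combine integrable_continuous_real integrand_continuous
            continuous_on_subset[OF cw]) auto
      finally show ?thesis .
    qed
  qed
qed

text \<open>The radius is chosen so small that the Lipschitz constant compensates the length of the
  interval.\<close>

theorem small_data_existence:
  assumes "0 < T"
  shows "\<exists>\<delta>>0. \<forall>u0. norm u0 < \<delta> \<longrightarrow> (\<exists>u. mild 0 T u0 u)"
proof -
  have b: "1 \<le> \<beta> T" by (rule \<beta>_ge_1)
  obtain M where M: "0 < M" "\<gamma> M \<le> 1 / (2 * T * \<beta> T)"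
    using \<gamma>_small[of "1 / (2 * T * \<beta> T)"] assms b by auto
  show ?thesis
  proof (intro exI[of _ "M / (2 * \<beta> T)"] conjI allI impI)
    show "0 < M / (2 * \<beta> T)" using M b by simp
    fix u0 :: 'a assume "norm u0 < M / (2 * \<beta> T)"
    then have "\<beta> T * norm u0 \<le> M / 2" using b by (simp add: field_simps)
    moreover have "(T - 0) * (\<beta> T * \<gamma> M) \<le> 1 / 2"
      using M(2) assms b by (simp add: field_simps)
    ultimately show "\<exists>u. mild 0 T u0 u"
      using assms M(1) by (intro mild_exists[where r = T and M = M]) auto
  qed
qed

text \<open>The length of the interval depends on the size of the datum only.\<close>

theorem local_existence:
  obtains \<tau> where "0 < \<tau>" "\<And>u0 a b. norm u0 \<le> R \<Longrightarrow> a \<le> b \<Longrightarrow> b - a \<le> \<tau> \<Longrightarrow> \<exists>u. mild a b u0 u"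
proof -
  have b: "1 \<le> \<beta> 1" by (rule \<beta>_ge_1)
  \<comment> \<open>Twice the bound for the free evolution up to time one.\<close>
  define M where "M = 2 * \<beta> 1 * \<bar>R\<bar>"
  have M: "0 \<le> M" using b by (simp add: M_def)
  define \<tau> where "\<tau> = 1 / (2 * (\<beta> 1 * \<gamma> M) + 1)"
  have L: "0 \<le> \<beta> 1 * \<gamma> M" using b \<gamma>_nonneg[OF M] by simp
  have \<tau>: "0 < \<tau>" "\<tau> \<le> 1" "\<tau> * (\<beta> 1 * \<gamma> M) \<le> 1 / 2" using L by (simp_all add: \<tau>_def field_simps add_pos_nonneg)
  show ?thesis
  proof (rule that[OF \<tau>(1)])
    fix u0 :: 'a and a c :: real assume *: "norm u0 \<le> R" "a \<le> c" "c - a \<le> \<tau>"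
    have "(c - a) * (\<beta> 1 * \<gamma> M) \<le> \<tau> * (\<beta> 1 * \<gamma> M)" by (intro mult_right_mono * L)
    moreover have "\<beta> 1 * norm u0 \<le> M / 2" using b * by (simp add: M_def mult_left_mono)
    ultimately show "\<exists>u. mild a c u0 u"
      using * \<tau> M by (intro mild_exists[where r = 1 and M = M]) auto
  qed
qed

text \<open>Otherwise the solution could be restarted at a time closer to the end than the guaranteed time
  of existence for data of norm at most \<open>Z\<close>.\<close>

theorem blow_up_alternative:
  assumes Ts: "0 < Ts" and u: "\<And>T. 0 < T \<Longrightarrow> T < Ts \<Longrightarrow> mild 0 T u0 u"
    and maximal: "\<And>T v. Ts < T \<Longrightarrow> \<not> mild 0 T u0 v"
  shows "filterlim (\<lambda>t. norm (u t)) at_top (at_left Ts)"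
  unfolding filterlim_at_top
proof
  fix Z
  obtain \<tau> where \<tau>: "0 < \<tau>" "\<And>u0 a b. norm u0 \<le> Z \<Longrightarrow> a \<le> b \<Longrightarrow> b - a \<le> \<tau> \<Longrightarrow> \<exists>u. mild a b u0 u"
    using local_existence[of Z] by blast
  have "Z \<le> norm (u t)" if t: "max 0 (Ts - \<tau>) < t" "t < Ts" for t
  proof (rule ccontr)
    assume "\<not> Z \<le> norm (u t)"
    then obtain v where "mild t (t + \<tau>) (u t) v"
      using \<tau>(2)[of "u t" t "t + \<tau>"] \<tau>(1) by auto
    moreover have "mild 0 t u0 u" using u t by auto
    ultimately have "mild 0 (t + \<tau>) u0 (\<lambda>\<sigma>. if \<sigma> \<le> t then u \<sigma> else v \<sigma>)"
      using t \<tau>(1) by (intro mild_glue) auto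
    then show False using maximal[of "t + \<tau>"] t by auto
  qed
  then show "\<forall>\<^sub>F t in at_left Ts. Z \<le> norm (u t)"
    unfolding eventually_at_left_field using Ts \<tau>(1) by (intro exI[of _ "max 0 (Ts - \<tau>)"]) auto
qed

end

section \<open>The linear group\<close>

text \<open>The sign of $\<xi>^2 (2-\<xi>^2)$ decides between exponential growth and oscillation, and the
  multipliers are entire functions of this quantity. In all three cases they satisfy the same addition
  theorems.\<close>

lemma multiplier_cases:
  obtains (flat) "\<xi>\<^sup>2 * (2 - \<xi>\<^sup>2) = 0" "\<And>t. C_mult t \<xi> = 1" "\<And>t. S_mult t \<xi> = t"
  | (hyperbolic) l where "0 < l" "l \<le> 1" "\<xi>\<^sup>2 * (2 - \<xi>\<^sup>2) = l\<^sup>2"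
      "\<And>t. C_mult t \<xi> = cosh (l * t)" "\<And>t. S_mult t \<xi> = sinh (l * t) / l"
  | (oscillating) l where "0 < l" "\<xi>\<^sup>2 * (2 - \<xi>\<^sup>2) = - l\<^sup>2"
      "\<And>t. C_mult t \<xi> = cos (l * t)" "\<And>t. S_mult t \<xi> = sin (l * t) / l"
proof -
  have sq: "\<bar>\<xi>\<bar> \<le> sqrt 2 \<longleftrightarrow> \<xi>\<^sup>2 \<le> 2" "\<bar>\<xi>\<bar> = sqrt 2 \<longleftrightarrow> \<xi>\<^sup>2 = 2"
    using abs_le_square_iff[of \<xi> "sqrt 2"] by (simp, metis real_sqrt_abs real_sqrt_eq_iff)
  show thesis
  proof (cases "\<xi> = 0 \<or> \<bar>\<xi>\<bar> = sqrt 2")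
    case True
    then show thesis using flat sq by (auto simp: C_mult_def S_mult_def)
  next
    case False
    then have \<xi>: "\<xi> \<noteq> 0" "\<xi>\<^sup>2 \<noteq> 2" using sq by auto
    show thesis
    proof (cases "\<bar>\<xi>\<bar> \<le> sqrt 2")
      case True
      define l where "l = \<bar>\<xi>\<bar> * sqrt (2 - \<xi>\<^sup>2)"
      have "\<xi>\<^sup>2 < 2" using True sq \<xi> by auto
      then have l: "0 < l" "l\<^sup>2 = \<xi>\<^sup>2 * (2 - \<xi>\<^sup>2)" using \<xi> by (auto simp: l_def power_mult_distrib)
      have "l\<^sup>2 \<le> 1\<^sup>2"
        using zero_le_power2[of "1 - \<xi>\<^sup>2"] by (simp add: l(2) power2_diff algebra_simps flip: power2_eq_square)
      then have "l \<le> 1" by (rule power2_le_imp_le) simp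
      then show thesis
        using False True l by (intro hyperbolic[of l]) (auto simp: C_mult_def S_mult_def l_def)
    next
      case gt: False
      define l where "l = \<bar>\<xi>\<bar> * sqrt (\<xi>\<^sup>2 - 2)"
      have "2 < \<xi>\<^sup>2" using gt sq by auto
      then have l: "0 < l" "l\<^sup>2 = \<xi>\<^sup>2 * (\<xi>\<^sup>2 - 2)" using \<xi> by (auto simp: l_def power_mult_distrib)
      then show thesis
        using False gt by (intro oscillating[of l]) (auto simp: C_mult_def S_mult_def l_def algebra_simps)
    qed
  qed
qed

lemma mult_even [simp]: "C_mult t (- \<xi>) = C_mult t \<xi>" "S_mult t (- \<xi>) = S_mult t \<xi>"
  by (simp_all add: C_mult_def S_mult_def)

lemma mult_0 [simp]: "C_mult 0 \<xi> = 1" "S_mult 0 \<xi> = 0"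
  by (cases rule: multiplier_cases[of \<xi>]; simp)+

lemma mult_uminus: "C_mult (- t) \<xi> = C_mult t \<xi>" "S_mult (- t) \<xi> = - S_mult t \<xi>"
  by (cases rule: multiplier_cases[of \<xi>]; simp)+

lemma C_mult_add: "C_mult (p + q) \<xi> = C_mult p \<xi> * C_mult q \<xi> + \<xi>\<^sup>2 * (2 - \<xi>\<^sup>2) * (S_mult p \<xi> * S_mult q \<xi>)"
  by (cases rule: multiplier_cases[of \<xi>])
     (simp_all add: distrib_left cosh_add cos_add power2_eq_square)

lemma S_mult_add: "S_mult (p + q) \<xi> = S_mult p \<xi> * C_mult q \<xi> + C_mult p \<xi> * S_mult q \<xi>"
  by (cases rule: multiplier_cases[of \<xi>])
     (simp_all add: distrib_left sinh_add sin_add add_divide_distrib)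

lemma sinh_le_cosh_mult: "0 \<le> (x::real) \<Longrightarrow> sinh x \<le> x * cosh x"
proof -
  assume x: "0 \<le> x"
  have "0 * cosh 0 - sinh (0::real) \<le> x * cosh x - sinh x"
  proof (rule DERIV_nonneg_imp_nondecreasing[OF x])
    fix y :: real assume y: "0 \<le> y" "y \<le> x"
    have "((\<lambda>y. y * cosh y - sinh y) has_real_derivative y * sinh y) (at y)"
      by (auto intro!: derivative_eq_intros)
    then show "\<exists>z. ((\<lambda>y. y * cosh y - sinh y) has_real_derivative z) (at y) \<and> 0 \<le> z"
      using y by (intro exI[of _ "y * sinh y"]) auto
  qed
  then show ?thesis by simp
qed

text \<open>A bound uniform in the frequency: the slope of the hyperbolic sine on the relevant range is at
  most \<open>cosh r\<close>, as $|\<xi>| \sqrt{2-\<xi>^2} \le 1$, and that of the sine is at most one.\<close>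

lemma abs_S_mult_le: assumes "\<bar>t\<bar> \<le> r" shows "\<bar>S_mult t \<xi>\<bar> \<le> r * cosh r"
proof -
  have c1: "1 \<le> cosh x" for x :: real by (rule cosh_real_ge_1)
  have r: "0 \<le> r" using assms by linarith
  have le: "\<bar>t\<bar> \<le> r * cosh r"
    using mult_mono[OF assms c1[of r]] r by simp
  show ?thesis
  proof (cases rule: multiplier_cases[of \<xi>])
    case flat
    then show ?thesis using le by simp
  next
    case (hyperbolic l)
    have "\<bar>sinh (l * t)\<bar> = sinh (l * \<bar>t\<bar>)"
      using hyperbolic(1) sinh_real_abs[of "l * t"] by (simp add: abs_mult del: sinh_real_abs)
    also have "\<dots> \<le> l * \<bar>t\<bar> * cosh (l * \<bar>t\<bar>)" using hyperbolic(1) by (intro sinh_le_cosh_mult) auto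
    also have "\<dots> \<le> l * r * cosh r"
    proof (intro mult_mono)
      have "l * \<bar>t\<bar> \<le> 1 * r" using hyperbolic assms by (intro mult_mono) auto
      then show "cosh (l * \<bar>t\<bar>) \<le> cosh r" using hyperbolic(1) r by (subst cosh_real_nonneg_le_iff) auto
    qed (use hyperbolic assms r in auto)
    finally show ?thesis using hyperbolic(1) by (simp add: hyperbolic(5) field_simps abs_mult)
  next
    case (oscillating l)
    have "\<bar>sin (l * t)\<bar> \<le> \<bar>l * t\<bar>" by (rule abs_sin_x_le_abs_x)
    then have "\<bar>sin (l * t) / l\<bar> \<le> \<bar>t\<bar>" using oscillating(1) by (simp add: abs_mult field_simps)
    then show ?thesis using le by (simp add: oscillating(4))
  qed
qed

lemma mult_continuous: "continuous_on S (\<lambda>t. C_mult t \<xi>)" "continuous_on S (\<lambda>t. S_mult t \<xi>)"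
  by (cases rule: multiplier_cases[of \<xi>]; auto intro!: continuous_intros)+

lemma C_mult_borel [measurable (raw)]:
  assumes [measurable]: "f \<in> borel_measurable M" "g \<in> borel_measurable M"
  shows "(\<lambda>x. C_mult (f x) (g x)) \<in> borel_measurable M"
  unfolding C_mult_def cosh_def by measurable

lemma S_mult_borel [measurable (raw)]:
  assumes [measurable]: "f \<in> borel_measurable M" "g \<in> borel_measurable M"
  shows "(\<lambda>x. S_mult (f x) (g x)) \<in> borel_measurable M"
  unfolding S_mult_def sinh_def by measurable

text \<open>The linear equation $w_t = i w_{xx} + 2 i \mathrm{Re}\, w$ couples the transform at \<open>\<xi>\<close> with
  the conjugate of the transform at \<open>- \<xi>\<close>. Its propagator multiplies the former by \<open>amp\<close> and the latter by
  \<open>bmp\<close>.\<close>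

definition amp :: "real \<Rightarrow> real \<Rightarrow> complex" where
  "amp t \<xi> = of_real (C_mult t \<xi>) + \<i> * of_real (S_mult t \<xi> * (1 - \<xi>\<^sup>2))"

definition bmp :: "real \<Rightarrow> real \<Rightarrow> complex" where
  "bmp t \<xi> = \<i> * of_real (S_mult t \<xi>)"

lemma amp_even [simp]: "amp t (- \<xi>) = amp t \<xi>" "bmp t (- \<xi>) = bmp t \<xi>"
  by (simp_all add: amp_def bmp_def)

lemma amp_0 [simp]: "amp 0 \<xi> = 1" "bmp 0 \<xi> = 0"
  by (simp_all add: amp_def bmp_def)

lemma amp_add:
  "amp (p + q) \<xi> = amp p \<xi> * amp q \<xi> + bmp p \<xi> * cnj (bmp q \<xi>)"
  "bmp (p + q) \<xi> = amp p \<xi> * bmp q \<xi> + bmp p \<xi> * cnj (amp q \<xi>)"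
  by (simp_all add: amp_def bmp_def C_mult_add S_mult_add complex_eq_iff power2_eq_square algebra_simps)

text \<open>The matrix of the propagator has determinant one, so that a bound for \<open>bmp\<close> is one for \<open>amp\<close>. The
  identity is the addition theorem for \<open>t\<close> and \<open>- t\<close>.\<close>

lemma cmod_amp_squared: "(cmod (amp t \<xi>))\<^sup>2 = 1 + (S_mult t \<xi>)\<^sup>2"
proof -
  have "C_mult (t + - t) \<xi> = 1" by simp
  then have "(C_mult t \<xi>)\<^sup>2 - \<xi>\<^sup>2 * (2 - \<xi>\<^sup>2) * (S_mult t \<xi>)\<^sup>2 = 1"
    unfolding C_mult_add by (simp add: mult_uminus power2_eq_square)
  then show ?thesis
    unfolding amp_def cmod_power2 by (simp add: power2_eq_square algebra_simps del: of_real_mult of_real_diff)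
qed

lemma cmod_amp_le: assumes "\<bar>t\<bar> \<le> r" shows "cmod (amp t \<xi>) \<le> 1 + r * cosh r" "cmod (bmp t \<xi>) \<le> r * cosh r"
proof -
  show "cmod (bmp t \<xi>) \<le> r * cosh r" using abs_S_mult_le[OF assms, of \<xi>] by (simp add: bmp_def norm_mult)
  have "(cmod (amp t \<xi>))\<^sup>2 \<le> (1 + \<bar>S_mult t \<xi>\<bar>)\<^sup>2"
    unfolding cmod_amp_squared by (simp add: power2_sum)
  then have "cmod (amp t \<xi>) \<le> 1 + \<bar>S_mult t \<xi>\<bar>" by (rule power2_le_imp_le) simp
  then show "cmod (amp t \<xi>) \<le> 1 + r * cosh r" using abs_S_mult_le[OF assms, of \<xi>] by simp
qed

lemma amp_borel [measurable (raw)]: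
  assumes [measurable]: "f \<in> borel_measurable M" "g \<in> borel_measurable M"
  shows "(\<lambda>x. amp (f x) (g x)) \<in> borel_measurable M" "(\<lambda>x. bmp (f x) (g x)) \<in> borel_measurable M"
  unfolding amp_def bmp_def by measurable

lemma amp_continuous: "continuous_on S (\<lambda>t. amp t \<xi>)" "continuous_on S (\<lambda>t. bmp t \<xi>)"
  unfolding amp_def bmp_def by (intro continuous_intros mult_continuous)+

definition flow :: "real \<Rightarrow> (real \<Rightarrow> complex) \<Rightarrow> real \<Rightarrow> complex" where
  "flow t F \<xi> = amp t \<xi> * F \<xi> + bmp t \<xi> * cnj (F (- \<xi>))"

lemma flow_borel [measurable]:
  assumes [measurable]: "F \<in> borel_measurable borel" shows "flow t F \<in> borel_measurable borel"
  unfolding flow_def[abs_def] by measurable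

lemma L2_flow:
  assumes F: "L2 F"
  shows "L2 (flow t F)" "\<bar>t\<bar> \<le> r \<Longrightarrow> L2_norm (flow t F) \<le> (1 + 2 * r * cosh r) * L2_norm F"
proof -
  have F': "L2 (\<lambda>\<xi>. cnj (F (- \<xi>)))" by (intro L2_cnj L2_reflect F)
  have ab: "(\<lambda>\<xi>. amp t \<xi>) \<in> borel_measurable borel" "(\<lambda>\<xi>. bmp t \<xi>) \<in> borel_measurable borel"
    by measurable
  note a = L2_bounded_mult[OF F ab(1) cmod_amp_le(1)[OF order_refl]]
    and b = L2_bounded_mult[OF F' ab(2) cmod_amp_le(2)[OF order_refl]]
  show "L2 (flow t F)" unfolding flow_def[abs_def] by (intro L2_add a b)
  assume r: "\<bar>t\<bar> \<le> r"
  have "L2_norm (flow t F) \<le> (1 + r * cosh r) * L2_norm F + r * cosh r * L2_norm (\<lambda>\<xi>. cnj (F (- \<xi>)))"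
    unfolding flow_def[abs_def]
    by (intro order_trans[OF L2_norm_triangle[OF a b]] add_mono L2_norm_bounded_mult F F' ab cmod_amp_le r)
  then show "L2_norm (flow t F) \<le> (1 + 2 * r * cosh r) * L2_norm F"
    by (simp add: L2_norm_cnj_reflect algebra_simps)
qed

definition V :: "real \<Rightarrow> l2 \<Rightarrow> l2" where "V t z = abs_l2 (flow t (rep_l2 z))"

lemma rep_V: "AE \<xi> in lborel. rep_l2 (V t z) \<xi> = amp t \<xi> * rep_l2 z \<xi> + bmp t \<xi> * cnj (rep_l2 z (- \<xi>))"
  using rep_abs_l2[OF L2_flow(1)[OF L2_rep_l2, of t z]] by (simp add: V_def flow_def)

lemma norm_V_le: "\<bar>t\<bar> \<le> r \<Longrightarrow> norm (V t z) \<le> (1 + 2 * r * cosh r) * norm z"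
  using L2_flow[OF L2_rep_l2[of z]] by (simp add: V_def norm_abs_l2 norm_rep_l2)

lemma V_additive: "V t (y + z) = V t y + V t z"
  by (rule l2_eqI)
    (use rep_V[of t "y + z"] rep_V[of t y] rep_V[of t z] rep_l2_add[of y z] lborel_AE_reflect[OF rep_l2_add[of y z]]
       rep_l2_add[of "V t y" "V t z"] in \<open>eventually_elim, simp add: algebra_simps\<close>)

lemma V_scaleR: "V t (r *\<^sub>R z) = r *\<^sub>R V t z"
  by (rule l2_eqI)
    (use rep_V[of t "r *\<^sub>R z"] rep_V[of t z] rep_l2_scaleR[of r z] lborel_AE_reflect[OF rep_l2_scaleR[of r z]]
       rep_l2_scaleR[of r "V t z"] in \<open>eventually_elim, simp add: algebra_simps\<close>)

lemma bounded_linear_V: "bounded_linear (V t)"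
  by (rule bounded_linear_intro[where K = "1 + 2 * \<bar>t\<bar> * cosh \<bar>t\<bar>"])
     (use norm_V_le[of t "\<bar>t\<bar>"] in \<open>auto simp: V_additive V_scaleR mult.commute\<close>)

lemma V_0: "V 0 z = z"
  by (rule l2_eqI) (use rep_V[of 0 z] in simp)

lemma V_add: "V (p + q) z = V p (V q z)"
  by (rule l2_eqI)
    (use rep_V[of "p + q" z] rep_V[of p "V q z"] rep_V[of q z] lborel_AE_reflect[OF rep_V[of q z]]
      in \<open>eventually_elim, simp add: amp_add algebra_simps\<close>)

text \<open>Dominated convergence: at each frequency the multipliers are continuous in time, and they are
  uniformly bounded for bounded times.\<close>

lemma V_continuous: "continuous_on UNIV (\<lambda>t. V t z)"
proof (rule continuous_on_sequentiallyI)
  fix \<tau> and t :: real assume \<tau>: "\<tau> \<longlonglongrightarrow> t"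
  obtain r where r: "\<And>n. \<bar>\<tau> n\<bar> \<le> r"
    using Bseq_eq_bounded convergent_imp_Bseq[OF convergentI[OF \<tau>]] unfolding Bseq_def by auto
  have tr: "\<bar>t\<bar> \<le> r"
    by (rule LIMSEQ_le_const2[OF tendsto_rabs[OF \<tau>]]) (use r in auto)
  then have r0: "0 \<le> r" by linarith
  define c where "c = 1 + r * cosh r"
  have c: "cmod (amp x \<xi>) \<le> c" "cmod (bmp x \<xi>) \<le> c" if "\<bar>x\<bar> \<le> r" for x \<xi>
    using cmod_amp_le[OF that, of \<xi>] by (auto simp: c_def)
  let ?z = "rep_l2 z"
  let ?w = "\<lambda>\<xi>. 8 * c\<^sup>2 * ((cmod (?z \<xi>))\<^sup>2 + (cmod (?z (- \<xi>)))\<^sup>2)"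
  have "(\<lambda>n. LINT \<xi>|lborel. (cmod (flow (\<tau> n) ?z \<xi> - flow t ?z \<xi>))\<^sup>2) \<longlonglongrightarrow> integral\<^sup>L (lborel :: real measure) (\<lambda>\<xi>. 0)"
  proof (rule integral_dominated_convergence[where w = ?w])
    show "integrable lborel ?w"
      using L2_integrable[OF L2_rep_l2, of z] L2_integrable[OF L2_reflect[OF L2_rep_l2], of z] by auto
    show "AE \<xi> in lborel. (\<lambda>n. (cmod (flow (\<tau> n) ?z \<xi> - flow t ?z \<xi>))\<^sup>2) \<longlonglongrightarrow> 0"
    proof (rule AE_I2)
      fix \<xi>
      have "(\<lambda>n. amp (\<tau> n) \<xi>) \<longlonglongrightarrow> amp t \<xi>" "(\<lambda>n. bmp (\<tau> n) \<xi>) \<longlonglongrightarrow> bmp t \<xi>"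
        using continuous_on_tendsto_compose[OF amp_continuous(1)[of UNIV] \<tau>]
          continuous_on_tendsto_compose[OF amp_continuous(2)[of UNIV] \<tau>] by auto
      then have "(\<lambda>n. flow (\<tau> n) ?z \<xi>) \<longlonglongrightarrow> flow t ?z \<xi>"
        unfolding flow_def by (intro tendsto_add tendsto_mult tendsto_const)
      then have "(\<lambda>n. (cmod (flow (\<tau> n) ?z \<xi> - flow t ?z \<xi>))\<^sup>2) \<longlonglongrightarrow> (cmod (flow t ?z \<xi> - flow t ?z \<xi>))\<^sup>2"
        by (intro tendsto_intros)
      then show "(\<lambda>n. (cmod (flow (\<tau> n) ?z \<xi> - flow t ?z \<xi>))\<^sup>2) \<longlonglongrightarrow> 0" by simp
    qed
    fix n
    show "AE \<xi> in lborel. norm ((cmod (flow (\<tau> n) ?z \<xi> - flow t ?z \<xi>))\<^sup>2) \<le> ?w \<xi>"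
    proof (rule AE_I2)
      fix \<xi>
      let ?a = "amp (\<tau> n) \<xi> - amp t \<xi>" and ?b = "bmp (\<tau> n) \<xi> - bmp t \<xi>"
      have eq: "flow (\<tau> n) ?z \<xi> - flow t ?z \<xi> = ?a * ?z \<xi> + ?b * cnj (?z (- \<xi>))"
        by (simp add: flow_def algebra_simps)
      have d: "cmod ?a \<le> 2 * c" "cmod ?b \<le> 2 * c"
        using c[OF r, of n \<xi>] c[OF tr, of \<xi>] norm_triangle_ineq4[of "amp (\<tau> n) \<xi>" "amp t \<xi>"]
          norm_triangle_ineq4[of "bmp (\<tau> n) \<xi>" "bmp t \<xi>"] by linarith+
      have 2: "(cmod ?a)\<^sup>2 \<le> (2 * c)\<^sup>2" "(cmod ?b)\<^sup>2 \<le> (2 * c)\<^sup>2"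
        by (rule power_mono[OF d(1) norm_ge_zero], rule power_mono[OF d(2) norm_ge_zero])
      have "(cmod (flow (\<tau> n) ?z \<xi> - flow t ?z \<xi>))\<^sup>2
          \<le> 2 * ((cmod ?a)\<^sup>2 * (cmod (?z \<xi>))\<^sup>2) + 2 * ((cmod ?b)\<^sup>2 * (cmod (?z (- \<xi>)))\<^sup>2)"
        unfolding eq by (rule order_trans[OF cmod_add_squared_le]) (simp add: norm_mult power_mult_distrib)
      also have "\<dots> \<le> 2 * ((2 * c)\<^sup>2 * (cmod (?z \<xi>))\<^sup>2) + 2 * ((2 * c)\<^sup>2 * (cmod (?z (- \<xi>)))\<^sup>2)"
        using 2 by (intro add_mono mult_left_mono mult_right_mono) auto
      finally show "norm ((cmod (flow (\<tau> n) ?z \<xi> - flow t ?z \<xi>))\<^sup>2) \<le> ?w \<xi>"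
        by (simp add: power_mult_distrib algebra_simps)
    qed
  qed auto
  then have "(\<lambda>n. sqrt (LINT \<xi>|lborel. (cmod (flow (\<tau> n) ?z \<xi> - flow t ?z \<xi>))\<^sup>2)) \<longlonglongrightarrow> sqrt 0"
    by (intro tendsto_real_sqrt) simp
  then show "(\<lambda>n. V (\<tau> n) z) \<longlonglongrightarrow> V t z"
    unfolding V_def by (subst L2_norm_tendsto_iff) (auto intro: L2_flow simp: L2_norm_def)
qed

section \<open>The nonlinearity\<close>

context sobolev
begin

interpretation mul: bounded_bilinear mul by (rule bounded_bilinear_mul)
interpretation star: bounded_linear star by (rule bounded_linear_star)

text \<open>The coordinates of \<open>- \<i> * G w\<close>, the contribution of the nonlinearity to the time derivative.\<close>

definition K :: "l2 \<Rightarrow> l2" where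
  "K z = cscale \<i> (2 *\<^sub>R mul z (star z) + mul z z + mul (mul z (star z)) z)"

lemma norm_mul_le: "norm (mul y z) \<le> Cmul * norm y * norm z"
  unfolding mul_def by (rule D_mult_Hs(2))

lemma norm_mul_mono: "norm y \<le> a \<Longrightarrow> norm z \<le> b \<Longrightarrow> norm (mul y z) \<le> Cmul * a * b"
  using order_trans[OF norm_mul_le[of y z]] Cmul_nonneg
  by (meson mult_mono mult_nonneg_nonneg norm_ge_zero order_refl order_trans)

text \<open>The differences of the quadratic and cubic terms are telescoped.\<close>

lemma K_lipschitz:
  assumes x: "norm x \<le> r" and y: "norm y \<le> r"
  shows "norm (K x - K y) \<le> (6 * Cmul * r + 3 * Cmul\<^sup>2 * r\<^sup>2) * norm (x - y)"
proof -
  let ?d = "norm (x - y)"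
  have 1: "norm (mul x (star x) - mul y (star y)) \<le> 2 * Cmul * r * ?d"
  proof -
    have "mul x (star x) - mul y (star y) = mul (x - y) (star x) + mul y (star (x - y))"
      by (simp add: mul.diff_left mul.diff_right star.diff)
    also have "norm \<dots> \<le> Cmul * ?d * r + Cmul * r * ?d"
      by (intro norm_triangle_le add_mono norm_mul_mono) (auto simp: norm_star x y)
    finally show ?thesis by (simp add: algebra_simps)
  qed
  have 2: "norm (mul x x - mul y y) \<le> 2 * Cmul * r * ?d"
  proof -
    have "mul x x - mul y y = mul (x - y) x + mul y (x - y)"
      by (simp add: mul.diff_left mul.diff_right)
    also have "norm \<dots> \<le> Cmul * ?d * r + Cmul * r * ?d"
      by (intro norm_triangle_le add_mono norm_mul_mono) (auto simp: x y)
    finally show ?thesis by (simp add: algebra_simps)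
  qed
  have 3: "norm (mul (mul x (star x)) x - mul (mul y (star y)) y) \<le> 3 * Cmul\<^sup>2 * r\<^sup>2 * ?d"
  proof -
    have "mul (mul x (star x)) x - mul (mul y (star y)) y = mul (mul x (star x) - mul y (star y)) x + mul (mul y (star y)) (x - y)"
      by (simp add: mul.diff_left mul.diff_right)
    also have "norm \<dots> \<le> Cmul * (2 * Cmul * r * ?d) * r + Cmul * (Cmul * r * r) * ?d"
      by (intro norm_triangle_le add_mono norm_mul_mono 1) (auto simp: norm_star x y)
    finally show ?thesis by (simp add: algebra_simps power2_eq_square)
  qed
  have "K x - K y = cscale \<i> (2 *\<^sub>R (mul x (star x) - mul y (star y)) + (mul x x - mul y y)
      + (mul (mul x (star x)) x - mul (mul y (star y)) y))"
    unfolding K_def linear_diff[OF bounded_linear.linear[OF bounded_linear_cscale], symmetric]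
    by (simp add: scaleR_diff_right algebra_simps)
  then have "norm (K x - K y) \<le> norm (2 *\<^sub>R (mul x (star x) - mul y (star y)) + (mul x x - mul y y)
      + (mul (mul x (star x)) x - mul (mul y (star y)) y))"
    by (simp add: norm_cscale)
  also have "\<dots> \<le> 2 * (2 * Cmul * r * ?d) + 2 * Cmul * r * ?d + 3 * Cmul\<^sup>2 * r\<^sup>2 * ?d"
    using 1 by (intro norm_triangle_le add_mono 2 3) (simp add: mult_ac)
  finally show ?thesis by (simp add: algebra_simps)
qed

sublocale evolution: semilinear V K "\<lambda>r. 1 + 2 * \<bar>r\<bar> * cosh r" "\<lambda>r. 6 * Cmul * r + 3 * Cmul\<^sup>2 * r\<^sup>2"
proof (rule semilinear.intro)
  fix t r c :: real and x y :: l2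
  show "bounded_linear (V t)" by (rule bounded_linear_V)
  show "V 0 x = x" by (rule V_0)
  show "V (p + q) x = V p (V q x)" for p q by (rule V_add)
  show "continuous_on UNIV (\<lambda>t. V t x)" by (rule V_continuous)
  show "norm (V t x) \<le> (1 + 2 * \<bar>r\<bar> * cosh r) * norm x" if "\<bar>t\<bar> \<le> r"
    using norm_V_le[OF that, of x] that by simp
  show "1 \<le> 1 + 2 * \<bar>r\<bar> * cosh r" by simp
  show "K 0 = 0"
    by (simp add: K_def mul.zero_left linear_0[OF bounded_linear.linear[OF bounded_linear_cscale]])
  show "norm (K x - K y) \<le> (6 * Cmul * r + 3 * Cmul\<^sup>2 * r\<^sup>2) * norm (x - y)" if "norm x \<le> r" "norm y \<le> r"
    using that by (rule K_lipschitz)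
  show "0 \<le> 6 * Cmul * r + 3 * Cmul\<^sup>2 * r\<^sup>2" if "0 \<le> r" using that Cmul_nonneg by simp
  show "\<exists>r>0. 6 * Cmul * r + 3 * Cmul\<^sup>2 * r\<^sup>2 \<le> c" if "0 < c"
  proof -
    define r where "r = min 1 (c / (6 * Cmul + 3 * Cmul\<^sup>2 + 1))"
    have p: "0 < 6 * Cmul + 3 * Cmul\<^sup>2 + 1" using Cmul_nonneg by (simp add: add_nonneg_pos)
    have r: "0 < r" "r \<le> 1" "r \<le> c / (6 * Cmul + 3 * Cmul\<^sup>2 + 1)" using that p by (auto simp: r_def)
    have "r\<^sup>2 \<le> r" using r by (simp add: power2_eq_square mult_left_le)
    then have "6 * Cmul * r + 3 * Cmul\<^sup>2 * r\<^sup>2 \<le> (6 * Cmul + 3 * Cmul\<^sup>2 + 1) * r"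
      using r mult_left_mono[of "r\<^sup>2" r "3 * Cmul\<^sup>2"] by (simp add: algebra_simps)
    also have "\<dots> \<le> c" using r(3) p by (simp add: field_simps)
    finally show ?thesis using r(1) by blast
  qed
qed

definition hat_G :: "l2 \<Rightarrow> real \<Rightarrow> complex" where
  "hat_G z \<xi> = - (2 * hat_mul z (star z) \<xi> + hat_mul z z \<xi> + hat_mul (mul z (star z)) z \<xi>)"

text \<open>\<open>hat_G (E w)\<close> is the Fourier integral of the nonlinearity (\<open>G_Hs\<close>), as a function of the
  coordinates.\<close>

lemma continuous_hat_G:
  "continuous_on UNIV (\<lambda>(z, \<xi>). hat_G z \<xi>)"
proof -
  have 1: "continuous_on UNIV (\<lambda>p. hat_mul (f p) (g p) (snd p))"
    if "continuous_on UNIV f" "continuous_on UNIV g" for f g :: "l2 \<times> real \<Rightarrow> l2"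
  proof -
    have "continuous_on UNIV (\<lambda>p. (f p, g p, snd p))" by (intro continuous_intros that)
    from continuous_on_compose2[OF continuous_hat_mul this] show ?thesis by simp
  qed
  have f: "continuous_on UNIV (fst :: l2 \<times> real \<Rightarrow> l2)" by (intro continuous_intros)
  have s: "continuous_on UNIV (\<lambda>p :: l2 \<times> real. star (fst p))" by (intro star.continuous_on f)
  show ?thesis
    unfolding hat_G_def split_beta
    by (intro continuous_intros 1 f s mul.continuous_on)
qed

lemma G_expand: "G z = - (2 * (z * cnj z) + z * z + z * cnj z * z)"
  unfolding G_def complex_norm_square by (simp add: power2_eq_square)

lemma G_Hs:
  assumes w: "w \<in> Hs s"
  shows "(\<lambda>x. G (w x)) \<in> Hs s"
    and "integrable lborel (\<lambda>x. G (w x))"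
    and "fourier_integral (\<lambda>x. G (w x)) \<xi> = hat_G (E w) \<xi>"
    and "E (\<lambda>x. - \<i> * G (w x)) = K (E w)"
proof -
  let ?z = "E w"
  note [measurable] = L2_borel[OF Hs_L2[OF w]]
  note c = Hs_cnj[OF w]
  note wc = Hs_mult[OF w c(1)]
  note ww = Hs_mult[OF w w]
  note wcw = Hs_mult[OF wc(1) w]
  note wc2 = Hs_cmult[OF wc(1), of 2]
  note sum1 = Hs_add[OF wc2(1) ww(1)]
  note sum = Hs_add[OF sum1(1) wcw(1)]
  have eq: "(\<lambda>x. G (w x)) = (\<lambda>x. (-1) * (2 * (w x * cnj (w x)) + w x * w x + w x * cnj (w x) * w x))"
    by (simp add: G_expand)
  show "(\<lambda>x. G (w x)) \<in> Hs s" unfolding eq by (rule Hs_cmult(1)[OF sum(1)])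
  have "(\<lambda>x. - \<i> * G (w x)) = (\<lambda>x. \<i> * (2 * (w x * cnj (w x)) + w x * w x + w x * cnj (w x) * w x))"
    by (rule ext) (simp add: G_expand algebra_simps)
  then have "E (\<lambda>x. - \<i> * G (w x)) = cscale \<i> (E (\<lambda>x. 2 * (w x * cnj (w x)) + w x * w x + w x * cnj (w x) * w x))"
    by (simp only: Hs_cmult(2)[OF sum(1)])
  also have "E (\<lambda>x. 2 * (w x * cnj (w x)) + w x * w x + w x * cnj (w x) * w x)
      = 2 *\<^sub>R mul ?z (star ?z) + mul ?z ?z + mul (mul ?z (star ?z)) ?z"
    unfolding sum(2) sum1(2) wc2(2) wcw(2) ww(2) wc(2) c(2) using cscale_of_real[of 2] by simp
  finally show "E (\<lambda>x. - \<i> * G (w x)) = K ?z" by (simp add: K_def)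
  have AE: "AE x in lborel. G (w x) = (-1) * (2 * (D ?z x * D (star ?z) x) + D ?z x * D ?z x + D (mul ?z (star ?z)) x * D ?z x)"
    using D_E[OF w] D_E[OF c(1)] D_E[OF wc(1)] unfolding wc(2) c(2)
    by eventually_elim (simp add: G_expand)
  have D_borel [measurable]: "D y \<in> borel_measurable borel" for y by (rule L2_borel[OF L2_D])
  have int: "integrable lborel (\<lambda>x. 2 * (D ?z x * D (star ?z) x) + D ?z x * D ?z x + D (mul ?z (star ?z)) x * D ?z x)"
    by (intro Bochner_Integration.integrable_add integrable_mult_right integrable_D_mult)
  have G_borel: "(\<lambda>x. G (w x)) \<in> borel_measurable borel" unfolding eq by measurable
  show "integrable lborel (\<lambda>x. G (w x))"
    using integrable_cong_AE[OF _ _ AE] integrable_mult_right[OF int, of "-1"] G_borel by auto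
  have "fourier_integral (\<lambda>x. G (w x)) \<xi> = fourier_integral (\<lambda>x. (-1) * (2 * (D ?z x * D (star ?z) x) + D ?z x * D ?z x + D (mul ?z (star ?z)) x * D ?z x)) \<xi>"
    by (subst fourier_integral_cong_AE[OF AE G_borel]) auto
  also have "\<dots> = hat_G ?z \<xi>"
    unfolding fourier_integral_cmult hat_G_def hat_mul_def
    by (simp add: fourier_integral_add fourier_integral_cmult integrable_D_mult)
  finally show "fourier_integral (\<lambda>x. G (w x)) \<xi> = hat_G ?z \<xi>" .
qed

lemma rep_K: "AE \<xi> in lborel. rep_l2 (K z) \<xi> = of_real (m \<xi>) * (- \<i> * hat_G z \<xi>)"
proof -
  have H: "(\<lambda>x. - \<i> * G (D z x)) \<in> Hs s"
    by (rule Hs_cmult(1)[OF G_Hs(1)[OF D_Hs]])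
  have "integrable lborel (\<lambda>x. - \<i> * G (D z x))"
    by (rule integrable_mult_right[OF G_Hs(2)[OF D_Hs]])
  then have "fourier (\<lambda>x. - \<i> * G (D z x)) \<xi> = - \<i> * hat_G z \<xi>" for \<xi>
    unfolding fourier_def if_P[OF \<open>integrable lborel (\<lambda>x. - \<i> * G (D z x))\<close>] fourier_integral_cmult G_Hs(3)[OF D_Hs] by simp
  then show ?thesis
    using rep_E[OF H] G_Hs(4)[OF D_Hs[of z]] by simp
qed

end

lemma eq_if_conjugate_sums_eq:
  fixes p q a b :: complex
  assumes "p + \<i> * q = a + \<i> * b" "p - \<i> * q = a - \<i> * b"
  shows "p = a \<and> q = b"
proof -
  have "2 * p = (p + \<i> * q) + (p - \<i> * q)" by simp
  then have "2 * p = 2 * a" unfolding assms by simp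
  with assms(1) show ?thesis by simp
qed

section \<open>Vector-valued and pointwise Duhamel integrals\<close>

text \<open>Both sides have the same pairings with modulated Gaussians: a bounded functional may be taken
  under the vector-valued integral, and Fubini's theorem exchanges time and frequency on the other
  side.\<close>

lemma l2_integral_pointwise:
  fixes h :: "real \<Rightarrow> l2" and H :: "real \<Rightarrow> real \<Rightarrow> complex"
  assumes h: "continuous_on {a..b} h"
    and H [measurable]: "(\<lambda>(\<sigma>, \<xi>). H \<sigma> \<xi>) \<in> borel_measurable (borel \<Otimes>\<^sub>M borel)"
    and rep: "\<And>\<sigma>. \<sigma> \<in> {a..b} \<Longrightarrow> AE \<xi> in lborel. rep_l2 (h \<sigma>) \<xi> = H \<sigma> \<xi>"
  shows "AE \<xi> in lborel. rep_l2 (integral {a..b} h) \<xi> = (LINT \<sigma>:{a..b}|lborel. H \<sigma> \<xi>)"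
proof -
  interpret pairing: bounded_bilinear l2_pairing
    by (rule l2_pairing_bounded_bilinear)
  define Y where "Y = rep_l2 (integral {a..b} h)"
  define y where "y \<xi> = (LINT \<sigma>:{a..b}|lborel. H \<sigma> \<xi>)" for \<xi>
  have Y: "L2 Y" by (simp add: Y_def)
  have [measurable]: "H \<sigma> \<in> borel_measurable borel" for \<sigma>
    using measurable_compose[OF measurable_Pair1'[of \<sigma> borel borel] H] by simp
  have HL: "L2 (H \<sigma>)" if "\<sigma> \<in> {a..b}" for \<sigma>
    by (rule L2_AE_cong[OF L2_rep_l2 _ rep[OF that]]) measurable
  have h_eq: "h \<sigma> = abs_l2 (H \<sigma>)" if "\<sigma> \<in> {a..b}" for \<sigma>
    using abs_l2_eq_iff[OF L2_rep_l2 HL[OF that], of "h \<sigma>"] rep[OF that] by simp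
  have "bounded (h ` {a..b})" by (intro compact_imp_bounded compact_continuous_image h) auto
  then obtain M where "\<forall>x\<in>h ` {a..b}. norm x \<le> M" unfolding bounded_iff by blast
  then have M: "\<And>\<sigma>. \<sigma> \<in> {a..b} \<Longrightarrow> norm (h \<sigma>) \<le> M" by auto
  have *: "integrable (lborel \<Otimes>\<^sub>M lborel) (\<lambda>(\<sigma>, \<xi>). indicator {a..b} \<sigma> *\<^sub>R (H \<sigma> \<xi> * g \<xi>))"
    and **: "(LINT \<xi>|lborel. Y \<xi> * g \<xi>) = (LINT \<xi>|lborel. y \<xi> * g \<xi>)" if g: "L2 g" for g
  proof -
    note [measurable] = L2_borel[OF g]
    let ?k = "\<lambda>\<sigma> \<xi>. indicator {a..b} \<sigma> *\<^sub>R (H \<sigma> \<xi> * g \<xi>)"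
    show int: "integrable (lborel \<Otimes>\<^sub>M lborel) (\<lambda>(\<sigma>, \<xi>). ?k \<sigma> \<xi>)"
    proof (rule lborel_pair.Fubini_integrable)
      have bound: "(LINT \<xi>|lborel. norm (?k \<sigma> \<xi>)) \<le> indicator {a..b} \<sigma> * (M * L2_norm g)" for \<sigma>
      proof (cases "\<sigma> \<in> {a..b}")
        case True
        have "(LINT \<xi>|lborel. cmod (H \<sigma> \<xi> * g \<xi>)) \<le> L2_norm (H \<sigma>) * L2_norm g"
          by (rule L2_Cauchy_Schwarz_norm[OF HL[OF True] g])
        also have "\<dots> \<le> M * L2_norm g"
          using M[OF True] HL[OF True] by (intro mult_right_mono L2_norm_nonneg) (simp add: h_eq[OF True] norm_abs_l2)
        finally show ?thesis using True by simp
      qed simp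
      have "integrable lborel (\<lambda>\<sigma>. LINT \<xi>|lborel. norm (?k \<sigma> \<xi>))"
      proof (rule Bochner_Integration.integrable_bound)
        show "integrable lborel (\<lambda>\<sigma>. indicator {a..b} \<sigma> * (M * L2_norm g) :: real)"
          by (intro integrable_mult_left integrable_real_indicator) (auto simp: emeasure_lborel_Icc_eq)
        have "0 \<le> (LINT \<xi>|lborel. norm (?k \<sigma> \<xi>))" for \<sigma> by simp
        then show "AE \<sigma> in lborel. norm (LINT \<xi>|lborel. norm (?k \<sigma> \<xi>)) \<le> norm (indicator {a..b} \<sigma> * (M * L2_norm g))"
          using order_trans[OF bound abs_ge_self] by (intro AE_I2) (simp only: real_norm_def abs_of_nonneg)
      qed measurable
      then show "integrable lborel (\<lambda>\<sigma>. LINT \<xi>|lborel. norm (case (\<sigma>, \<xi>) of (\<sigma>, \<xi>) \<Rightarrow> ?k \<sigma> \<xi>))" by simp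
      show "AE \<sigma> in lborel. integrable lborel (\<lambda>\<xi>. case (\<sigma>, \<xi>) of (\<sigma>, \<xi>) \<Rightarrow> ?k \<sigma> \<xi>)"
        using L2_mult_integrable[OF HL g] by (intro AE_I2) (auto simp: indicator_def)
    qed measurable
    let ?\<phi> = "\<lambda>z. l2_pairing z (abs_l2 g)"
    have \<phi>: "bounded_linear ?\<phi>" by (rule pairing.bounded_linear_left)
    have \<phi>h: "continuous_on {a..b} (\<lambda>\<sigma>. ?\<phi> (h \<sigma>))" by (intro pairing.continuous_on h continuous_intros)
    have "(LINT \<xi>|lborel. Y \<xi> * g \<xi>) = ?\<phi> (integral {a..b} h)"
      using l2_pairing_abs[OF Y g] by (simp add: Y_def)
    also have "\<dots> = integral {a..b} (\<lambda>\<sigma>. ?\<phi> (h \<sigma>))"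
      using integral_linear[OF integrable_continuous_real[OF h] \<phi>] by (simp add: o_def)
    also have "\<dots> = (LINT \<sigma>:{a..b}|lborel. ?\<phi> (h \<sigma>))"
      by (rule set_borel_integral_eq_integral(2)[symmetric]) (rule borel_integrable_atLeastAtMost'[OF \<phi>h])
    also have "\<dots> = (LINT \<sigma>|lborel. LINT \<xi>|lborel. ?k \<sigma> \<xi>)"
      unfolding set_lebesgue_integral_def
    proof (intro Bochner_Integration.integral_cong refl)
      fix \<sigma>
      show "indicator {a..b} \<sigma> *\<^sub>R ?\<phi> (h \<sigma>) = (LINT \<xi>|lborel. ?k \<sigma> \<xi>)"
        using l2_pairing_abs[OF HL g] by (cases "\<sigma> \<in> {a..b}") (auto simp: h_eq)
    qed
    also have "\<dots> = (LINT \<xi>|lborel. LINT \<sigma>|lborel. ?k \<sigma> \<xi>)"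
      by (rule lborel_pair.Fubini_integral[OF int, symmetric])
    also have "\<dots> = (LINT \<xi>|lborel. y \<xi> * g \<xi>)"
      by (simp add: y_def set_lebesgue_integral_def flip: integral_mult_left_zero)
    finally show "(LINT \<xi>|lborel. Y \<xi> * g \<xi>) = (LINT \<xi>|lborel. y \<xi> * g \<xi>)" .
  qed
  have yg: "integrable lborel (\<lambda>\<xi>. y \<xi> * g \<xi>)" if "L2 g" for g
    using lborel_pair.integrable_snd[OF *[OF that]]
    by (simp add: y_def set_lebesgue_integral_def flip: integral_mult_left_zero)
  have "AE \<xi> in lborel. Y \<xi> - y \<xi> = 0"
  proof (rule AE_eq_0_if_modulated_gauss_pairings_vanish)
    show "integrable lborel (\<lambda>\<xi>. (Y \<xi> - y \<xi>) * gauss \<xi>)"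
      using Bochner_Integration.integrable_diff[OF L2_mult_integrable[OF Y L2_gauss] yg[OF L2_gauss]]
      by (simp add: left_diff_distrib)
    fix b'
    let ?g = "\<lambda>\<xi>. cis (\<xi> * b') * gauss \<xi>"
    have "(LINT \<xi>|lborel. (Y \<xi> - y \<xi>) * ?g \<xi>) = (LINT \<xi>|lborel. Y \<xi> * ?g \<xi>) - (LINT \<xi>|lborel. y \<xi> * ?g \<xi>)"
      unfolding left_diff_distrib
      by (rule Bochner_Integration.integral_diff[OF L2_mult_integrable[OF Y L2_modulated_gauss] yg[OF L2_modulated_gauss]])
    then show "(LINT \<xi>|lborel. (Y \<xi> - y \<xi>) * ?g \<xi>) = 0"
      using **[OF L2_modulated_gauss[of b']] by simp
  qed
  then show ?thesis by (simp add: Y_def y_def)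
qed

context sobolev
begin

lemma duhamel_pointwise:
  assumes u: "continuous_on {0..t} u"
  shows "AE \<xi> in lborel. rep_l2 (evolution.duhamel 0 t u) \<xi> = of_real (m \<xi>) *
    (LINT \<sigma>:{0..t}|lborel. amp (t - \<sigma>) \<xi> * (- \<i> * hat_G (u \<sigma>) \<xi>) + bmp (t - \<sigma>) \<xi> * cnj (- \<i> * hat_G (u \<sigma>) (- \<xi>)))"
proof (cases "0 \<le> t")
  case False
  then show ?thesis using rep_l2_zero by (simp add: evolution.duhamel_def set_lebesgue_integral_def)
next
  case True
  \<comment> \<open>A continuous extension of \<open>u\<close> to all times makes the integrand measurable on the whole plane.\<close>
  define v where "v \<sigma> = u (max 0 (min t \<sigma>))" for \<sigma>
  have v: "continuous_on UNIV v"
    unfolding v_def using True by (intro continuous_on_compose2[OF u] continuous_intros) auto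
  have vu: "v \<sigma> = u \<sigma>" if "\<sigma> \<in> {0..t}" for \<sigma> using that by (simp add: v_def)
  define H where "H \<sigma> \<xi> = of_real (m \<xi>) * (amp (t - \<sigma>) \<xi> * (- \<i> * hat_G (v \<sigma>) \<xi>)
      + bmp (t - \<sigma>) \<xi> * cnj (- \<i> * hat_G (v \<sigma>) (- \<xi>)))" for \<sigma> \<xi>
  have "continuous_on UNIV (\<lambda>p :: real \<times> real. hat_G (v (fst p)) (snd p))"
    using continuous_on_compose2[OF continuous_hat_G, of UNIV "\<lambda>p :: real \<times> real. (v (fst p), snd p)"]
      continuous_on_compose2[OF v, of UNIV "fst :: real \<times> real \<Rightarrow> real"]
    by (simp add: continuous_intros)
  then have hG [measurable]: "(\<lambda>p :: real \<times> real. hat_G (v (fst p)) (snd p)) \<in> borel_measurable (borel \<Otimes>\<^sub>M borel)"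
    unfolding borel_prod by (rule borel_measurable_continuous_onI)
  have [measurable]: "(\<lambda>p :: real \<times> real. hat_G (v (fst p)) (- snd p)) \<in> borel_measurable (borel \<Otimes>\<^sub>M borel)"
    using measurable_compose[of "\<lambda>p :: real \<times> real. (fst p, - snd p)" "borel \<Otimes>\<^sub>M borel" "borel \<Otimes>\<^sub>M borel", OF _ hG] by simp
  have Hm: "(\<lambda>(\<sigma>, \<xi>). H \<sigma> \<xi>) \<in> borel_measurable (borel \<Otimes>\<^sub>M borel)"
    unfolding H_def split_beta by measurable
  have rep: "AE \<xi> in lborel. rep_l2 (V (t - \<sigma>) (K (u \<sigma>))) \<xi> = H \<sigma> \<xi>" if "\<sigma> \<in> {0..t}" for \<sigma>
    using rep_V[of "t - \<sigma>" "K (u \<sigma>)"] rep_K[of "u \<sigma>"] lborel_AE_reflect[OF rep_K[of "u \<sigma>"]]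
    by eventually_elim (simp add: H_def vu[OF that] algebra_simps)
  have "AE \<xi> in lborel. rep_l2 (evolution.duhamel 0 t u) \<xi> = (LINT \<sigma>:{0..t}|lborel. H \<sigma> \<xi>)"
    unfolding evolution.duhamel_def
    by (rule l2_integral_pointwise[OF evolution.integrand_continuous[OF u] Hm rep])
  moreover have "(LINT \<sigma>:{0..t}|lborel. H \<sigma> \<xi>) = of_real (m \<xi>) *
    (LINT \<sigma>:{0..t}|lborel. amp (t - \<sigma>) \<xi> * (- \<i> * hat_G (u \<sigma>) \<xi>) + bmp (t - \<sigma>) \<xi> * cnj (- \<i> * hat_G (u \<sigma>) (- \<xi>)))" for \<xi>
    unfolding set_integral_mult_right[symmetric]
    by (rule set_lebesgue_integral_cong) (auto simp: H_def vu)
  ultimately show ?thesis by simp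
qed

lemma C_Hs_iff:
  "C_Hs s T w \<longleftrightarrow> (\<forall>t\<in>{0..T}. w t \<in> Hs s) \<and> continuous_on {0..T} (\<lambda>t. E (w t))"
proof (cases "\<forall>t\<in>{0..T}. w t \<in> Hs s")
  case True
  have "((\<lambda>r. Hs_norm s (\<lambda>x. w r x - w t x)) \<longlongrightarrow> 0) (at t within {0..T}) \<longleftrightarrow>
      ((\<lambda>r. E (w r)) \<longlongrightarrow> E (w t)) (at t within {0..T})" if t: "t \<in> {0..T}" for t
  proof -
    have "\<forall>\<^sub>F r in at t within {0..T}. Hs_norm s (\<lambda>x. w r x - w t x) = norm (E (w r) - E (w t))"
      unfolding eventually_at_filter using True t by (auto simp: Hs_norm_eq Hs_diff intro!: always_eventually)
    then have "((\<lambda>r. Hs_norm s (\<lambda>x. w r x - w t x)) \<longlongrightarrow> 0) (at t within {0..T}) \<longleftrightarrow>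
        ((\<lambda>r. norm (E (w r) - E (w t))) \<longlongrightarrow> 0) (at t within {0..T})"
      by (rule tendsto_cong)
    also have "\<dots> \<longleftrightarrow> ((\<lambda>r. E (w r)) \<longlongrightarrow> E (w t)) (at t within {0..T})"
      by (simp add: tendsto_norm_zero_iff LIM_zero_iff)
    finally show ?thesis .
  qed
  then show ?thesis using True by (simp add: C_Hs_def continuous_on_def)
qed (auto simp: C_Hs_def)

text \<open>The complex formula at \<open>\<xi>\<close> and the conjugate of the one at \<open>- \<xi>\<close> together determine the two
  formulas for the transforms of the real and the imaginary part, since the transform of a real function
  takes conjugate values at \<open>\<xi>\<close> and \<open>- \<xi>\<close>.\<close>

lemma duhamel_system_iff:
  assumes w0: "w0 \<in> Hs s" and w: "\<And>t. t \<in> {0..T} \<Longrightarrow> w t \<in> Hs s"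
    and cont: "continuous_on {0..T} (\<lambda>t. E (w t))" and t: "t \<in> {0..T}"
  shows "(AE \<xi> in lborel.
        Re_hat (w t) \<xi> =
            of_real (C_mult t \<xi>) * Re_hat w0 \<xi>
          + of_real (S_mult t \<xi> * \<xi>\<^sup>2) * Im_hat w0 \<xi>
          + (LINT \<sigma>:{0..t}|lborel. of_real (C_mult (t - \<sigma>) \<xi>) * Im_hat (\<lambda>x. G (w \<sigma> x)) \<xi>)
          - (LINT \<sigma>:{0..t}|lborel. of_real (S_mult (t - \<sigma>) \<xi> * \<xi>\<^sup>2) * Re_hat (\<lambda>x. G (w \<sigma> x)) \<xi>)
      \<and> Im_hat (w t) \<xi> =
            of_real (C_mult t \<xi>) * Im_hat w0 \<xi>
          + of_real (S_mult t \<xi> * (2 - \<xi>\<^sup>2)) * Re_hat w0 \<xi>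
          - (LINT \<sigma>:{0..t}|lborel. of_real (C_mult (t - \<sigma>) \<xi>) * Re_hat (\<lambda>x. G (w \<sigma> x)) \<xi>)
          + (LINT \<sigma>:{0..t}|lborel. of_real (S_mult (t - \<sigma>) \<xi> * (2 - \<xi>\<^sup>2)) * Im_hat (\<lambda>x. G (w \<sigma> x)) \<xi>))
    \<longleftrightarrow> E (w t) = V t (E w0) + evolution.duhamel 0 t (\<lambda>\<sigma>. E (w \<sigma>))"
    (is "(AE \<xi> in lborel. ?P \<xi> = ?A \<xi> \<and> ?Q \<xi> = ?B \<xi>) \<longleftrightarrow> _")
proof -
  let ?f = "\<lambda>\<sigma> \<xi>. Re_hat (\<lambda>x. G (w \<sigma> x)) \<xi>" and ?g = "\<lambda>\<sigma> \<xi>. Im_hat (\<lambda>x. G (w \<sigma> x)) \<xi>"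
  let ?j1 = "\<lambda>\<sigma> \<xi>. of_real (C_mult (t - \<sigma>) \<xi>) * ?g \<sigma> \<xi>"
  let ?J1 = "\<lambda>\<xi>. LINT \<sigma>:{0..t}|lborel. ?j1 \<sigma> \<xi>"
  let ?j2 = "\<lambda>\<sigma> \<xi>. of_real (S_mult (t - \<sigma>) \<xi> * \<xi>\<^sup>2) * ?f \<sigma> \<xi>"
  let ?J2 = "\<lambda>\<xi>. LINT \<sigma>:{0..t}|lborel. ?j2 \<sigma> \<xi>"
  let ?j3 = "\<lambda>\<sigma> \<xi>. of_real (C_mult (t - \<sigma>) \<xi>) * ?f \<sigma> \<xi>"
  let ?J3 = "\<lambda>\<xi>. LINT \<sigma>:{0..t}|lborel. ?j3 \<sigma> \<xi>"
  let ?j4 = "\<lambda>\<sigma> \<xi>. of_real (S_mult (t - \<sigma>) \<xi> * (2 - \<xi>\<^sup>2)) * ?g \<sigma> \<xi>"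
  let ?J4 = "\<lambda>\<xi>. LINT \<sigma>:{0..t}|lborel. ?j4 \<sigma> \<xi>"
  let ?i = "\<lambda>\<sigma> \<xi>. amp (t - \<sigma>) \<xi> * (- \<i> * hat_G (E (w \<sigma>)) \<xi>) + bmp (t - \<sigma>) \<xi> * cnj (- \<i> * hat_G (E (w \<sigma>)) (- \<xi>))"
  let ?I = "\<lambda>\<xi>. LINT \<sigma>:{0..t}|lborel. ?i \<sigma> \<xi>"
  let ?p = "Re_hat w0" and ?q = "Im_hat w0"
  have wt: "w \<sigma> \<in> Hs s" if "\<sigma> \<in> {0..t}" for \<sigma> using that t by (intro w) auto
  have L1: "integrable lborel (\<lambda>x. G (w \<sigma> x))" if "\<sigma> \<in> {0..t}" for \<sigma> by (rule G_Hs(2)[OF wt[OF that]])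
  have hatG: "hat_G (E (w \<sigma>)) \<xi> = ?f \<sigma> \<xi> + \<i> * ?g \<sigma> \<xi>" if "\<sigma> \<in> {0..t}" for \<sigma> \<xi>
    using Re_Im_hat_L1(1)[OF L1[OF that], of \<xi>] G_Hs(3)[OF wt[OF that], of \<xi>] by simp
  have herm: "?f \<sigma> (- \<xi>) = cnj (?f \<sigma> \<xi>)" "?g \<sigma> (- \<xi>) = cnj (?g \<sigma> \<xi>)" if "\<sigma> \<in> {0..t}" for \<sigma> \<xi>
    using Re_Im_hat_L1(2,3)[OF L1[OF that]] by auto
  have cG: "continuous_on {0..t} (\<lambda>\<sigma>. hat_G (E (w \<sigma>)) \<xi>)" for \<xi>
  proof -
    have "continuous_on {0..t} (\<lambda>\<sigma>. (E (w \<sigma>), \<xi>))"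
      using t by (intro continuous_intros continuous_on_subset[OF cont]) auto
    from continuous_on_compose2[OF continuous_hat_G this] show ?thesis by simp
  qed
  have cf: "continuous_on {0..t} (\<lambda>\<sigma>. ?f \<sigma> \<xi>)" for \<xi>
  proof -
    have "continuous_on {0..t} (\<lambda>\<sigma>. (hat_G (E (w \<sigma>)) \<xi> + cnj (hat_G (E (w \<sigma>)) (- \<xi>))) / 2)"
      by (intro continuous_intros cG) auto
    then show ?thesis
      by (rule continuous_on_cong[THEN iffD1, rotated 2]) (auto simp: hatG herm)
  qed
  have cg: "continuous_on {0..t} (\<lambda>\<sigma>. ?g \<sigma> \<xi>)" for \<xi>
  proof -
    have "continuous_on {0..t} (\<lambda>\<sigma>. (hat_G (E (w \<sigma>)) \<xi> - cnj (hat_G (E (w \<sigma>)) (- \<xi>))) / (2 * \<i>))"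
      by (intro continuous_intros cG) auto
    then show ?thesis
      by (rule continuous_on_cong[THEN iffD1, rotated 2]) (auto simp: hatG herm)
  qed
  have cm: "continuous_on {0..t} (\<lambda>\<sigma>. C_mult (t - \<sigma>) \<xi>)" "continuous_on {0..t} (\<lambda>\<sigma>. S_mult (t - \<sigma>) \<xi>)" for \<xi>
    using continuous_on_compose2[OF mult_continuous(1)[of UNIV \<xi>], of "{0..t}" "\<lambda>\<sigma>. t - \<sigma>"]
      continuous_on_compose2[OF mult_continuous(2)[of UNIV \<xi>], of "{0..t}" "\<lambda>\<sigma>. t - \<sigma>"]
    by (auto simp: continuous_intros)
  have J_int: "set_integrable lborel {0..t} (\<lambda>\<sigma>. ?j1 \<sigma> \<xi>)"
      "set_integrable lborel {0..t} (\<lambda>\<sigma>. ?j2 \<sigma> \<xi>)"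
      "set_integrable lborel {0..t} (\<lambda>\<sigma>. ?j3 \<sigma> \<xi>)"
      "set_integrable lborel {0..t} (\<lambda>\<sigma>. ?j4 \<sigma> \<xi>)" for \<xi>
    by (intro borel_integrable_atLeastAtMost' continuous_intros cf cg cm)+
  have I_eq: "?I \<xi> = ?J1 \<xi> - ?J2 \<xi> + \<i> * (?J4 \<xi> - ?J3 \<xi>)" for \<xi>
  proof -
    have "?I \<xi> = (LINT \<sigma>:{0..t}|lborel. (?j1 \<sigma> \<xi> - ?j2 \<sigma> \<xi>)
        + \<i> * (?j4 \<sigma> \<xi> - ?j3 \<sigma> \<xi>))"
    proof (rule set_lebesgue_integral_cong)
      show "\<forall>\<sigma>. \<sigma> \<in> {0..t} \<longrightarrow>
          ?i \<sigma> \<xi>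
          = (?j1 \<sigma> \<xi> - ?j2 \<sigma> \<xi>)
          + \<i> * (?j4 \<sigma> \<xi> - ?j3 \<sigma> \<xi>)"
        by (auto simp: hatG herm amp_def bmp_def algebra_simps)
    qed simp
    also have "\<dots> = ?J1 \<xi> - ?J2 \<xi> + \<i> * (?J4 \<xi> - ?J3 \<xi>)"
      using J_int[of \<xi>] by (simp add: set_integral_add set_integral_diff)
    finally show ?thesis .
  qed
  have J_herm: "?J1 (- \<xi>) = cnj (?J1 \<xi>)" "?J2 (- \<xi>) = cnj (?J2 \<xi>)" "?J3 (- \<xi>) = cnj (?J3 \<xi>)" "?J4 (- \<xi>) = cnj (?J4 \<xi>)" for \<xi>
  proof -
    have *: "(LINT \<sigma>:{0..t}|lborel. of_real (k \<sigma>) * h' \<sigma>) = cnj (LINT \<sigma>:{0..t}|lborel. of_real (k \<sigma>) * h \<sigma>)"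
      if "\<And>\<sigma>. \<sigma> \<in> {0..t} \<Longrightarrow> h' \<sigma> = cnj (h \<sigma>)" for h h' :: "real \<Rightarrow> complex" and k
      unfolding set_lebesgue_integral_def Bochner_Integration.integral_cnj[symmetric]
    proof (intro Bochner_Integration.integral_cong refl)
      fix \<sigma> show "indicator {0..t} \<sigma> *\<^sub>R (of_real (k \<sigma>) * h' \<sigma>) = cnj (indicator {0..t} \<sigma> *\<^sub>R (of_real (k \<sigma>) * h \<sigma>))"
        using that[of \<sigma>] by (cases "\<sigma> \<in> {0..t}") auto
    qed
    show "?J1 (- \<xi>) = cnj (?J1 \<xi>)" "?J2 (- \<xi>) = cnj (?J2 \<xi>)" "?J3 (- \<xi>) = cnj (?J3 \<xi>)" "?J4 (- \<xi>) = cnj (?J4 \<xi>)"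
      unfolding mult_even power2_minus by (rule *; simp add: herm)+
  qed
  have L: "L2 w0" "L2 (w t)" using w0 w t by (auto intro: Hs_L2)
  have rhs: "E (w t) = V t (E w0) + evolution.duhamel 0 t (\<lambda>\<sigma>. E (w \<sigma>)) \<longleftrightarrow>
      (AE \<xi> in lborel. ?P \<xi> + \<i> * ?Q \<xi> = ?A \<xi> + \<i> * ?B \<xi>)"
  proof -
    have c: "continuous_on {0..t} (\<lambda>\<sigma>. E (w \<sigma>))" using t by (intro continuous_on_subset[OF cont]) auto
    have "E (w t) = V t (E w0) + evolution.duhamel 0 t (\<lambda>\<sigma>. E (w \<sigma>)) \<longleftrightarrow>
        (AE \<xi> in lborel. rep_l2 (E (w t)) \<xi> = rep_l2 (V t (E w0) + evolution.duhamel 0 t (\<lambda>\<sigma>. E (w \<sigma>))) \<xi>)"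
      using l2_eqI by auto
    also have "\<dots> \<longleftrightarrow> (AE \<xi> in lborel. ?P \<xi> + \<i> * ?Q \<xi> = ?A \<xi> + \<i> * ?B \<xi>)"
    proof (rule eventually_subst)
      show "AE \<xi> in lborel. (rep_l2 (E (w t)) \<xi> = rep_l2 (V t (E w0) + evolution.duhamel 0 t (\<lambda>\<sigma>. E (w \<sigma>))) \<xi>)
          \<longleftrightarrow> (?P \<xi> + \<i> * ?Q \<xi> = ?A \<xi> + \<i> * ?B \<xi>)"
        using rep_E[OF w[OF t]] rep_l2_add[of "V t (E w0)" "evolution.duhamel 0 t (\<lambda>\<sigma>. E (w \<sigma>))"]
          rep_V[of t "E w0"] rep_E[OF w0] lborel_AE_reflect[OF rep_E[OF w0]] duhamel_pointwise[OF c]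
          fourier_Re_Im(1)[OF L(2)] fourier_Re_Im[OF L(1)] lborel_AE_reflect[OF fourier_Re_Im(1)[OF L(1)]]
      proof eventually_elim
        case (elim \<xi>)
        have "rep_l2 (V t (E w0) + evolution.duhamel 0 t (\<lambda>\<sigma>. E (w \<sigma>))) \<xi> = of_real (m \<xi>) *
            (amp t \<xi> * (?p \<xi> + \<i> * ?q \<xi>) + bmp t \<xi> * (?p \<xi> - \<i> * ?q \<xi>) + ?I \<xi>)"
        proof -
          have alg: "a * (of_real r * (p + \<i> * q)) + b * cnj (of_real r * (cnj p + \<i> * cnj q)) + of_real r * I
              = of_real r * (a * (p + \<i> * q) + b * (p - \<i> * q) + I)" for a b p q I :: complex and r :: real
            by (simp add: algebra_simps)
          show ?thesis
            unfolding elim(2,3,4,5,6,8,11) m_even unfolding elim(9,10) by (rule alg)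
        qed
        also have "amp t \<xi> * (?p \<xi> + \<i> * ?q \<xi>) + bmp t \<xi> * (?p \<xi> - \<i> * ?q \<xi>) + ?I \<xi> = ?A \<xi> + \<i> * ?B \<xi>"
          unfolding I_eq by (simp add: amp_def bmp_def algebra_simps)
        finally have rhs: "rep_l2 (V t (E w0) + evolution.duhamel 0 t (\<lambda>\<sigma>. E (w \<sigma>))) \<xi> = of_real (m \<xi>) * (?A \<xi> + \<i> * ?B \<xi>)" .
        have lhs: "rep_l2 (E (w t)) \<xi> = of_real (m \<xi>) * (?P \<xi> + \<i> * ?Q \<xi>)"
          unfolding elim(1) elim(7) ..
        show ?case unfolding lhs rhs mult_cancel_left by simp
      qed
    qed
    finally show ?thesis .
  qed
  show ?thesis
    unfolding rhs
  proof
    assume "AE \<xi> in lborel. ?P \<xi> = ?A \<xi> \<and> ?Q \<xi> = ?B \<xi>"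
    then show "AE \<xi> in lborel. ?P \<xi> + \<i> * ?Q \<xi> = ?A \<xi> + \<i> * ?B \<xi>" by eventually_elim simp
  next
    assume e: "AE \<xi> in lborel. ?P \<xi> + \<i> * ?Q \<xi> = ?A \<xi> + \<i> * ?B \<xi>"
    show "AE \<xi> in lborel. ?P \<xi> = ?A \<xi> \<and> ?Q \<xi> = ?B \<xi>"
      using e lborel_AE_reflect[OF e] fourier_Re_Im(2,3)[OF L(1)] fourier_Re_Im(2,3)[OF L(2)]
    proof eventually_elim
      case (elim \<xi>)
      have A: "?A (- \<xi>) = cnj (?A \<xi>)" and B: "?B (- \<xi>) = cnj (?B \<xi>)"
        unfolding J_herm elim(3,4) by simp_all
      have "cnj (?P (- \<xi>) + \<i> * ?Q (- \<xi>)) = cnj (?A (- \<xi>) + \<i> * ?B (- \<xi>))"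
        using elim(2) by (rule arg_cong)
      then have 2: "?P \<xi> - \<i> * ?Q \<xi> = ?A \<xi> - \<i> * ?B \<xi>"
        unfolding A B elim(5,6) by simp
      show ?case by (rule eq_if_conjugate_sums_eq[OF elim(1) 2])
    qed
  qed
qed

section \<open>Well-posedness and blow-up\<close>

lemma is_solution_iff:
  assumes w0: "w0 \<in> Hs s"
  shows "is_solution s T w0 w \<longleftrightarrow> (\<forall>t\<in>{0..T}. w t \<in> Hs s) \<and> evolution.mild 0 T (E w0) (\<lambda>t. E (w t))"
proof (cases "(\<forall>t\<in>{0..T}. w t \<in> Hs s) \<and> continuous_on {0..T} (\<lambda>t. E (w t))")
  case True
  then show ?thesis
    unfolding is_solution_def C_Hs_iff evolution.mild_def diff_zero
    using duhamel_system_iff[OF w0, of T w] by (auto cong: ball_cong)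
next
  case False
  then show ?thesis by (auto simp: is_solution_def C_Hs_iff evolution.mild_def)
qed

lemma is_solution_D:
  "w0 \<in> Hs s \<Longrightarrow> is_solution s T w0 (\<lambda>t. D (u t)) \<longleftrightarrow> evolution.mild 0 T (E w0) u"
  by (simp add: is_solution_iff D_Hs)

lemma mild_imp_ex_unique_solution:
  assumes w0: "w0 \<in> Hs s" and u: "evolution.mild 0 T (E w0) u"
  shows "ex_unique_solution s T w0"
  unfolding ex_unique_solution_def
proof (intro exI[of _ "\<lambda>t. D (u t)"] conjI allI impI ballI)
  show "is_solution s T w0 (\<lambda>t. D (u t))" using u w0 by (simp add: is_solution_D)
  fix v t assume v: "is_solution s T w0 v" and t: "t \<in> {0..T}"
  then have "E (v t) = E (D (u t))"
    using evolution.mild_unique[OF _ u t, of "\<lambda>t. E (v t)"] w0 by (simp add: is_solution_iff)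
  then show "AE x in lborel. v t x = D (u t) x"
    using v t w0 by (subst E_eq_iff[symmetric]) (auto simp: D_Hs is_solution_iff)
qed

lemma ex_solution_iff:
  assumes w0: "w0 \<in> Hs s"
  shows "(\<exists>w. is_solution s T w0 w) \<longleftrightarrow> (\<exists>u. evolution.mild 0 T (E w0) u)"
  using is_solution_D[OF w0] is_solution_iff[OF w0] by blast

lemma mem_max_intervalI:
  assumes "0 < T" "is_solution s T w0 w" "t \<in> {0..T}"
  shows "t \<in> max_interval s w0"
  unfolding max_interval_def by (rule UnionI[OF _ assms(3)]) (use assms in blast)

lemma max_interval_downward:
  assumes "T \<in> max_interval s w0" "0 \<le> t" "t \<le> T"
  shows "t \<in> max_interval s w0"
proof -
  obtain T' w where "0 < T'" "T \<le> T'" "is_solution s T' w0 w"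
    using assms(1) by (auto simp: max_interval_def)
  then show ?thesis using assms by (intro mem_max_intervalI[of T' w0 w]) auto
qed

lemma mem_max_interval_iff:
  assumes w0: "w0 \<in> Hs s" and T: "0 < T"
  shows "T \<in> max_interval s w0 \<longleftrightarrow> (\<exists>u. evolution.mild 0 T (E w0) u)"
proof
  assume "T \<in> max_interval s w0"
  then obtain T' u where "T \<le> T'" "evolution.mild 0 T' (E w0) u"
    using ex_solution_iff[OF w0] unfolding max_interval_def by auto
  then show "\<exists>u. evolution.mild 0 T (E w0) u" by (blast intro: evolution.mild_subinterval)
next
  assume "\<exists>u. evolution.mild 0 T (E w0) u"
  then show "T \<in> max_interval s w0"
    using T ex_solution_iff[OF w0, of T] mem_max_intervalI[of T w0 _ T] by auto
qed

lemma max_interval_nonneg: "t \<in> max_interval s w0 \<Longrightarrow> 0 \<le> t"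
  by (auto simp: max_interval_def)

lemma local_well_posedness:
  assumes w0: "w0 \<in> Hs s"
  shows "\<exists>T0>0. \<forall>T. 0 < T \<and> T \<le> T0 \<longrightarrow> ex_unique_solution s T w0"
proof -
  obtain \<tau> where \<tau>: "0 < \<tau>" "\<And>a b. a \<le> b \<Longrightarrow> b - a \<le> \<tau> \<Longrightarrow> \<exists>u. evolution.mild a b (E w0) u"
    using evolution.local_existence[of "norm (E w0)"] by (metis order_refl)
  show ?thesis
  proof (intro exI[of _ \<tau>] conjI allI impI \<tau>)
    fix T assume "0 < T \<and> T \<le> \<tau>"
    then show "ex_unique_solution s T w0"
      using \<tau>(2)[of 0 T] mild_imp_ex_unique_solution[OF w0] by auto
  qed
qed

lemma small_data_well_posedness:
  assumes "0 < T"
  shows "\<exists>\<delta>>0. \<forall>w0\<in>Hs s. Hs_norm s w0 < \<delta> \<longrightarrow> ex_unique_solution s T w0"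
proof -
  obtain \<delta> where "0 < \<delta>" "\<And>u0. norm u0 < \<delta> \<Longrightarrow> \<exists>u. evolution.mild 0 T u0 u"
    using evolution.small_data_existence[OF assms] by blast
  then show ?thesis
    using mild_imp_ex_unique_solution by (intro exI[of _ \<delta>]) (auto simp: Hs_norm_eq)
qed

text \<open>For each time in the maximal interval some solution up to that time is chosen. By uniqueness
  these solutions agree where they overlap, so that the diagonal \<open>U t t\<close> is a solution.\<close>

lemma maximal_solution_exists:
  assumes w0: "w0 \<in> Hs s"
  shows "\<exists>w. is_maximal_solution s w0 w"
proof -
  let ?I = "max_interval s w0"
  have "\<exists>u. evolution.mild 0 T (E w0) u" if "T \<in> ?I" for T
  proof (cases "0 < T")
    case True
    then show ?thesis using mem_max_interval_iff[OF w0] that by simp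
  next
    case False
    then have "T = 0" using max_interval_nonneg[OF that] by simp
    then have "evolution.mild 0 T (E w0) (\<lambda>_. E w0)" by (simp add: evolution.mild_def evolution.duhamel_def V_0)
    then show ?thesis by blast
  qed
  then obtain U where U: "\<And>T. T \<in> ?I \<Longrightarrow> evolution.mild 0 T (E w0) (U T)" by metis
  have "evolution.mild 0 T (E w0) (\<lambda>t. U t t)" if T: "T \<in> ?I" for T
  proof -
    have "U t t = U T t" if t: "t \<in> {0..T}" for t
    proof -
      have "t \<in> ?I" using t by (intro max_interval_downward[OF T]) auto
      then show ?thesis
        using t U[OF T] by (intro evolution.mild_unique[OF U]) (auto intro: evolution.mild_subinterval)
    qed
    then show ?thesis using U[OF T] by (subst evolution.mild_cong) auto
  qed
  then have "is_maximal_solution s w0 (\<lambda>t. D (U t t))"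
    by (simp add: is_maximal_solution_def is_solution_D[OF w0])
  then show ?thesis by blast
qed

text \<open>The solution exists up to every time below the supremum, and no solution exists beyond it,
  so that the blow-up alternative in the Banach space applies.\<close>

lemma maximal_solution_blows_up:
  assumes w0: "w0 \<in> Hs s" and w: "is_maximal_solution s w0 w" and bdd: "bdd_above (max_interval s w0)"
  shows "filterlim (\<lambda>t. Hs_norm s (w t)) at_top (at_left (Sup (max_interval s w0)))"
proof -
  let ?I = "max_interval s w0"
  define Ts where "Ts = Sup ?I"
  obtain T0 where T0: "0 < T0" "ex_unique_solution s T0 w0"
    using local_well_posedness[OF w0] by blast
  then have "T0 \<in> ?I"
    using mem_max_intervalI[of T0 w0 _ T0] by (auto simp: ex_unique_solution_def)
  then have Ts: "0 < Ts" using T0(1) cSup_upper[OF _ bdd] by (force simp: Ts_def)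
  have sol: "is_solution s T w0 w" if T: "0 < T" "T < Ts" for T
  proof -
    have "T < Sup ?I" "?I \<noteq> {}" using T \<open>T0 \<in> ?I\<close> unfolding Ts_def by blast+
    then obtain T' where "T' \<in> ?I" "T < T'"
      by (metis less_cSup_iff bdd)
    then have "T \<in> ?I" using T by (intro max_interval_downward[OF \<open>T' \<in> ?I\<close>]) auto
    then show ?thesis using w by (simp add: is_maximal_solution_def)
  qed
  have "filterlim (\<lambda>t. norm (E (w t))) at_top (at_left Ts)"
  proof (rule evolution.blow_up_alternative[OF Ts])
    show "evolution.mild 0 T (E w0) (\<lambda>t. E (w t))" if "0 < T" "T < Ts" for T
      using sol[OF that] by (simp add: is_solution_iff[OF w0])
    show "\<not> evolution.mild 0 T (E w0) v" if "Ts < T" for T v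
      using that Ts mem_max_interval_iff[OF w0, of T] cSup_upper[OF _ bdd, of T] by (auto simp: Ts_def)
  qed
  moreover have "\<forall>\<^sub>F t in at_left Ts. norm (E (w t)) = Hs_norm s (w t)"
    unfolding eventually_at_left_field
  proof (intro exI[of _ 0] conjI allI impI Ts)
    fix t assume "0 < t" "t < Ts"
    then have "w t \<in> Hs s" using sol[of t] by (simp add: is_solution_iff[OF w0])
    then show "norm (E (w t)) = Hs_norm s (w t)" by (simp add: Hs_norm_eq)
  qed
  ultimately show ?thesis
    unfolding Ts_def[symmetric] by (subst filterlim_cong[OF refl refl]) (auto elim: eventually_mono)
qed

end

theorem theorem1p1:
  fixes s :: real
  assumes "s > 1 / 2"
  shows "(\<forall>T>0. \<exists>\<delta>>0. \<forall>w0\<in>Hs s. Hs_norm s w0 < \<delta> \<longrightarrow> ex_unique_solution s T w0)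
    \<and> (\<forall>w0\<in>Hs s. \<exists>T0>0. \<forall>T. 0 < T \<and> T \<le> T0 \<longrightarrow> ex_unique_solution s T w0)
    \<and> (\<forall>w0\<in>Hs s.
         (\<exists>w. is_maximal_solution s w0 w) \<and>
         (\<forall>w. is_maximal_solution s w0 w \<and> bdd_above (max_interval s w0) \<longrightarrow>
            filterlim (\<lambda>t. Hs_norm s (w t)) at_top (at_left (Sup (max_interval s w0)))))"
proof -
  interpret sobolev s by unfold_locales (use assms in simp)
  show ?thesis
    using small_data_well_posedness local_well_posedness maximal_solution_exists maximal_solution_blows_up
    by blast
qed

end
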